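(* The following three statements hold. (1) Let $d\in\mathbb{Z}\setminus\{0\}$ be tenth-power free with $d\equiv 1,7,9\pmod{11}$, and let $C_d$ be the hyperelliptic curve $y^2=x^5+d$ over $\mathbb{Q}$, with Jacobian $J$. If $\operatorname{rank}J(\mathbb{Q})=0$, then $$C_d(\mathbb{Q})=\begin{cases} \{P_\infty\} & \text{if } d\equiv 7 \pmod{11},\\ \{(0,\pm\sqrt d),P_\infty\} & \text{if } d\equiv 9\pmod{11} \text{ and } d \text{ is a perfect square},\\ \{P_\infty\} & \text{if } d\equiv 9\pmod{11}\text{ and } d \text{ is not a perfect square},\\ \{(0,\pm\sqrt d),P_\infty\} & \text{if } d\equiv 1\pmod{11},\ d \text{ is a perfect square and is not a fifth power},\\ \{(-\sqrt[5]{d},0),P_\infty\} & \text{if } d\equiv 1\pmod{11},\ d \text{ is not a perfect square and is a fifth power},\\ \{P_\infty\} & \text{if } d\equiv 1\pmod{11},\ d \text{ is not a perfect square and is not a fifth power}. \end{cases}$$ (2) Let $p\ge 7$ be a prime with $p\equiv 3\pmod 4$, let $d\in p\mathbb{Z}$, and let $D_d$ be the hyperelliptic curve $y^2=f(x):=x^{p-1}+dx^{\frac{p-1}{2}}-1$ over $\mathbb{Q}$, with Jacobian $J$. If $\operatorname{rank}J(\mathbb{Q})=0$, then $$D_d(\mathbb{Q})\subseteq\{(\alpha,0) \mid \alpha\in\overline{\mathbb{Q}},\ f(\alpha)=0\}\cup\{P_{+\infty},P_{-\infty}\}.$$ (3) Let $p\ge 5$ be a prime and let $C$ be the hyperelliptic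 curve $y^2=x^p-x$ over $\mathbb{Q}$, with Jacobian $J$. If $\operatorname{rank}J(\mathbb{Q})=0$, then $$C(\mathbb{Q})=\{(0,0),(1,0),(-1,0),P_\infty\}.$$
   Context: A hyperelliptic curve given by an affine equation $y^2=f(x)$, with $f\in\mathbb{Q}[x]$ squarefree of degree $2g+1$ or $2g+2$, means the smooth projective curve of genus $g$ obtained by gluing the affine curve $y^2=f(x)$ with the affine curve $w^2=v^{2g+2}f(1/v)$ via $(v,w)=(x^{-1},yx^{-(g+1)})$. If $\deg f=2g+1$, there is a single point at infinity $P_\infty$, namely $(v,w)=(0,0)$, and it is rational. If $\deg f=2g+2$ with leading coefficient $a_0$, there are two points at infinity $P_{\pm\infty}$, namely $(v,w)=(0,\pm\sqrt{a_0})$; they are rational when $a_0$ is a square in $\mathbb{Q}$ (here $a_0=1$). "Perfect square" and "fifth power" refer to squares and fifth powers of integers; $\sqrt[5]{d}$ is the real fifth root. "Tenth-power free" means not divisible by $n^{10}$ for any integer $n\geq 2$. *)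

theory Defs
  imports
    Complex_Main
    "HOL-Number_Theory.Cong"
    "HOL-Library.Extended_Nat"
    "HOL-Computational_Algebra.Nth_Powers"
    "HOL-Computational_Algebra.Fraction_Field"
    "HOL-Algebra.Ideal"
    "HOL-Algebra.Free_Abelian_Groups"
    "HOL-Algebra.Algebraic_Closure_Type"
begin

section \<open>Hyperelliptic curves and their points\<close>

text \<open>
  The curve is given by \<open>f\<close> alone, which is meant to be squarefree of degree \<open>2g+1\<close> or \<open>2g+2\<close>.
  The polynomial \<open>inf_poly f\<close> is \<open>v^(2g+2) f(1/v)\<close>.
\<close>

definition genus :: "'a::field poly \<Rightarrow> nat" where
  "genus f = (degree f - 1) div 2"

definition inf_poly :: "'a::field poly \<Rightarrow> 'a poly" where
  "inf_poly f = monom 1 (2 * genus f + 2 - degree f) * reflect_poly f"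

text \<open>
  The points of the glued curve are the affine points \<open>(x, y)\<close> together with the points
  \<open>(v, w) = (0, w)\<close> of the second chart; \<open>Infty w\<close> is the latter. So \<open>P\<^sub>\<infinity>\<close> is \<open>Infty 0\<close>, and
  for monic \<open>f\<close> of even degree the points at infinity are \<open>Infty 1\<close> and \<open>Infty (-1)\<close>.
\<close>

datatype 'a hpoint = Affine 'a 'a | Infty 'a

fun on_curve :: "'a::field poly \<Rightarrow> 'a hpoint \<Rightarrow> bool" where
  "on_curve f (Affine x y) \<longleftrightarrow> y ^ 2 = poly f x"
| "on_curve f (Infty w) \<longleftrightarrow> w ^ 2 = poly (inf_poly f) 0"

text \<open>The points with coordinates in the coefficient field \<open>'a\<close>.\<close>

definition curve_points :: "'a::field poly \<Rightarrow> 'a hpoint set" where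
  "curve_points f = {P. on_curve f P}"


section \<open>The function field and orders of vanishing\<close>

text \<open>
  The function field \<open>K(x)[y]/(y\<^sup>2 - f)\<close>: the pair \<open>(a, b)\<close> stands for \<open>a + b y\<close>.
\<close>

type_synonym 'a ratfun = "'a poly fract \<times> 'a poly fract"

definition function_field :: "'a::field poly \<Rightarrow> 'a ratfun ring" where
  "function_field f =
     \<lparr>carrier = UNIV,
      monoid.mult = (\<lambda>(a, b) (c, d). (a * c + Fract f 1 * (b * d), a * d + b * c)),
      one = (1, 0),
      zero = (0, 0),
      add = (\<lambda>(a, b) (c, d). (a + c, b + d))\<rparr>"

text \<open>
  A pair \<open>(p, q)\<close> of polynomials stands for \<open>p(x) + q(x) y\<close> in the coordinate ring of the
  affine chart, and for \<open>p(v) + q(v) w\<close> in that of the chart at infinity.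
  \<open>chart_fun f P\<close> is the corresponding element of the function field, in the chart to which
  \<open>P\<close> belongs (with \<open>v = 1/x\<close> and \<open>w = y/x^(g+1)\<close>), and \<open>chart_val P\<close> is its value at \<open>P\<close>.
\<close>

definition eval_inv_x :: "'a::field poly \<Rightarrow> 'a poly fract" where
  "eval_inv_x p = poly (map_poly (\<lambda>c. Fract [:c:] 1) p) (Fract 1 [:0, 1:])"

fun chart_fun :: "'a::field poly \<Rightarrow> 'a hpoint \<Rightarrow> 'a poly \<times> 'a poly \<Rightarrow> 'a ratfun" where
  "chart_fun f (Affine x y) (p, q) = (Fract p 1, Fract q 1)"
| "chart_fun f (Infty w) (p, q) =
     (eval_inv_x p, eval_inv_x q * Fract 1 [:0, 1:] ^ (genus f + 1))"

fun chart_val :: "'a::field hpoint \<Rightarrow> 'a poly \<times> 'a poly \<Rightarrow> 'a" where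
  "chart_val (Affine x y) (p, q) = poly p x + poly q x * y"
| "chart_val (Infty w) (p, q) = poly p 0 + poly q 0 * w"

text \<open>The local ring at \<open>P\<close>: fractions \<open>A/B\<close> of chart functions with \<open>B(P) \<noteq> 0\<close>.\<close>

definition local_ring :: "'a::field poly \<Rightarrow> 'a hpoint \<Rightarrow> 'a ratfun ring" where
  "local_ring f P = (function_field f)
     \<lparr>carrier := {h. \<exists>A B. chart_val P B \<noteq> 0 \<and>
        h \<otimes>\<^bsub>function_field f\<^esub> chart_fun f P B = chart_fun f P A}\<rparr>"

definition local_max_ideal :: "'a::field poly \<Rightarrow> 'a hpoint \<Rightarrow> 'a ratfun set" where
  "local_max_ideal f P = {h. \<exists>A B. chart_val P B \<noteq> 0 \<and> chart_val P A = 0 \<and>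
     h \<otimes>\<^bsub>function_field f\<^esub> chart_fun f P B = chart_fun f P A}"

text \<open>
  The local ring at a point of the (smooth) curve is a discrete valuation ring; \<open>ord_at f P h\<close>
  is the exponent \<open>n\<close> in \<open>h = u t^n\<close> with \<open>t\<close> a uniformizer and \<open>u\<close> a unit, for nonzero \<open>h\<close>.
\<close>

definition ord_at :: "'a::field poly \<Rightarrow> 'a hpoint \<Rightarrow> 'a ratfun \<Rightarrow> int" where
  "ord_at f P h = (THE n. \<exists>t u.
     t \<in> carrier (local_ring f P) \<and>
     local_max_ideal f P = cgenideal (local_ring f P) t \<and>
     u \<in> Units (local_ring f P) \<and>
     h = u \<otimes>\<^bsub>function_field f\<^esub> (t [^]\<^bsub>function_field f\<^esub> n))"


section \<open>The Picard group and the rational points of the Jacobian\<close>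

text \<open>In this section's divisor groups the field \<open>'a\<close> is meant to be algebraically closed.\<close>

definition divisor_degree :: "('a hpoint \<Rightarrow>\<^sub>0 int) \<Rightarrow> int" where
  "divisor_degree D = (\<Sum>P\<in>Poly_Mapping.keys D. Poly_Mapping.lookup D P)"

definition div0_group :: "'a::field poly \<Rightarrow> ('a hpoint \<Rightarrow>\<^sub>0 int) monoid" where
  "div0_group f = (free_Abelian_group (curve_points f))
     \<lparr>carrier := {D \<in> carrier (free_Abelian_group (curve_points f)). divisor_degree D = 0}\<rparr>"

definition principal_divisors :: "'a::field poly \<Rightarrow> ('a hpoint \<Rightarrow>\<^sub>0 int) set" where
  "principal_divisors f = {D \<in> carrier (free_Abelian_group (curve_points f)).
     \<exists>h. h \<noteq> \<zero>\<^bsub>function_field f\<^esub> \<and>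
         (\<forall>P\<in>curve_points f. Poly_Mapping.lookup D P = ord_at f P h)}"

definition pic0 :: "'a::field poly \<Rightarrow> ('a hpoint \<Rightarrow>\<^sub>0 int) set monoid" where
  "pic0 f = div0_group f Mod principal_divisors f"

text \<open>The absolute Galois group of \<open>\<rat>\<close>, acting on \<open>rat alg_closure\<close>.\<close>

definition galois_Q :: "(rat alg_closure \<Rightarrow> rat alg_closure) set" where
  "galois_Q = {\<sigma>. bij \<sigma> \<and> (\<forall>x y. \<sigma> (x + y) = \<sigma> x + \<sigma> y) \<and>
     (\<forall>x y. \<sigma> (x * y) = \<sigma> x * \<sigma> y) \<and> (\<forall>q. \<sigma> (to_ac q) = to_ac q)}"

definition conj_divisor :: "('a \<Rightarrow> 'a) \<Rightarrow> ('a hpoint \<Rightarrow>\<^sub>0 int) \<Rightarrow> ('a hpoint \<Rightarrow>\<^sub>0 int)" where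
  "conj_divisor \<sigma> D = frag_extend (\<lambda>P. frag_of (map_hpoint \<sigma> P)) D"

text \<open>
  For the Jacobian \<open>J\<close> of the curve over \<open>\<rat>\<close> one has \<open>J(\<rat>) = Pic\<^sup>0(C)^Gal\<close>, where the Picard
  group is that of the curve over the algebraic closure. Divisor classes are cosets, on which
  the Galois group acts by taking images.
\<close>

definition jacobian_Q :: "rat poly \<Rightarrow> (rat alg_closure hpoint \<Rightarrow>\<^sub>0 int) set monoid" where
  "jacobian_Q f = (pic0 (map_poly to_ac f))
     \<lparr>carrier := {c \<in> carrier (pic0 (map_poly to_ac f)). \<forall>\<sigma>\<in>galois_Q. conj_divisor \<sigma> ` c = c}\<rparr>"


section \<open>The rank of an abelian group\<close>

definition Z_independent :: "('g, 'm) monoid_scheme \<Rightarrow> 'g set \<Rightarrow> bool" where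
  "Z_independent G S \<longleftrightarrow> finite S \<and> S \<subseteq> carrier G \<and>
     (\<forall>n :: 'g \<Rightarrow> int. finprod G (\<lambda>a. a [^]\<^bsub>G\<^esub> n a) S = \<one>\<^bsub>G\<^esub> \<longrightarrow> (\<forall>a\<in>S. n a = 0))"

definition abelian_rank :: "('g, 'm) monoid_scheme \<Rightarrow> enat" where
  "abelian_rank G = Sup {enat (card S) | S. Z_independent G S}"


section \<open>The families of curves\<close>

definition tenth_power_free :: "int \<Rightarrow> bool" where
  "tenth_power_free d \<longleftrightarrow> (\<forall>n\<ge>2. \<not> n ^ 10 dvd d)"

definition C_poly :: "int \<Rightarrow> rat poly" where
  "C_poly d = monom 1 5 + [:of_int d:]"

definition D_poly :: "nat \<Rightarrow> int \<Rightarrow> rat poly" where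
  "D_poly p d = monom 1 (p - 1) + monom (of_int d) ((p - 1) div 2) - 1"

definition E_poly :: "nat \<Rightarrow> rat poly" where
  "E_poly p = monom 1 p - monom 1 1"

end

(*
  If f has good reduction at p and two rational points P, T of the curve lie in the same residue disc, and
  rank J(Q) = 0, then n(P - T) = div h for some n > 0. Scale h so that it reduces to a nonzero constant modulo p
  and write h = 1 + p^k G with G not constant modulo p. With s = 0 at P and s = -b at T, the expansion of h in the
  disc is (1 + b/s)^(-n) or its inverse times a unit, and for odd p all terms of the binomial series beyond the
  linear one have a larger valuation than n b. Hence G reduces to a function with at most one simple pole, which
  must be constant because the genus is positive; so P = T. This is applied to P and its conjugate when P reduces
  to a Weierstrass point (also at infinity), to P and a rational point at infinity, and, on y^2 = x^5 + d with x
  divisible by 11, to 10 m P and the divisor of (y - y(P))^(2m).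

  The function h is found over the algebraic closure of Q: with polynomial coordinates A + B y, it satisfies linear
  conditions with rational coefficients, so a Q-linear functional applied to the coefficients makes it rational.
*)
theory Submission
  imports
    Defs
    "HOL-Computational_Algebra.Formal_Power_Series"
    "HOL-Computational_Algebra.Polynomial_FPS"
    "HOL-Number_Theory.Residues"
begin

unbundle fps_syntax

section \<open>Evaluation of polynomials in power series\<close>

text \<open>The curve modulo p is never formed. Multiplied by a function that moves its poles to
  infinity, h becomes a pair of polynomials in a linear space given by degree bounds; its reduction
  consists of the residues of finitely many coefficients, and its zeros are read off from one
  expansion over the local ring at p. There h is compared with a reference function E of the same
  space: (x - x(P))^n for P and its conjugate, v^n in the chart at infinity, (y - y(P))^(2 m) in the
  last case. The genus enters through the bound on the degree of B, which lies g + 1 below that of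
  A. The last case arises because the disc of points with x divisible by 11 may contain no second
  known rational point: d is a square modulo 11, but perhaps not an integer square. The five zeros
  (z x(P), y(P)) of y - y(P), with z^5 = 1, all lie in the disc of P and serve instead; hence the
  multiples of 5, and the need for 5 to be a unit at p. Orders of vanishing are defined by
  uniformizers of local rings; they are identified with orders of power series before anything is
  computed.\<close>

locale coeff_hom =
  fixes g :: "'a::comm_ring_1 \<Rightarrow> 'b::comm_ring_1"
  assumes add: "g (x + y) = g x + g y"
    and mult: "g (x * y) = g x * g y"
    and one: "g 1 = 1"
begin

lemma zero: "g 0 = 0"
  using add[of 0 0] by simp

lemma minus: "g (- x) = - g x"
  using add[of x "- x"] zero by (simp add: eq_neg_iff_add_eq_0 add.commute)

lemma diff: "g (x - y) = g x - g y"
  using add[of x "- y"] minus by simp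

lemma of_nat: "g (of_nat n) = of_nat n"
  by (induction n) (simp_all add: zero one add)

lemma power: "g (x ^ n) = g x ^ n"
  by (induction n) (simp_all add: one mult)

lemma sum: "g (\<Sum>i\<in>A. h i) = (\<Sum>i\<in>A. g (h i))"
  by (induction A rule: infinite_finite_induct) (simp_all add: zero add)

text \<open>Evaluation through a coefficient map, used among others with \<open>fps_const\<close>,
  with the constants of the rational function field and with \<open>to_ac\<close>, so that the ring
  laws are proved once.\<close>

definition ev :: "'a poly \<Rightarrow> 'b \<Rightarrow> 'b" where
  "ev p x = poly (map_poly g p) x"

lemma ev_0 [simp]: "ev 0 x = 0"
  by (simp add: ev_def)

lemma ev_pCons [simp]: "ev (pCons a p) x = g a + x * ev p x"
  by (simp add: ev_def map_poly_pCons zero)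

lemma ev_1 [simp]: "ev 1 x = 1"
  by (simp add: one_pCons one del: pCons_one)

lemma ev_add: "ev (p + q) x = ev p x + ev q x"
  by (induction p q rule: poly_induct2) (simp_all add: add algebra_simps)

lemma ev_smult: "ev (smult c p) x = g c * ev p x"
  by (induction p) (simp_all add: mult algebra_simps)

lemma ev_mult: "ev (p * q) x = ev p x * ev q x"
  by (induction p) (simp_all add: ev_add ev_smult zero algebra_simps)

lemma ev_minus: "ev (- p) x = - ev p x"
  using ev_smult[of "- 1" p x] by (simp add: minus one)

lemma ev_diff: "ev (p - q) x = ev p x - ev q x"
  using ev_add[of p "- q" x] ev_minus by simp

lemma ev_power: "ev (p ^ n) x = ev p x ^ n"
  by (induction n) (simp_all add: ev_mult)

lemma ev_monom: "ev (monom c n) x = g c * x ^ n"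
  by (induction n) (simp_all add: monom_0 monom_Suc zero algebra_simps)

lemma ev_hom: "ev p (g x) = g (poly p x)"
  by (induction p) (simp_all add: zero add mult)

lemma ev_altdef: "ev p x = (\<Sum>i\<le>degree p. g (coeff p i) * x ^ i)"
proof -
  have "ev p x = ev (\<Sum>i\<le>degree p. monom (coeff p i) i) x"
    by (simp add: poly_as_sum_of_monoms)
  also have "\<dots> = (\<Sum>i\<le>degree p. g (coeff p i) * x ^ i)"
  proof -
    have "ev (\<Sum>i\<in>A. h i) x = (\<Sum>i\<in>A. ev (h i) x)" if "finite A" for A :: "nat set" and h
      using that by (induction rule: finite_induct) (simp_all add: ev_add)
    then show ?thesis
      by (simp add: ev_monom)
  qed
  finally show ?thesis .
qed

lemma ev_pcompose: "ev (pcompose p q) x = ev p (ev q x)"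
  by (induction p) (simp_all add: pcompose_pCons ev_add ev_mult zero)

end

interpretation fps_ev: coeff_hom "fps_const :: 'a::comm_ring_1 \<Rightarrow> 'a fps"
  by unfold_locales simp_all

abbreviation pev :: "'a::comm_ring_1 poly \<Rightarrow> 'a fps \<Rightarrow> 'a fps" where
  "pev \<equiv> fps_ev.ev"

lemma pev_nth_0: "pev p U $ 0 = poly p (U $ 0)"
  by (induction p) simp_all

lemma pev_root_factor:
  "pev p U - fps_const (poly p a) = (U - fps_const a) * pev (synthetic_div p a) U"
proof -
  have "p + smult a (synthetic_div p a) = pCons (poly p a) (synthetic_div p a)"
    by (rule synthetic_div_correct)
  then have "pev (p + smult a (synthetic_div p a)) U = pev (pCons (poly p a) (synthetic_div p a)) U"
    by simp
  then show ?thesis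
    by (simp add: fps_ev.ev_add fps_ev.ev_smult algebra_simps)
qed

text \<open>The quotient of p - p(a) by X - a takes at a the value of the derivative: differentiate
  the division identity and evaluate at a.\<close>

lemma poly_synthetic_div: "poly (synthetic_div p a) a = poly (pderiv p) (a::'a::idom)"
proof -
  have "p + smult a (synthetic_div p a) = pCons (poly p a) (synthetic_div p a)"
    by (rule synthetic_div_correct)
  then have "pderiv (p + smult a (synthetic_div p a)) = pderiv (pCons (poly p a) (synthetic_div p a))"
    by simp
  then have "poly (pderiv (p + smult a (synthetic_div p a))) a
     = poly (pderiv (pCons (poly p a) (synthetic_div p a))) a"
    by simp
  then show ?thesis by (simp add: pderiv_add pderiv_smult pderiv_pCons)
qed

lemma subdegree_pos_iff: "U \<noteq> 0 \<Longrightarrow> subdegree U \<ge> 1 \<longleftrightarrow> U $ 0 = 0"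
  using subdegree_eq_0_iff[of U] by (auto simp: Suc_le_eq)

text \<open>Once the full power of X - x1 is split off from p, the remaining factor has a nonzero
  constant term along U. The order of U - x1 is the ramification index of x.\<close>

lemma pev_nonzero_subdegree:
  fixes U :: "'a::field_char_0 fps"
  assumes "p \<noteq> 0" "U \<noteq> fps_const x1" "U $ 0 = x1"
  shows "pev p U \<noteq> 0 \<and> subdegree (pev p U) = order x1 p * subdegree (U - fps_const x1)"
proof -
  obtain q where q: "p = [:- x1, 1:] ^ order x1 p * q" "\<not> [:- x1, 1:] dvd q"
    using order_decomp[OF assms(1)] by blast
  have e: "pev p U = (U - fps_const x1) ^ order x1 p * pev q U"
    by (subst q(1)) (simp add: fps_ev.ev_mult fps_ev.ev_power flip: fps_const_neg)
  have q0: "pev q U $ 0 \<noteq> 0"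
    using q(2) assms(3) by (simp add: pev_nth_0 poly_eq_0_iff_dvd)
  then have "pev q U \<noteq> 0" by auto
  moreover have "subdegree (pev q U) = 0"
    using q0 by (simp add: subdegree_eq_0)
  ultimately show ?thesis
    using e assms(2) by (simp add: subdegree_mult subdegree_power)
qed

text \<open>A local parametrisation of \<open>y\<^sup>2 = f\<close> at \<open>(x, y)\<close>; the last condition says that it is unramified.\<close>

definition param :: "'a::field poly \<Rightarrow> 'a \<Rightarrow> 'a \<Rightarrow> 'a fps \<Rightarrow> 'a fps \<Rightarrow> bool" where
  "param f x y U V \<longleftrightarrow> U $ 0 = x \<and> V $ 0 = y \<and> V\<^sup>2 = pev f U \<and> (U $ 1 \<noteq> 0 \<or> V $ 1 \<noteq> 0)"

lemma param_on_curve: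
  assumes "param f x y U V"
  shows "y\<^sup>2 = poly f x"
proof -
  have "(V\<^sup>2) $ 0 = pev f U $ 0"
    using assms by (simp add: param_def)
  then show ?thesis
    using assms by (simp add: param_def pev_nth_0 power2_eq_square)
qed

text \<open>Comparing linear coefficients in V^2 = f(U) gives 2 y V_1 = f'(x) U_1: for y \<noteq> 0
  a vanishing U_1 would make V_1 vanish too.\<close>

lemma param_simple:
  fixes U :: "'a::field_char_0 fps"
  assumes "param f x y U V" "y \<noteq> 0"
  shows "U - fps_const x \<noteq> 0 \<and> subdegree (U - fps_const x) = 1"
proof -
  let ?q = "synthetic_div f x"
  have y: "y\<^sup>2 = poly f x"
    using assms(1) by (rule param_on_curve)
  have "V\<^sup>2 - fps_const (y\<^sup>2) = (U - fps_const x) * pev ?q U"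
    using assms(1) y pev_root_factor[of f U x] by (simp add: param_def)
  then have "(V\<^sup>2 - fps_const (y\<^sup>2)) $ 1 = ((U - fps_const x) * pev ?q U) $ 1"
    by simp
  then have "2 * y * V $ 1 = U $ 1 * pev ?q U $ 0"
    using assms(1) by (simp add: param_def power2_eq_square fps_mult_nth mult.assoc)
  then have X1: "U $ 1 \<noteq> 0"
    using assms by (auto simp: param_def)
  then have ne: "(U - fps_const x) $ 1 \<noteq> 0" by simp
  have "subdegree (U - fps_const x) = 1"
    by (rule subdegreeI) (use ne assms(1) in \<open>auto simp: param_def\<close>)
  then show ?thesis using ne by auto
qed

text \<open>With q = (f - f(x))/(X - x) one has V^2 = (U - x) q(U), and q(U) is a unit; so U - x has
  twice the order of V. As the parametrisation is unramified, the order of V is 1.\<close>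

lemma param_weierstrass:
  fixes U :: "'a::field_char_0 fps"
  assumes "param f x 0 U V" "poly (pderiv f) x \<noteq> 0"
  shows "V \<noteq> 0 \<and> subdegree V = 1 \<and> U - fps_const x \<noteq> 0 \<and> subdegree (U - fps_const x) = 2"
proof -
  let ?q = "synthetic_div f x"
  have y: "poly f x = 0"
    using param_on_curve[OF assms(1)] by simp
  have e: "V\<^sup>2 = (U - fps_const x) * pev ?q U"
    using assms(1) y pev_root_factor[of f U x] by (simp add: param_def)
  have q0: "pev ?q U $ 0 \<noteq> 0"
    using assms by (simp add: pev_nth_0 param_def poly_synthetic_div)
  then have q1: "pev ?q U \<noteq> 0" "subdegree (pev ?q U) = 0"
    by (auto simp: subdegree_eq_0)
  have ne: "V \<noteq> 0"
  proof
    assume "V = 0"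
    then have "U - fps_const x = 0" using e q1 by simp
    then show False using assms(1) \<open>V = 0\<close> by (auto simp: param_def)
  qed
  have ne2: "U - fps_const x \<noteq> 0"
    using e ne by auto
  have s: "2 * subdegree V = subdegree (U - fps_const x)"
    using arg_cong[OF e, of subdegree] ne ne2 q1 by (simp add: subdegree_mult subdegree_power)
  have "V $ 1 \<noteq> 0"
  proof (rule ccontr)
    assume "\<not> V $ 1 \<noteq> 0"
    then have "(U - fps_const x) $ 1 \<noteq> 0" using assms(1) by (simp add: param_def)
    then have "subdegree (U - fps_const x) \<le> 1" by (rule subdegree_leI)
    moreover have "subdegree V \<ge> 1"
      using assms(1) ne subdegree_pos_iff[of V] by (simp add: param_def)
    ultimately show False using s by simp
  qed
  then have "subdegree V = 1"
    using assms(1) by (intro subdegreeI) (auto simp: param_def)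
  then show ?thesis using s ne ne2 by simp
qed

lemma fps_sqrt_exists:
  fixes F :: "'a::field_char_0 fps"
  assumes "F $ 0 = y\<^sup>2" "y \<noteq> 0"
  shows "\<exists>V. V $ 0 = y \<and> V\<^sup>2 = F"
proof -
  let ?r = "\<lambda>_ _. y"
  have "fps_radical ?r (Suc 1) F ^ Suc 1 = F"
    using assms by (subst power_radical[symmetric]) (simp_all add: power2_eq_square)
  moreover have "fps_radical ?r (Suc 1) F $ 0 = y" by simp
  ultimately show ?thesis
    by (metis Suc_1)
qed

lemma pev_compose:
  fixes U :: "'a::field_char_0 fps"
  assumes "U $ 0 = 0" shows "pev p U = fps_of_poly p oo U"
  using assms
  by (induction p) (simp_all add: fps_of_poly_pCons fps_compose_add_distrib fps_compose_mult_distrib)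

text \<open>Formal inverse function theorem: shifted to the origin, f has a compositional inverse
  because its linear coefficient f'(x) is nonzero.\<close>

lemma pev_solve:
  fixes H :: "'a::field_char_0 fps"
  assumes "poly f x = H $ 0" "poly (pderiv f) x \<noteq> 0"
  shows "\<exists>U. U $ 0 = x \<and> pev f U = H"
proof -
  define q where "q = pcompose f [:x, 1:] - [:poly f x:]"
  let ?Q = "fps_of_poly q"
  have q0: "?Q $ 0 = 0"
    by (simp add: q_def poly_0_coeff_0[symmetric] poly_pcompose)
  have "coeff q 1 = poly (pderiv q) 0"
    by (simp add: poly_0_coeff_0 coeff_pderiv)
  also have "\<dots> = poly (pderiv f) x"
    by (simp add: q_def pderiv_diff pderiv_pcompose poly_pcompose pderiv_pCons)
  finally have q1: "?Q $ 1 \<noteq> 0"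
    using assms(2) by simp
  define Z where "Z = fps_inv ?Q oo (H - fps_const (H $ 0))"
  have Z0: "Z $ 0 = 0" by (simp add: Z_def fps_inv_def)
  have "?Q oo Z = (?Q oo fps_inv ?Q) oo (H - fps_const (H $ 0))"
    unfolding Z_def by (rule fps_compose_assoc) (simp_all add: fps_inv_def)
  also have "\<dots> = H - fps_const (H $ 0)"
    using fps_inv_right[OF q0 q1] by simp
  finally have "pev q Z = H - fps_const (H $ 0)"
    using pev_compose[OF Z0] by simp
  then have "pev f (Z + fps_const x) = H"
    using assms(1) by (simp add: q_def fps_ev.ev_diff fps_ev.ev_pcompose add.commute)
  then show ?thesis using Z0 by (intro exI[of _ "Z + fps_const x"]) simp
qed

text \<open>At a point with y = 0 the coordinate is y itself and x is solved for; elsewhere the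
  coordinate is x up to a constant and y is a square root of a series.\<close>

lemma param_exists:
  fixes f :: "'a::field_char_0 poly"
  assumes "y\<^sup>2 = poly f x" "y = 0 \<Longrightarrow> poly (pderiv f) x \<noteq> 0"
  shows "\<exists>U V. param f x y U V"
proof (cases "y = 0")
  case True
  obtain U where "U $ 0 = x" "pev f U = fps_X\<^sup>2"
    using pev_solve[of f x "fps_X\<^sup>2"] assms True by (auto simp: power2_eq_square)
  then show ?thesis
    using True by (intro exI[of _ U] exI[of _ fps_X]) (simp add: param_def)
next
  case False
  obtain V where "V $ 0 = y" "V\<^sup>2 = pev f (fps_X + fps_const x)"
    using fps_sqrt_exists[of "pev f (fps_X + fps_const x)" y] assms False
    by (auto simp: pev_nth_0)
  then show ?thesis
    by (intro exI[of _ "fps_X + fps_const x"] exI[of _ V]) (simp add: param_def)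
qed

section \<open>The function field and its valuations\<close>

text \<open>Equivalently, f is not a square in the field of fractions; stated without
  denominators.\<close>

definition nonsquare :: "'a::field poly \<Rightarrow> bool" where
  "nonsquare f \<longleftrightarrow> (\<forall>a b. a\<^sup>2 = f * b\<^sup>2 \<longrightarrow> b = 0)"

text \<open>The product of a + b y and c + d y when y^2 = f, over an arbitrary ring, so that it
  serves both the coordinate rings and the function field.\<close>

definition pair_mult :: "'a::comm_ring_1 \<Rightarrow> 'a \<times> 'a \<Rightarrow> 'a \<times> 'a \<Rightarrow> 'a \<times> 'a" where
  "pair_mult f u v = (fst u * fst v + f * (snd u * snd v), fst u * snd v + snd u * fst v)"

lemma pair_mult_simp [simp]: "pair_mult f (a, b) (c, d) = (a * c + f * (b * d), a * d + b * c)"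
  by (simp add: pair_mult_def)

lemma pair_mult_const: "pair_mult f (a, 0) (c, d) = (a * c, a * d)"
  by simp

lemma pair_mult_comm: "pair_mult f u v = pair_mult f v u"
  by (simp add: pair_mult_def algebra_simps)

lemma pair_mult_assoc: "pair_mult f (pair_mult f u v) w = pair_mult f u (pair_mult f v w)"
  by (simp add: pair_mult_def algebra_simps)

lemma pair_mult_left_comm: "pair_mult f u (pair_mult f v w) = pair_mult f v (pair_mult f u w)"
  by (metis pair_mult_comm pair_mult_assoc)

lemmas pair_mult_ac = pair_mult_assoc pair_mult_comm pair_mult_left_comm

lemma pair_mult_one [simp]: "pair_mult f (1, 0) u = u" "pair_mult f u (1, 0) = u"
  by (simp_all add: pair_mult_def)

lemma pair_mult_zero [simp]: "pair_mult f (0, 0) u = (0, 0)" "pair_mult f u (0, 0) = (0, 0)"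
  by (simp_all add: pair_mult_def)

abbreviation ffm :: "'a::field poly \<Rightarrow> 'a ratfun \<Rightarrow> 'a ratfun \<Rightarrow> 'a ratfun" where
  "ffm f \<equiv> pair_mult (Fract f 1)"

lemma function_field_sel [simp]:
  "carrier (function_field f) = UNIV"
  "\<one>\<^bsub>function_field f\<^esub> = (1, 0)"
  "\<zero>\<^bsub>function_field f\<^esub> = (0, 0)"
  "u \<otimes>\<^bsub>function_field f\<^esub> v = ffm f u v"
  by (auto simp: function_field_def pair_mult_def split_beta)

lemma function_field_add [simp]: "u \<oplus>\<^bsub>function_field f\<^esub> v = (fst u + fst v, snd u + snd v)"
  by (auto simp: function_field_def split_beta)

lemma nonsquare_fract:
  fixes f :: "'a::field poly"
  assumes "nonsquare f" "z\<^sup>2 = Fract f 1 * w\<^sup>2"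
  shows "w = 0 \<and> z = 0"
proof -
  obtain a c where z: "z = Fract a c" "c \<noteq> 0" by (cases z) auto
  obtain b e where w: "w = Fract b e" "e \<noteq> 0" by (cases w) auto
  have "(a * e)\<^sup>2 = f * (b * c)\<^sup>2"
    using assms(2) z w by (simp add: power2_eq_square eq_fract algebra_simps)
  then have "b * c = 0"
    using assms(1) unfolding nonsquare_def by blast
  then have "w = 0" using z w by (simp add: fract_collapse)
  then show ?thesis using assms(2) by simp
qed

text \<open>The inverse is the conjugate a - b y divided by the norm, which is nonzero for a
  nonsquare f.\<close>

lemma ffm_inverse:
  assumes "nonsquare f" "u \<noteq> (0, 0)"
  shows "\<exists>v. ffm f u v = (1, 0)"
proof -
  obtain a b where u: "u = (a, b)" by (cases u)
  define N where "N = a\<^sup>2 - Fract f 1 * b\<^sup>2"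
  have N: "N \<noteq> 0"
    using nonsquare_fract[OF assms(1), of a b] assms(2) u by (auto simp: N_def)
  have "ffm f u (a / N, - b / N) = (N / N, 0)"
    using N by (simp add: u N_def power2_eq_square mult.commute flip: diff_divide_distrib)
  then show ?thesis using N by auto
qed

lemma ffm_eq_0_iff:
  assumes "nonsquare f"
  shows "ffm f u v = (0, 0) \<longleftrightarrow> u = (0, 0) \<or> v = (0, 0)"
proof
  assume e: "ffm f u v = (0, 0)"
  show "u = (0, 0) \<or> v = (0, 0)"
  proof (rule disjCI)
    assume "v \<noteq> (0, 0)"
    then obtain w where "ffm f v w = (1, 0)" using ffm_inverse[OF assms] by blast
    then have "u = ffm f (ffm f u v) w" by (simp add: pair_mult_assoc)
    then show "u = (0, 0)" using e by simp
  qed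
qed auto

lemma ffm_cancel:
  assumes "nonsquare f" "u \<noteq> (0, 0)" "ffm f u v = ffm f u w"
  shows "v = w"
proof -
  obtain z where "ffm f u z = (1, 0)" using ffm_inverse[OF assms(1,2)] by blast
  then have "v = ffm f z (ffm f u v)" "w = ffm f z (ffm f u w)"
    by (metis pair_mult_assoc pair_mult_comm pair_mult_one(1))+
  then show ?thesis using assms(3) by simp
qed

lemma function_field_is_field:
  fixes f :: "'a::field poly"
  assumes "nonsquare f"
  shows "field (function_field f)"
proof -
  have "cring (function_field f)"
  proof (intro cringI abelian_groupI comm_monoidI, goal_cases)
    case (6 u)
    then show ?case by (intro bexI[of _ "(- fst u, - snd u)"]) auto
  qed (auto simp: algebra_simps pair_mult_def)
  then show ?thesis
  proof (rule cring.cring_fieldI)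
    show "Units (function_field f) = carrier (function_field f) - {\<zero>\<^bsub>function_field f\<^esub>}"
    proof -
      have "u \<in> Units (function_field f) \<longleftrightarrow> u \<noteq> (0, 0)" for u
        using ffm_inverse[OF assms, of u] by (auto simp: Units_def pair_mult_comm)
      then show ?thesis by auto
    qed
  qed
qed

text \<open>
  In a chart with coordinates \<open>(v, w)\<close>, \<open>\<eta>\<close> substitutes \<open>v\<close> for the variable of a polynomial, \<open>w = \<kappa> y\<close> and
  \<open>w\<^sup>2 = fc(v)\<close>.
\<close>

locale chart =
  fixes f fc :: "'a::field_char_0 poly" and \<eta> :: "'a poly \<Rightarrow> 'a poly fract"
    and \<kappa> :: "'a poly fract" and x1 y1 :: 'a and P :: "'a hpoint"
  assumes nonsquare_f: "nonsquare f" and nonsquare_fc: "nonsquare fc"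
    and \<eta>_add: "\<eta> (p + q) = \<eta> p + \<eta> q"
    and \<eta>_mult: "\<eta> (p * q) = \<eta> p * \<eta> q"
    and \<eta>_one: "\<eta> 1 = 1"
    and \<eta>_inj: "\<eta> p = 0 \<Longrightarrow> p = 0"
    and \<eta>_ratio: "\<exists>c a. c \<noteq> 0 \<and> z * \<eta> c = \<eta> a"
    and \<kappa>: "\<kappa> \<noteq> 0" "Fract f 1 * \<kappa>\<^sup>2 = \<eta> fc"
    and on_chart: "y1\<^sup>2 = poly fc x1" "y1 = 0 \<Longrightarrow> poly (pderiv fc) x1 \<noteq> 0"
    and chart_fun_P: "chart_fun f P (p, q) = (\<eta> p, \<eta> q * \<kappa>)"
    and chart_val_P: "chart_val P (p, q) = poly p x1 + poly q x1 * y1"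
begin

sublocale \<eta>: coeff_hom \<eta>
  by unfold_locales (rule \<eta>_add \<eta>_mult \<eta>_one)+

abbreviation \<chi> where "\<chi> \<equiv> chart_fun f P"

lemma \<chi>_def: "\<chi> u = (\<eta> (fst u), \<eta> (snd u) * \<kappa>)"
  by (cases u) (simp add: chart_fun_P)

lemma \<chi>_mult: "ffm f (\<chi> u) (\<chi> v) = \<chi> (pair_mult fc u v)"
proof -
  have "Fract f 1 * (a * \<kappa> * (b * \<kappa>)) = \<eta> fc * (a * b)" for a b
    by (simp add: \<kappa>(2)[symmetric] power2_eq_square algebra_simps)
  then show ?thesis
    by (simp add: \<chi>_def pair_mult_def \<eta>_add \<eta>_mult algebra_simps)
qed

lemma \<chi>_eq_0_iff: "\<chi> u = (0, 0) \<longleftrightarrow> u = (0, 0)"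
  using \<eta>_inj \<kappa>(1) by (auto simp: \<chi>_def \<eta>.zero prod_eq_iff)

lemma \<chi>_inj: "\<chi> u = \<chi> v \<Longrightarrow> u = v"
  using \<eta>_inj[of "fst u - fst v"] \<eta>_inj[of "snd u - snd v"] \<kappa>(1)
  by (auto simp: \<chi>_def \<eta>.diff prod_eq_iff)

lemma \<chi>_one: "\<chi> (1, 0) = (1, 0)"
  by (simp add: \<chi>_def \<eta>_one \<eta>.zero)

lemma pair_mult_fc_eq_0_iff: "pair_mult fc u v = (0, 0) \<longleftrightarrow> u = (0, 0) \<or> v = (0, 0)"
  using ffm_eq_0_iff[OF nonsquare_f, of "\<chi> u" "\<chi> v"] by (simp add: \<chi>_mult \<chi>_eq_0_iff)

lemma ratio_exists: "\<exists>c a. c \<noteq> 0 \<and> ffm f h (\<chi> (c, 0)) = \<chi> a"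
proof -
  obtain c1 a1 where 1: "c1 \<noteq> 0" "fst h * \<eta> c1 = \<eta> a1" using \<eta>_ratio by blast
  obtain c2 a2 where 2: "c2 \<noteq> 0" "snd h / \<kappa> * \<eta> c2 = \<eta> a2" using \<eta>_ratio by blast
  have "ffm f h (\<chi> (c1 * c2, 0)) = \<chi> (a1 * c2, a2 * c1)"
    using 1 2 \<kappa>(1)
    by (simp add: \<chi>_def pair_mult_def \<eta>_mult \<eta>.zero flip: 1(2) 2(2))
  then show ?thesis using 1 2 by (intro exI[of _ "c1 * c2"]) auto
qed

lemma cancel_common:
  assumes "e \<noteq> (0, 0)" "ffm f h (\<chi> (pair_mult fc e u)) = \<chi> (pair_mult fc e v)"
  shows "ffm f h (\<chi> u) = \<chi> v"
proof (rule ffm_cancel[OF nonsquare_f])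
  show "\<chi> e \<noteq> (0, 0)" using assms(1) by (simp add: \<chi>_eq_0_iff)
  show "ffm f (\<chi> e) (ffm f h (\<chi> u)) = ffm f (\<chi> e) (\<chi> v)"
    using assms(2) by (simp add: \<chi>_mult[symmetric] pair_mult_ac)
qed

end

section \<open>Expansions along a parametrisation and the valuation they define\<close>

definition pair_ev :: "'a::comm_ring_1 fps \<Rightarrow> 'a fps \<Rightarrow> 'a poly \<times> 'a poly \<Rightarrow> 'a fps" where
  "pair_ev U V u = pev (fst u) U + pev (snd u) U * V"

lemma pair_ev_mult:
  "pev f U = V\<^sup>2 \<Longrightarrow> pair_ev U V (pair_mult f u v) = pair_ev U V u * pair_ev U V v"
  by (simp add: pair_ev_def pair_mult_def fps_ev.ev_add fps_ev.ev_mult power2_eq_square algebra_simps)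

locale chart_param = chart +
  fixes U V :: "'a fps"
  assumes param: "param fc x1 y1 U V"
begin

abbreviation \<Psi> where "\<Psi> \<equiv> pair_ev U V"

lemma V_sq: "V\<^sup>2 = pev fc U" and U_0: "U $ 0 = x1" and V_0: "V $ 0 = y1"
  using param by (simp_all add: param_def)

lemma \<Psi>_mult: "\<Psi> (pair_mult fc u v) = \<Psi> u * \<Psi> v"
  by (rule pair_ev_mult[OF V_sq[symmetric]])

lemma \<Psi>_0: "\<Psi> u $ 0 = chart_val P u"
  by (cases u) (simp add: pair_ev_def chart_val_P pev_nth_0 U_0 V_0)

lemma U_nonconst: "U - fps_const x1 \<noteq> 0"
  using param_simple[of fc x1 y1 U V] param_weierstrass[of fc x1 U V] param on_chart
  by (cases "y1 = 0") auto

lemma pev_eq_0_iff: "pev p U = 0 \<longleftrightarrow> p = 0"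
  using pev_nonzero_subdegree[of p U x1] U_nonconst U_0 by auto

text \<open>If p + q y expands to 0, so does its norm p^2 - fc q^2, a polynomial in the nonconstant
  series U. Hence the norm is 0 and \<open>nonsquare_fc\<close> applies.\<close>

lemma \<Psi>_eq_0_iff: "\<Psi> u = 0 \<longleftrightarrow> u = (0, 0)"
proof
  assume a: "\<Psi> u = 0"
  obtain p q where u: "u = (p, q)" by (cases u)
  have "\<Psi> (pair_mult fc (p, q) (p, - q)) = 0"
    using a u by (simp only: \<Psi>_mult) simp
  then have "p\<^sup>2 - fc * q\<^sup>2 = 0"
    by (simp add: pair_ev_def power2_eq_square pev_eq_0_iff algebra_simps)
  then have q: "q = 0" using nonsquare_fc by (simp add: nonsquare_def)
  then have "p = 0" using a u by (simp add: pair_ev_def pev_eq_0_iff)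
  then show "u = (0, 0)" using q u by simp
qed (simp add: pair_ev_def)

text \<open>The order of a quotient of chart functions, read off from expansions: a computable
  stand-in for \<open>ord_at\<close>, with which \<open>ord_at_eq_\<nu>\<close> identifies
  it.\<close>

definition \<nu> :: "'a ratfun \<Rightarrow> int" where
  "\<nu> h = (THE n. \<exists>u v. u \<noteq> (0, 0) \<and> v \<noteq> (0, 0) \<and> ffm f h (\<chi> u) = \<chi> v \<and>
     n = int (subdegree (\<Psi> v)) - int (subdegree (\<Psi> u)))"

lemma \<nu>_eq:
  assumes "u \<noteq> (0, 0)" "v \<noteq> (0, 0)" "ffm f h (\<chi> u) = \<chi> v"
  shows "\<nu> h = int (subdegree (\<Psi> v)) - int (subdegree (\<Psi> u))"
  unfolding \<nu>_def
proof (rule the_equality, goal_cases)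
  case 1
  then show ?case using assms by blast
next
  case (2 n)
  then obtain u' v' where *: "u' \<noteq> (0, 0)" "v' \<noteq> (0, 0)" "ffm f h (\<chi> u') = \<chi> v'"
     "n = int (subdegree (\<Psi> v')) - int (subdegree (\<Psi> u'))" by blast
  have "\<chi> (pair_mult fc v u') = \<chi> (pair_mult fc v' u)"
    by (simp add: \<chi>_mult[symmetric] assms(3)[symmetric] *(3)[symmetric] pair_mult_ac)
  then have "\<Psi> v * \<Psi> u' = \<Psi> v' * \<Psi> u"
    using \<chi>_inj \<Psi>_mult by metis
  then have "subdegree (\<Psi> v * \<Psi> u') = subdegree (\<Psi> v' * \<Psi> u)" by simp
  then show ?case using assms * by (simp add: subdegree_mult \<Psi>_eq_0_iff)
qed

lemma ratio_nonzero:
  assumes "h \<noteq> (0, 0)"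
  obtains c v where "c \<noteq> 0" "v \<noteq> (0, 0)" "ffm f h (\<chi> (c, 0)) = \<chi> v"
proof -
  obtain c v where *: "c \<noteq> 0" "ffm f h (\<chi> (c, 0)) = \<chi> v" using ratio_exists by blast
  moreover have "v \<noteq> (0, 0)"
    using * assms ffm_eq_0_iff[OF nonsquare_f, of h "\<chi> (c, 0)"] by (auto simp: \<chi>_eq_0_iff)
  ultimately show ?thesis using that by blast
qed

lemma \<nu>_mult:
  assumes "h \<noteq> (0, 0)" "k \<noteq> (0, 0)"
  shows "\<nu> (ffm f h k) = \<nu> h + \<nu> k"
proof -
  obtain c v where 1: "c \<noteq> 0" "v \<noteq> (0, 0)" "ffm f h (\<chi> (c, 0)) = \<chi> v"
    using ratio_nonzero assms(1) by blast
  obtain d w where 2: "d \<noteq> 0" "w \<noteq> (0, 0)" "ffm f k (\<chi> (d, 0)) = \<chi> w"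
    using ratio_nonzero assms(2) by blast
  let ?cd = "pair_mult fc (c, 0) (d, 0)" and ?vw = "pair_mult fc v w"
  have "ffm f (ffm f h k) (\<chi> ?cd) = \<chi> ?vw"
    by (simp only: \<chi>_mult[symmetric] 1(3)[symmetric] 2(3)[symmetric] pair_mult_ac)
  moreover have "?cd \<noteq> (0, 0)" "?vw \<noteq> (0, 0)"
    using 1 2 by (simp_all add: pair_mult_fc_eq_0_iff)
  ultimately have "\<nu> (ffm f h k) = int (subdegree (\<Psi> ?vw)) - int (subdegree (\<Psi> ?cd))"
    by (intro \<nu>_eq)
  also have "\<dots> = \<nu> h + \<nu> k"
    using 1 2 \<nu>_eq[OF _ 1(2,3)] \<nu>_eq[OF _ 2(2,3)]
    by (simp only: \<Psi>_mult) (simp add: subdegree_mult \<Psi>_eq_0_iff)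
  finally show ?thesis .
qed

lemma \<nu>_\<chi>: "v \<noteq> (0, 0) \<Longrightarrow> \<nu> (\<chi> v) = int (subdegree (\<Psi> v))"
  using \<nu>_eq[of "(1, 0)" v "\<chi> v"] by (simp add: \<chi>_one pair_ev_def)

lemma \<nu>_one: "\<nu> (1, 0) = 0"
  using \<nu>_\<chi>[of "(1, 0)"] by (simp add: \<chi>_one pair_ev_def)

lemma \<nu>_inverse:
  assumes "ffm f h k = (1, 0)" shows "\<nu> k = - \<nu> h"
proof -
  have "h \<noteq> (0, 0)" "k \<noteq> (0, 0)" using assms by auto
  then show ?thesis using \<nu>_mult[of h k] assms \<nu>_one by simp
qed

end

section \<open>The local ring of a point as a valuation ring\<close>

context chart_param
begin

lemma linear_divides:
  assumes "poly p x1 = 0" shows "\<exists>q. p = [:- x1, 1:] * q"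
  using assms by (metis poly_eq_0_iff_dvd dvdE)

lemma pev_linear: "pev [:- x1, 1:] U = U - fps_const x1"
  by (simp flip: fps_const_neg)

text \<open>Here x - x1 has order 2 and y has order 1. The constant coefficient of the expansion of
  a + b y is a(x1); once this vanishes, the linear one is b(x1) times a nonzero constant.\<close>

lemma divides_weierstrass:
  assumes "y1 = 0" "\<Psi> u $ 0 = 0" "\<Psi> u $ 1 = 0"
  shows "\<exists>v. u = pair_mult fc ([:- x1, 1:], 0) v"
proof -
  obtain a b where u: "u = (a, b)" by (cases u)
  have W: "V \<noteq> 0 \<and> subdegree V = 1 \<and> U - fps_const x1 \<noteq> 0 \<and> subdegree (U - fps_const x1) = 2"
    using param_weierstrass[of fc x1 U V] param assms(1) on_chart by simp
  have "poly a x1 = 0"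
    using assms(1,2) u by (simp add: \<Psi>_0 chart_val_P)
  then obtain a' where a': "a = [:- x1, 1:] * a'" using linear_divides by blast
  have "pev a U = (U - fps_const x1) * pev a' U"
    by (simp only: a' fps_ev.ev_mult pev_linear)
  moreover have "(U - fps_const x1) $ 1 = 0" "(U - fps_const x1) $ 0 = 0"
    using W nth_less_subdegree_zero[of 1 "U - fps_const x1"] nth_less_subdegree_zero[of 0 "U - fps_const x1"] by auto
  ultimately have "pev a U $ 1 = 0"
    by (simp add: fps_mult_nth del: fps_sub_nth)
  then have "poly b x1 * V $ 1 = 0"
    using assms(1,3) u V_0 by (simp add: pair_ev_def fps_mult_nth pev_nth_0 U_0)
  moreover have "V $ 1 \<noteq> 0"
    using W nth_subdegree_nonzero[of V] by auto
  ultimately obtain b' where "b = [:- x1, 1:] * b'" using linear_divides[of b] by auto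
  then have "u = pair_mult fc ([:- x1, 1:], 0) (a', b')"
    using u a' by simp
  then show ?thesis by blast
qed

lemma \<Psi>_linear: "\<Psi> ([:- x1, 1:], 0) = U - fps_const x1"
  by (simp only: pair_ev_def fst_conv snd_conv pev_linear) simp

text \<open>The zero of the denominator is removed one factor x - x1 at a time. Either the numerator
  a + b y is divisible by x - x1, or numerator and denominator are multiplied by the conjugate a - b
  y: this does not vanish at P, and the norm that replaces the numerator is divisible by the whole
  power of x - x1.\<close>

lemma regular_imp_fraction:
  assumes "poly c x1 \<noteq> 0" "ffm f h (\<chi> ([:- x1, 1:] ^ k * c, 0)) = \<chi> u"
    "u = (0, 0) \<or> subdegree (\<Psi> u) \<ge> k * subdegree (U - fps_const x1)"
  shows "\<exists>A B. chart_val P B \<noteq> 0 \<and> ffm f h (\<chi> B) = \<chi> A"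
  using assms
proof (induction k arbitrary: u)
  case 0
  then show ?case by (intro exI[of _ u] exI[of _ "(c, 0)"]) (simp add: chart_val_P)
next
  case (Suc k)
  let ?e = "([:- x1, 1:], 0)"
  let ?d = "subdegree (U - fps_const x1)"
  show ?case
  proof (cases "\<exists>v. u = pair_mult fc ?e v")
    case True
    then obtain v where v: "u = pair_mult fc ?e v" by blast
    have "ffm f h (\<chi> (pair_mult fc ?e ([:- x1, 1:] ^ k * c, 0))) = \<chi> (pair_mult fc ?e v)"
      using Suc.prems(2) v by (simp only: pair_mult_const power_Suc mult.assoc mult_zero_right)
    then have "ffm f h (\<chi> ([:- x1, 1:] ^ k * c, 0)) = \<chi> v"
      by (rule cancel_common[rotated]) simp
    moreover have "v = (0, 0) \<or> subdegree (\<Psi> v) \<ge> k * ?d"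
    proof (rule disjCI)
      assume neg: "\<not> subdegree (\<Psi> v) \<ge> k * ?d"
      show "v = (0, 0)"
      proof (rule ccontr)
        assume nv: "v \<noteq> (0, 0)"
        have "subdegree (\<Psi> u) = ?d + subdegree (\<Psi> v)"
          unfolding v \<Psi>_mult \<Psi>_linear using U_nonconst nv by (simp add: subdegree_mult \<Psi>_eq_0_iff)
        moreover have "u \<noteq> (0, 0)"
          using nv v by (simp add: pair_mult_fc_eq_0_iff del: pair_mult_simp)
        ultimately show False using Suc.prems(3) neg by simp
      qed
    qed
    ultimately show ?thesis using Suc.IH Suc.prems(1) by blast
  next
    case False
    obtain a b where u: "u = (a, b)" by (cases u)
    have u0: "u \<noteq> (0, 0)" using False by (metis pair_mult_zero(2))
    then have sd: "subdegree (\<Psi> u) \<ge> Suc k * ?d" using Suc.prems(3) by simp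
    have d1: "?d \<ge> 1"
      using U_nonconst U_0 subdegree_pos_iff[of "U - fps_const x1"] by simp
    \<comment> \<open>At a point with y1 = 0, an expansion of order at least 2 would already make u
      divisible by x - x1.\<close>
    have y1: "y1 \<noteq> 0"
    proof
      assume "y1 = 0"
      then have "?d = 2" using param_weierstrass[of fc x1 U V] param on_chart by simp
      then have "2 \<le> subdegree (\<Psi> u)" using sd by simp
      then have "\<Psi> u $ 0 = 0" "\<Psi> u $ 1 = 0" by (auto intro: nth_less_subdegree_zero)
      then show False using divides_weierstrass[OF \<open>y1 = 0\<close>] False by blast
    qed
    have "1 \<le> subdegree (\<Psi> u)" using sd d1 by simp
    then have "\<Psi> u $ 0 = 0" by (intro nth_less_subdegree_zero) simp
    then have val0: "poly a x1 + poly b x1 * y1 = 0"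
      using \<Psi>_0[of u] u by (simp add: chart_val_P)
    \<comment> \<open>If both conjugates vanished at P, then a and b would vanish at x1, since y1 is
      nonzero, and u would be divisible by x - x1.\<close>
    have val1: "poly a x1 - poly b x1 * y1 \<noteq> 0"
    proof
      assume *: "poly a x1 - poly b x1 * y1 = 0"
      have "2 * poly a x1 = (poly a x1 + poly b x1 * y1) + (poly a x1 - poly b x1 * y1)"
        by simp
      then have a: "poly a x1 = 0" unfolding val0 * by simp
      then have "poly b x1 = 0" using val0 y1 by simp
      with a obtain a' b' where "a = [:- x1, 1:] * a'" "b = [:- x1, 1:] * b'"
        using linear_divides by blast
      then have "u = pair_mult fc ?e (a', b')" using u by simp
      then show False using False by blast
    qed
    define N where "N = a\<^sup>2 - fc * b\<^sup>2"
    have N: "pair_mult fc u (a, - b) = (N, 0)"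
      by (simp add: u N_def power2_eq_square)
    have N0: "N \<noteq> 0"
    proof
      assume "N = 0"
      then have "(a, - b) = (0, 0)" using N u0 pair_mult_fc_eq_0_iff by metis
      then show False using val1 by simp
    qed
    \<comment> \<open>The conjugate contributes a nonnegative order, so the norm inherits at least
      the order of u.\<close>
    have "subdegree (\<Psi> (N, 0)) = subdegree (\<Psi> u) + subdegree (\<Psi> (a, - b))"
      unfolding N[symmetric] \<Psi>_mult using N0 N pair_mult_fc_eq_0_iff[of u "(a, - b)"]
      by (subst subdegree_mult) (auto simp: \<Psi>_eq_0_iff)
    moreover have "subdegree (\<Psi> (N, 0)) = order x1 N * ?d"
      using pev_nonzero_subdegree[OF N0 _ U_0] U_nonconst by (auto simp: pair_ev_def)
    ultimately have "Suc k * ?d \<le> order x1 N * ?d" using sd by simp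
    then have "Suc k \<le> order x1 N" using d1 mult_le_cancel2[of "Suc k" ?d "order x1 N"] by linarith
    then have "[:- x1, 1:] ^ Suc k dvd N"
      using order_1 power_le_dvd by blast
    then obtain N' where N': "N = [:- x1, 1:] ^ Suc k * N'" by blast
    let ?es = "([:- x1, 1:] ^ Suc k, 0)"
    have "ffm f (ffm f h (\<chi> ([:- x1, 1:] ^ Suc k * c, 0))) (\<chi> (a, - b)) = \<chi> (N, 0)"
      by (simp only: Suc.prems(2) \<chi>_mult N)
    then have "ffm f h (\<chi> (pair_mult fc ([:- x1, 1:] ^ Suc k * c, 0) (a, - b))) = \<chi> (N, 0)"
      by (simp only: pair_mult_assoc \<chi>_mult)
    moreover have "pair_mult fc ([:- x1, 1:] ^ Suc k * c, 0) (a, - b) = pair_mult fc ?es (c * a, - (c * b))"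
      by (simp only: pair_mult_const mult.assoc mult_minus_right)
    moreover have "(N, 0) = pair_mult fc ?es (N', 0)"
      by (simp only: N' pair_mult_const mult_zero_right)
    ultimately have "ffm f h (\<chi> (pair_mult fc ?es (c * a, - (c * b)))) = \<chi> (pair_mult fc ?es (N', 0))"
      by (simp only:)
    then have "ffm f h (\<chi> (c * a, - (c * b))) = \<chi> (N', 0)"
    proof (rule cancel_common[rotated])
      have "[:- x1, 1:] ^ Suc k \<noteq> 0" by (rule power_not_zero) simp
      then show "?es \<noteq> (0, 0)" by (metis prod.inject)
    qed
    moreover have "chart_val P (c * a, - (c * b)) \<noteq> 0"
    proof -
      have "chart_val P (c * a, - (c * b)) = poly c x1 * (poly a x1 - poly b x1 * y1)"
        by (simp add: chart_val_P algebra_simps)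
      then show ?thesis using Suc.prems(1) val1 by simp
    qed
    ultimately show ?thesis by blast
  qed
qed

lemma fraction_iff_regular:
  "(\<exists>A B. chart_val P B \<noteq> 0 \<and> ffm f h (\<chi> B) = \<chi> A) \<longleftrightarrow> h = (0, 0) \<or> \<nu> h \<ge> 0"
proof
  assume "\<exists>A B. chart_val P B \<noteq> 0 \<and> ffm f h (\<chi> B) = \<chi> A"
  then obtain A B where AB: "chart_val P B \<noteq> 0" "ffm f h (\<chi> B) = \<chi> A" by blast
  have B: "B \<noteq> (0, 0)" using AB by (auto simp: chart_val_P)
  have "\<Psi> B $ 0 \<noteq> 0" using AB by (simp add: \<Psi>_0)
  then have sB: "subdegree (\<Psi> B) = 0" by (simp add: subdegree_eq_0)
  show "h = (0, 0) \<or> \<nu> h \<ge> 0"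
  proof (cases "A = (0, 0)")
    case True
    then show ?thesis using AB B ffm_eq_0_iff[OF nonsquare_f, of h "\<chi> B"] by (simp add: \<chi>_eq_0_iff)
  next
    case False
    then show ?thesis using \<nu>_eq[OF B False AB(2)] sB by simp
  qed
next
  assume h: "h = (0, 0) \<or> \<nu> h \<ge> 0"
  obtain c u where c: "c \<noteq> 0" "ffm f h (\<chi> (c, 0)) = \<chi> u" using ratio_exists by blast
  obtain c' where c': "c = [:- x1, 1:] ^ order x1 c * c'" "\<not> [:- x1, 1:] dvd c'"
    using order_decomp[OF c(1)] by blast
  have "poly c' x1 \<noteq> 0" using c'(2) by (simp add: poly_eq_0_iff_dvd)
  moreover have "u = (0, 0) \<or> subdegree (\<Psi> u) \<ge> order x1 c * subdegree (U - fps_const x1)"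
  proof (rule disjCI, rule ccontr)
    assume neg: "\<not> subdegree (\<Psi> u) \<ge> order x1 c * subdegree (U - fps_const x1)" and u: "u \<noteq> (0, 0)"
    have "h \<noteq> (0, 0)" using u c(2) \<chi>_eq_0_iff[of u] by auto
    then have "\<nu> h \<ge> 0" using h by simp
    then have "subdegree (\<Psi> u) \<ge> subdegree (\<Psi> (c, 0))"
      using \<nu>_eq[OF _ u c(2)] c(1) by simp
    moreover have "subdegree (\<Psi> (c, 0)) = order x1 c * subdegree (U - fps_const x1)"
      using pev_nonzero_subdegree[OF c(1) _ U_0] U_nonconst by (auto simp: pair_ev_def)
    ultimately show False using neg by simp
  qed
  ultimately show "\<exists>A B. chart_val P B \<noteq> 0 \<and> ffm f h (\<chi> B) = \<chi> A"
    using regular_imp_fraction[of c' h "order x1 c" u] c(2) c'(1) by metis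
qed

lemma fraction_vanishing_iff:
  "(\<exists>A B. chart_val P B \<noteq> 0 \<and> chart_val P A = 0 \<and> ffm f h (\<chi> B) = \<chi> A) \<longleftrightarrow> h = (0, 0) \<or> \<nu> h \<ge> 1"
proof -
  have key: "chart_val P A = 0 \<longleftrightarrow> h = (0, 0) \<or> \<nu> h \<ge> 1"
    if AB: "chart_val P B \<noteq> 0" "ffm f h (\<chi> B) = \<chi> A" for A B
  proof -
    have B: "B \<noteq> (0, 0)" using AB by (auto simp: chart_val_P)
    have "\<Psi> B $ 0 \<noteq> 0" using AB by (simp add: \<Psi>_0)
    then have sB: "subdegree (\<Psi> B) = 0" by (simp add: subdegree_eq_0)
    have hA: "h = (0, 0) \<longleftrightarrow> A = (0, 0)"
      using AB B ffm_eq_0_iff[OF nonsquare_f, of h "\<chi> B"] \<chi>_eq_0_iff by auto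
    show ?thesis
    proof (cases "A = (0, 0)")
      case True
      then show ?thesis using hA by (simp add: chart_val_P)
    next
      case False
      then have "\<nu> h = int (subdegree (\<Psi> A))" using \<nu>_eq[OF B False AB(2)] sB by simp
      then show ?thesis using hA False subdegree_pos_iff[of "\<Psi> A"] by (simp add: \<Psi>_0 \<Psi>_eq_0_iff)
    qed
  qed
  have "h = (0, 0) \<or> \<nu> h \<ge> 1 \<Longrightarrow> h = (0, 0) \<or> \<nu> h \<ge> 0" by auto
  then show ?thesis using key fraction_iff_regular[of h] by blast
qed

lemma carrier_local_ring: "carrier (local_ring f P) = {h. h = (0, 0) \<or> \<nu> h \<ge> 0}"
  unfolding local_ring_def by (simp add: fraction_iff_regular del: split_paired_Ex)

lemma local_max_ideal_eq: "local_max_ideal f P = {h. h = (0, 0) \<or> \<nu> h \<ge> 1}"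
  unfolding local_max_ideal_def by (simp add: fraction_vanishing_iff del: split_paired_Ex)

lemma local_ring_sel [simp]:
  "\<one>\<^bsub>local_ring f P\<^esub> = (1, 0)" "u \<otimes>\<^bsub>local_ring f P\<^esub> v = ffm f u v"
  by (auto simp: local_ring_def function_field_def pair_mult_def split_beta)

lemma Units_local_ring: "Units (local_ring f P) = {h. h \<noteq> (0, 0) \<and> \<nu> h = 0}"
proof (intro equalityI subsetI)
  fix u assume "u \<in> Units (local_ring f P)"
  then obtain v where uv: "u \<in> carrier (local_ring f P)" "v \<in> carrier (local_ring f P)" "ffm f u v = (1, 0)"
    by (auto simp: Units_def)
  then have "u \<noteq> (0, 0)" "v \<noteq> (0, 0)" by auto
  then show "u \<in> {h. h \<noteq> (0, 0) \<and> \<nu> h = 0}"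
    using uv \<nu>_inverse[OF uv(3)] by (simp add: carrier_local_ring)
next
  fix u assume u: "u \<in> {h. h \<noteq> (0, 0) \<and> \<nu> h = 0}"
  then obtain v where v: "ffm f u v = (1, 0)" using ffm_inverse[OF nonsquare_f] by blast
  then have "\<nu> v = 0" using \<nu>_inverse u by fastforce
  then show "u \<in> Units (local_ring f P)"
    using u v pair_mult_comm[of "Fract f 1" u v] unfolding Units_def carrier_local_ring local_ring_sel
    by (auto simp del: split_paired_Ex intro!: exI[of _ v])
qed

text \<open>The uniformizer is the second coordinate when y1 = 0, and the first one minus x1
  otherwise.\<close>

lemma exists_uniformizer: "\<exists>s. s \<noteq> (0, 0) \<and> \<nu> s = 1"
proof (cases "y1 = 0")
  case True
  then show ?thesis
    using \<nu>_\<chi>[of "(0, 1)"] param_weierstrass[of fc x1 U V] param on_chart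
    by (intro exI[of _ "\<chi> (0, 1)"]) (simp add: \<chi>_eq_0_iff pair_ev_def)
next
  case False
  then show ?thesis
    using \<nu>_\<chi>[of "([:- x1, 1:], 0)"] param_simple[of fc x1 y1 U V] param
    by (intro exI[of _ "\<chi> ([:- x1, 1:], 0)"]) (simp only: \<chi>_eq_0_iff \<Psi>_linear, simp)
qed

lemma cgenideal_eq_iff:
  assumes "t \<noteq> (0, 0)"
  shows "local_max_ideal f P = cgenideal (local_ring f P) t \<longleftrightarrow> \<nu> t = 1"
proof -
  have c: "cgenideal (local_ring f P) t = {h. h = (0, 0) \<or> \<nu> h \<ge> \<nu> t}"
  proof (intro equalityI subsetI)
    fix h assume "h \<in> cgenideal (local_ring f P) t"
    then obtain z where "z = (0, 0) \<or> \<nu> z \<ge> 0" "h = ffm f z t"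
      by (auto simp: cgenideal_def carrier_local_ring)
    then show "h \<in> {h. h = (0, 0) \<or> \<nu> h \<ge> \<nu> t}"
      using assms \<nu>_mult[of z t] by (cases "z = (0, 0)") auto
  next
    fix h assume h: "h \<in> {h. h = (0, 0) \<or> \<nu> h \<ge> \<nu> t}"
    obtain w where w: "ffm f t w = (1, 0)" using ffm_inverse[OF nonsquare_f assms] by blast
    have e: "h = ffm f (ffm f h w) t"
      using w by (simp add: pair_mult_ac)
    have "ffm f h w = (0, 0) \<or> \<nu> (ffm f h w) \<ge> 0"
    proof (cases "h = (0, 0)")
      case False
      moreover have "w \<noteq> (0, 0)" using w by auto
      ultimately show ?thesis using h \<nu>_mult[of h w] \<nu>_inverse[OF w] by auto
    qed auto
    then show "h \<in> cgenideal (local_ring f P) t"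
      using e unfolding cgenideal_def carrier_local_ring local_ring_sel by blast
  qed
  show ?thesis
  proof
    assume a: "local_max_ideal f P = cgenideal (local_ring f P) t"
    obtain s where s: "s \<noteq> (0, 0)" "\<nu> s = 1" using exists_uniformizer by blast
    have "s \<in> cgenideal (local_ring f P) t" using s a local_max_ideal_eq by auto
    then have "\<nu> t \<le> 1" using c s by auto
    moreover have "t \<in> local_max_ideal f P" using c a by auto
    then have "\<nu> t \<ge> 1" using assms local_max_ideal_eq by auto
    ultimately show "\<nu> t = 1" by simp
  qed (simp add: c local_max_ideal_eq)
qed

lemma \<nu>_int_pow:
  assumes "t \<noteq> (0, 0)"
  shows "t [^]\<^bsub>function_field f\<^esub> (n::int) \<noteq> (0, 0) \<and> \<nu> (t [^]\<^bsub>function_field f\<^esub> n) = n * \<nu> t"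
proof -
  have FF: "field (function_field f)" by (rule function_field_is_field[OF nonsquare_f])
  have nat: "t [^]\<^bsub>function_field f\<^esub> k \<noteq> (0, 0) \<and> \<nu> (t [^]\<^bsub>function_field f\<^esub> k) = int k * \<nu> t" for k :: nat
  proof (induction k)
    case (Suc k)
    then show ?case using assms \<nu>_mult[of "t [^]\<^bsub>function_field f\<^esub> k" t]
      by (simp add: ffm_eq_0_iff[OF nonsquare_f] algebra_simps)
  qed (simp add: \<nu>_one)
  show ?thesis
  proof (cases "n < 0")
    case True
    define z where "z = t [^]\<^bsub>function_field f\<^esub> nat (- n)"
    have z: "z \<noteq> (0, 0)" "\<nu> z = - n * \<nu> t" using nat[of "nat (- n)"] True unfolding z_def by simp_all
    have "z \<in> Units (function_field f)" unfolding field.field_Units[OF FF] using z(1) by simp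
    then have i: "ffm f z (inv\<^bsub>function_field f\<^esub> z) = (1, 0)"
      using monoid.Units_r_inv[of "function_field f" z] FF
      by (simp add: field.is_ring ring.is_monoid cring.axioms domain.axioms field.axioms)
    obtain w where w: "w = inv\<^bsub>function_field f\<^esub> z" by blast
    have i': "ffm f z w = (1, 0)" using i w by (simp only:)
    then have "w \<noteq> (0, 0)" by auto
    moreover have "t [^]\<^bsub>function_field f\<^esub> n = w"
      using True by (simp only: int_pow_def2 z_def w if_True)
    ultimately show ?thesis using z \<nu>_inverse[OF i'] by simp
  next
    case False
    then have "t [^]\<^bsub>function_field f\<^esub> n = t [^]\<^bsub>function_field f\<^esub> nat n"
      by (simp only: int_pow_def2 if_False)
    then show ?thesis using nat[of "nat n"] False by (simp del: function_field_sel)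
  qed
qed

theorem ord_at_eq_\<nu>:
  assumes h: "h \<noteq> (0, 0)"
  shows "ord_at f P h = \<nu> h"
  unfolding ord_at_def
proof (rule the_equality, goal_cases)
  case 1
  obtain t where t: "t \<noteq> (0, 0)" "\<nu> t = 1" using exists_uniformizer by blast
  let ?z = "t [^]\<^bsub>function_field f\<^esub> \<nu> h"
  have z: "?z \<noteq> (0, 0)" "\<nu> ?z = \<nu> h" using \<nu>_int_pow[OF t(1), of "\<nu> h"] t by simp_all
  obtain w where w: "ffm f ?z w = (1, 0)" using ffm_inverse[OF nonsquare_f z(1)] by blast
  have w0: "w \<noteq> (0, 0)" using w by auto
  have "h = ffm f (ffm f h w) ?z" using w by (simp add: pair_mult_ac)
  moreover have "ffm f h w \<in> Units (local_ring f P)"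
    using h w0 \<nu>_mult[of h w] \<nu>_inverse[OF w] z by (simp add: Units_local_ring ffm_eq_0_iff[OF nonsquare_f])
  moreover have "t \<in> carrier (local_ring f P)" using t by (simp add: carrier_local_ring)
  moreover have "local_max_ideal f P = cgenideal (local_ring f P) t"
    using t cgenideal_eq_iff by blast
  ultimately show ?case unfolding function_field_sel by blast
next
  case (2 n)
  then obtain t u where tu: "local_max_ideal f P = cgenideal (local_ring f P) t" "u \<in> Units (local_ring f P)"
    "h = ffm f u (t [^]\<^bsub>function_field f\<^esub> n)"
    by auto
  have t0: "t \<noteq> (0, 0)"
  proof
    assume "t = (0, 0)"
    then have "cgenideal (local_ring f P) t \<subseteq> {(0, 0)}" by (auto simp: cgenideal_def)
    moreover obtain s where "s \<noteq> (0, 0)" "\<nu> s = 1" using exists_uniformizer by blast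
    ultimately show False using tu(1) local_max_ideal_eq by auto
  qed
  then have "\<nu> t = 1" using tu cgenideal_eq_iff by blast
  then show ?case
    using tu \<nu>_mult[of u "t [^]\<^bsub>function_field f\<^esub> n"] \<nu>_int_pow[OF t0, of n] by (simp add: Units_local_ring)
qed

lemma ord_at_eq:
  assumes "u \<noteq> (0, 0)" "v \<noteq> (0, 0)" "ffm f h (\<chi> u) = \<chi> v"
  shows "ord_at f P h = int (subdegree (\<Psi> v)) - int (subdegree (\<Psi> u))"
proof -
  have "h \<noteq> (0, 0)" using assms \<chi>_eq_0_iff[of v] by auto
  then show ?thesis using ord_at_eq_\<nu> \<nu>_eq[OF assms] by simp
qed

end

section \<open>The two charts of a hyperelliptic curve\<close>

lemma order_eq_1:
  fixes f :: "'a::field poly"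
  assumes "poly f \<alpha> = 0" "poly (pderiv f) \<alpha> \<noteq> 0"
  shows "order \<alpha> f = 1"
proof -
  have f: "f = [:- \<alpha>, 1:] * synthetic_div f \<alpha>"
    using synthetic_div_correct'[of \<alpha> f] assms by simp
  have f0: "f \<noteq> 0" using assms by auto
  have "order \<alpha> (synthetic_div f \<alpha>) = 0"
    using assms by (intro order_0I) (simp add: poly_synthetic_div)
  moreover have "order \<alpha> ([:- \<alpha>, 1:] ^ 1) = 1" by (rule order_power_n_n)
  moreover have "order \<alpha> f = order \<alpha> [:- \<alpha>, 1:] + order \<alpha> (synthetic_div f \<alpha>)"
    using f0 f by (metis order_mult)
  ultimately show ?thesis by simp
qed

text \<open>At a simple zero of f the two sides of a^2 = f b^2 would have orders of different
  parity.\<close>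

lemma nonsquareI:
  assumes "f \<noteq> 0" "order \<alpha> f = 1"
  shows "nonsquare f"
  unfolding nonsquare_def
proof (intro allI impI, rule ccontr)
  fix a b assume e: "a\<^sup>2 = f * b\<^sup>2" and b: "b \<noteq> 0"
  have a: "a \<noteq> 0" using e b assms by auto
  have "order \<alpha> (a * a) = order \<alpha> (f * (b * b))" using e by (simp add: power2_eq_square)
  then have "2 * order \<alpha> a = 1 + 2 * order \<alpha> b"
    using a b assms by (simp add: order_mult)
  then show False by presburger
qed

interpretation const_fract: coeff_hom "\<lambda>c::'a::field. Fract [:c:] 1"
  by unfold_locales (simp_all add: One_fract_def one_pCons mult.commute)

abbreviation fract_x :: "'a::field poly fract" where "fract_x \<equiv> Fract [:0, 1:] 1"

lemma fract_x_nonzero: "fract_x \<noteq> 0"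
  by (simp add: Zero_fract_def eq_fract)

lemma inverse_fract_x: "Fract 1 [:0, 1:] = inverse fract_x"
  by simp

lemma eval_inv_x_ev: "eval_inv_x p = const_fract.ev p (inverse fract_x)"
  by (simp add: eval_inv_x_def const_fract.ev_def)

lemma ev_fract_x: "const_fract.ev p fract_x = Fract p 1"
proof (induction p)
  case (pCons a p)
  have "Fract (pCons a p) 1 = Fract [:a:] 1 + fract_x * Fract p 1"
    by simp
  then show ?case using pCons.IH by simp
qed (simp add: Zero_fract_def)

lemma (in coeff_hom) map_poly_reflect:
  assumes "\<And>c. g c = 0 \<Longrightarrow> c = 0"
  shows "map_poly g (reflect_poly p) = reflect_poly (map_poly g p)"
proof (rule poly_eqI)
  fix n
  have "degree (map_poly g p) = degree p"
    using assms degree_map_poly[of g p] zero by (cases "p = 0") auto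
  then show "coeff (map_poly g (reflect_poly p)) n = coeff (reflect_poly (map_poly g p)) n"
    by (simp add: coeff_map_poly coeff_reflect_poly zero)
qed

lemma const_fract_inj: "Fract [:c:] 1 = 0 \<Longrightarrow> c = (0::'a::field)"
  by (simp add: Zero_fract_def eq_fract)

lemma ev_reflect:
  assumes "z \<noteq> 0"
  shows "const_fract.ev (reflect_poly p) z = z ^ degree p * const_fract.ev p (inverse z)"
proof -
  have "degree (map_poly (\<lambda>c. Fract [:c:] 1) p) = degree p"
    using const_fract_inj degree_map_poly[of "\<lambda>c. Fract [:c:] 1" p] by (cases "p = 0") auto
  then show ?thesis
    using assms poly_reflect_poly_nz[of z "map_poly (\<lambda>c. Fract [:c:] 1) p"]
    by (simp add: const_fract.ev_def const_fract.map_poly_reflect[OF const_fract_inj])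
qed

lemma eval_inv_x_reflect: "eval_inv_x (reflect_poly p) = inverse fract_x ^ degree p * Fract p 1"
  using ev_reflect[of "inverse fract_x" p] fract_x_nonzero
  by (simp only: eval_inv_x_ev inverse_inverse_eq ev_fract_x) (simp del: inverse_fract)

lemma eval_inv_x_monom: "eval_inv_x (monom 1 n) = inverse fract_x ^ n"
  by (simp add: eval_inv_x_ev const_fract.ev_monom One_fract_def flip: one_pCons del: inverse_fract)

lemma eval_inv_x_inj: "eval_inv_x p = 0 \<Longrightarrow> p = 0"
proof -
  assume a: "eval_inv_x p = 0"
  have "Fract (reflect_poly p) 1 = fract_x ^ degree p * eval_inv_x p"
    using ev_reflect[of fract_x p] fract_x_nonzero
    by (simp only: ev_fract_x eval_inv_x_ev) simp
  then have "Fract (reflect_poly p) 1 = 0" using a by simp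
  then have "reflect_poly p = 0" by (simp add: Zero_fract_def eq_fract)
  then show "p = 0" by simp
qed

lemma eval_inv_x_mult: "eval_inv_x (p * q) = eval_inv_x p * eval_inv_x q"
  by (simp add: eval_inv_x_ev const_fract.ev_mult)

lemma inf_poly_exponent:
  assumes "degree f \<ge> 1"
  shows "degree f \<le> 2 * genus f + 2" "2 * genus f + 2 \<le> degree f + 1"
  unfolding genus_def using assms by presburger+

text \<open>This is the equation of the second chart, for v = 1/x and w = y/x^(g+1) in the function
  field.\<close>

lemma eval_inv_x_inf_poly:
  assumes "degree f \<ge> 1"
  shows "eval_inv_x (inf_poly f) = Fract f 1 * (inverse fract_x ^ (genus f + 1))\<^sup>2"
proof -
  have "eval_inv_x (inf_poly f)
      = inverse fract_x ^ (2 * genus f + 2 - degree f + degree f) * Fract f 1"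
    unfolding inf_poly_def eval_inv_x_mult eval_inv_x_monom eval_inv_x_reflect
    by (simp only: power_add mult.assoc)
  also have "2 * genus f + 2 - degree f + degree f = (genus f + 1) * 2"
    using inf_poly_exponent[OF assms] by simp
  finally show ?thesis by (simp only: power_mult) (simp only: mult.commute)
qed

lemma principal_divisors_iff:
  "D \<in> principal_divisors f \<longleftrightarrow> Poly_Mapping.keys D \<subseteq> curve_points f \<and>
     (\<exists>h. h \<noteq> (0, 0) \<and> (\<forall>P\<in>curve_points f. Poly_Mapping.lookup D P = ord_at f P h))"
  unfolding principal_divisors_def mem_Collect_eq function_field_sel carrier_free_Abelian_group_iff ..

definition emb :: "'a::field poly \<times> 'a poly \<Rightarrow> 'a ratfun" where
  "emb u = (Fract (fst u) 1, Fract (snd u) 1)"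

section \<open>The charts of a curve whose right-hand side has only simple roots\<close>

locale hyperelliptic =
  fixes f :: "'a::{alg_closed_field, field_char_0} poly"
  assumes degree_f: "degree f \<ge> 3"
    and simple_roots: "poly f \<alpha> = 0 \<Longrightarrow> poly (pderiv f) \<alpha> \<noteq> 0"
begin

lemma f_nonzero: "f \<noteq> 0"
  using degree_f by auto

lemma nonsquare_f: "nonsquare f"
proof -
  obtain \<alpha> where "poly f \<alpha> = 0"
    using alg_closed_imp_poly_has_root[of f] degree_f by auto
  then show ?thesis
    using simple_roots order_eq_1 f_nonzero nonsquareI by blast
qed

text \<open>Reversing f moves a root \<alpha> to 1/\<alpha> and loses the root 0, so a nonzero root
  is wanted. If 0 is a root it is simple, and the cofactor of positive degree supplies another
  one.\<close>

lemma nonzero_root: "\<exists>\<alpha>. \<alpha> \<noteq> 0 \<and> poly f \<alpha> = 0"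
proof (cases "poly f 0 = 0")
  case False
  obtain \<alpha> where "poly f \<alpha> = 0"
    using alg_closed_imp_poly_has_root[of f] degree_f by auto
  then show ?thesis using False by metis
next
  case True
  have f: "f = [:- 0, 1:] * synthetic_div f 0"
    using synthetic_div_correct'[of 0 f] True by simp
  have "degree (synthetic_div f 0) > 0" using degree_f by (simp add: degree_synthetic_div)
  then obtain \<alpha> where a: "poly (synthetic_div f 0) \<alpha> = 0"
    using alg_closed_imp_poly_has_root by blast
  then have "\<alpha> \<noteq> 0" using simple_roots[OF True] poly_synthetic_div[of f 0] by auto
  moreover have "poly f \<alpha> = 0" by (subst f) (simp add: a)
  ultimately show ?thesis by blast
qed

text \<open>The simple root \<alpha> \<noteq> 0 of f becomes the simple root 1/\<alpha>.\<close>

lemma nonsquare_inf_poly: "nonsquare (inf_poly f)"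
proof -
  obtain \<alpha> where \<alpha>: "\<alpha> \<noteq> 0" "poly f \<alpha> = 0" using nonzero_root by blast
  define q where "q = synthetic_div f \<alpha>"
  have f: "f = [:- \<alpha>, 1:] * q"
    using synthetic_div_correct'[of \<alpha> f] \<alpha> by (simp add: q_def)
  have q: "poly q \<alpha> \<noteq> 0" using \<alpha> simple_roots by (simp add: q_def poly_synthetic_div)
  let ?\<beta> = "inverse \<alpha>"
  let ?M = "monom 1 (2 * genus f + 2 - degree f) :: 'a poly"
  have l: "reflect_poly [:- \<alpha>, 1:] = smult (- \<alpha>) ([:- ?\<beta>, 1:] ^ 1)"
    using \<alpha> by (simp add: reflect_poly_pCons)
  have e: "inf_poly f = ?M * (reflect_poly [:- \<alpha>, 1:] * reflect_poly q)"
    unfolding inf_poly_def by (subst (2) f) (simp only: reflect_poly_mult)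
  have "order ?\<beta> ?M = 0"
    using \<alpha> by (intro order_0I) (simp add: poly_monom)
  moreover have "order ?\<beta> (reflect_poly [:- \<alpha>, 1:]) = 1"
    unfolding l using \<alpha> by (subst order_smult) (simp_all only: order_power_n_n neg_equal_0_iff_equal not_False_eq_True)
  moreover have "order ?\<beta> (reflect_poly q) = 0"
    using \<alpha> q by (intro order_0I) (simp add: poly_reflect_poly_nz)
  moreover have ne: "inf_poly f \<noteq> 0"
    using f_nonzero by (simp add: inf_poly_def)
  ultimately have "order ?\<beta> (inf_poly f) = 1"
    using ne unfolding e by (simp only: order_mult) (metis add_0 add.right_neutral order_mult mult_eq_0_iff)
  then show ?thesis using ne nonsquareI by blast
qed

text \<open>The origin is a root only for odd degree; then \<open>inf_poly f\<close> is v times the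
  reversed polynomial, whose value there is the leading coefficient of f.\<close>

lemma simple_inf_poly:
  assumes "poly (inf_poly f) 0 = 0" shows "poly (pderiv (inf_poly f)) 0 \<noteq> 0"
proof -
  let ?k = "2 * genus f + 2 - degree f"
  have "?k \<noteq> 0"
  proof
    assume "?k = 0"
    then have "poly (inf_poly f) 0 = lead_coeff f" unfolding inf_poly_def by simp
    then show False using assms f_nonzero by simp
  qed
  then have "?k = 1" using inf_poly_exponent[of f] degree_f by simp
  then have "inf_poly f = [:0, 1:] * reflect_poly f"
    unfolding inf_poly_def by (simp add: monom_altdef)
  then have "poly (pderiv (inf_poly f)) 0 = lead_coeff f"
    by (simp add: pderiv_mult pderiv_pCons)
  then show ?thesis using f_nonzero by simp
qed

lemma chart_affine:
  assumes "y\<^sup>2 = poly f x"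
  shows "chart f f (\<lambda>p. Fract p 1) 1 x y (Affine x y)"
proof
  show "Fract f 1 * 1\<^sup>2 = Fract f 1" by simp
  show "\<exists>c a. c \<noteq> 0 \<and> z * Fract c 1 = Fract a 1" for z :: "'a poly fract"
  proof -
    obtain a c where "z = Fract a c" "c \<noteq> 0" by (cases z) auto
    then show ?thesis by (intro exI[of _ c] exI[of _ a]) (simp add: eq_fract)
  qed
qed (use assms nonsquare_f simple_roots in \<open>auto simp: One_fract_def Zero_fract_def eq_fract\<close>)

lemma chart_infty:
  assumes "w\<^sup>2 = poly (inf_poly f) 0"
  shows "chart f (inf_poly f) eval_inv_x (Fract 1 [:0, 1:] ^ (genus f + 1)) 0 w (Infty w)"
proof (unfold inverse_fract_x, unfold_locales, goal_cases)
  case (7 z)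
  obtain a c where z: "z = Fract a c" "c \<noteq> 0" by (cases z) auto
  \<comment> \<open>With z = a/c, both a and c are multiplied by v^(deg a + deg c), which makes them
    polynomials in v = 1/x.\<close>
  let ?c = "reflect_poly c * monom 1 (degree a)" and ?a = "reflect_poly a * monom 1 (degree c)"
  have zc: "z * Fract c 1 = Fract a 1" using z by (simp add: eq_fract)
  have "z * eval_inv_x ?c = (z * Fract c 1) * inverse fract_x ^ degree c * inverse fract_x ^ degree a"
    unfolding eval_inv_x_mult eval_inv_x_reflect eval_inv_x_monom by (simp only: mult_ac)
  also have "\<dots> = eval_inv_x ?a"
    unfolding zc eval_inv_x_mult eval_inv_x_reflect eval_inv_x_monom by (simp only: mult_ac)
  finally show ?case using z by (intro exI[of _ ?c] exI[of _ ?a]) simp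
next
  case 8
  show ?case using fract_x_nonzero by (simp only: power_eq_0_iff inverse_nonzero_iff_nonzero) simp
next
  case 9
  show ?case using degree_f by (intro eval_inv_x_inf_poly[symmetric]) simp
next
  case 11
  then show ?case using assms simple_inf_poly by simp
qed (use assms nonsquare_f nonsquare_inf_poly eval_inv_x_inj fract_x_nonzero in
    \<open>auto simp: eval_inv_x_ev const_fract.ev_add const_fract.ev_mult\<close>)

lemma chart_param_affine:
  assumes "param f x y U V"
  shows "chart_param f f (\<lambda>p. Fract p 1) 1 x y (Affine x y) U V"
  using chart_affine[OF param_on_curve[OF assms]] assms
  by (simp add: chart_param_def chart_param_axioms_def)

lemma chart_param_infty:
  assumes "param (inf_poly f) 0 w U V"
  shows "chart_param f (inf_poly f) eval_inv_x (Fract 1 [:0, 1:] ^ (genus f + 1)) 0 w (Infty w) U V"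
  using chart_infty[OF param_on_curve[OF assms]] assms
  by (simp add: chart_param_def chart_param_axioms_def)

lemma chart_param_exists:
  assumes "P \<in> curve_points f"
  shows "\<exists>fc \<eta> \<kappa> x1 y1 U V. chart_param f fc \<eta> \<kappa> x1 y1 P U V"
proof (cases P)
  case (Affine x y)
  then have "y\<^sup>2 = poly f x" using assms by (simp add: curve_points_def)
  then obtain U V where "param f x y U V" using param_exists simple_roots by (metis zero_power2)
  then show ?thesis using chart_param_affine Affine by blast
next
  case (Infty w)
  then have "w\<^sup>2 = poly (inf_poly f) 0" using assms by (simp add: curve_points_def)
  then obtain U V where "param (inf_poly f) 0 w U V" using param_exists simple_inf_poly by (metis zero_power2)
  then show ?thesis using chart_param_infty Infty by blast
qed

lemma ord_mult:
  assumes "P \<in> curve_points f" "h \<noteq> (0, 0)" "k \<noteq> (0, 0)"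
  shows "ord_at f P (ffm f h k) = ord_at f P h + ord_at f P k"
proof -
  obtain fc \<eta> \<kappa> x1 y1 U V where c: "chart_param f fc \<eta> \<kappa> x1 y1 P U V"
    using chart_param_exists[OF assms(1)] by blast
  interpret chart_param f fc \<eta> \<kappa> x1 y1 P U V by (rule c)
  show ?thesis
    using assms \<nu>_mult ord_at_eq_\<nu> ffm_eq_0_iff[OF nonsquare_f] by simp
qed

lemma ord_one:
  assumes "P \<in> curve_points f" shows "ord_at f P (1, 0) = 0"
  using ord_mult[OF assms, of "(1, 0)" "(1, 0)"] by simp

lemma ord_inverse:
  assumes "P \<in> curve_points f" "ffm f h k = (1, 0)"
  shows "ord_at f P k = - ord_at f P h"
proof -
  have "h \<noteq> (0, 0)" "k \<noteq> (0, 0)" using assms(2) by auto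
  then show ?thesis using ord_mult[OF assms(1), of h k] ord_one[OF assms(1)] assms(2) by simp
qed

lemma ord_emb:
  assumes "param f x y U V" "u \<noteq> (0, 0)"
  shows "ord_at f (Affine x y) (emb u) = int (subdegree (pair_ev U V u))"
proof -
  interpret chart_param f f "\<lambda>p. Fract p 1" 1 x y "Affine x y" U V
    by (rule chart_param_affine[OF assms(1)])
  have "emb u = \<chi> u" by (cases u) (simp add: emb_def)
  then show ?thesis using ord_at_eq_\<nu> \<nu>_\<chi> assms(2) \<chi>_eq_0_iff by metis
qed

lemma principal_divisors_subgroup:
  "subgroup (principal_divisors f) (free_Abelian_group (curve_points f))"
proof
  show "principal_divisors f \<subseteq> carrier (free_Abelian_group (curve_points f))"
    by (auto simp: principal_divisors_def)
next
  fix D E assume "D \<in> principal_divisors f" "E \<in> principal_divisors f"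
  then obtain h k where *: "Poly_Mapping.keys D \<subseteq> curve_points f" "Poly_Mapping.keys E \<subseteq> curve_points f"
    "h \<noteq> (0, 0)" "k \<noteq> (0, 0)"
    "\<And>P. P \<in> curve_points f \<Longrightarrow> Poly_Mapping.lookup D P = ord_at f P h"
    "\<And>P. P \<in> curve_points f \<Longrightarrow> Poly_Mapping.lookup E P = ord_at f P k"
    unfolding principal_divisors_iff by blast
  have "Poly_Mapping.keys (D + E) \<subseteq> curve_points f"
    using *(1,2) keys_add[of D E] by blast
  moreover have "ffm f h k \<noteq> (0, 0)" using * ffm_eq_0_iff[OF nonsquare_f] by simp
  ultimately show "D \<otimes>\<^bsub>free_Abelian_group (curve_points f)\<^esub> E \<in> principal_divisors f"
    using * ord_mult[OF _ *(3,4)] unfolding principal_divisors_iff mult_free_Abelian_group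
    by (auto simp: lookup_add simp del: split_paired_Ex intro!: exI[of _ "ffm f h k"])
next
  show "\<one>\<^bsub>free_Abelian_group (curve_points f)\<^esub> \<in> principal_divisors f"
    using ord_one unfolding principal_divisors_iff
    by (auto simp del: split_paired_Ex intro!: exI[of _ "(1, 0)"])
next
  fix D assume "D \<in> principal_divisors f"
  then obtain h where *: "Poly_Mapping.keys D \<subseteq> curve_points f" "h \<noteq> (0, 0)"
    "\<And>P. P \<in> curve_points f \<Longrightarrow> Poly_Mapping.lookup D P = ord_at f P h"
    unfolding principal_divisors_iff by blast
  obtain k where k: "ffm f h k = (1, 0)" using ffm_inverse[OF nonsquare_f *(2)] by blast
  then have "k \<noteq> (0, 0)" by auto
  then show "inv\<^bsub>free_Abelian_group (curve_points f)\<^esub> D \<in> principal_divisors f"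
    using * ord_inverse[OF _ k] unfolding principal_divisors_iff
    by (auto simp: keys_minus simp del: split_paired_Ex intro!: exI[of _ k])
qed

end

section \<open>Regular functions and their poles at infinity\<close>

lemma linear_power_dvd:
  fixes U :: "'a::field_char_0 fps"
  assumes "U $ 0 = x1" "U - fps_const x1 \<noteq> 0" "subdegree (U - fps_const x1) = 1"
    "\<And>i. i < k \<Longrightarrow> pev a U $ i = 0"
  shows "[:- x1, 1:] ^ k dvd a"
proof (cases "a = 0")
  case False
  have ne: "pev a U \<noteq> 0 \<and> subdegree (pev a U) = order x1 a * 1"
    using pev_nonzero_subdegree[OF False _ assms(1)] assms(2,3) by force
  then have "k \<le> order x1 a"
    using subdegree_geI[of "pev a U" k] assms(4) by simp
  then show ?thesis using order_1 power_le_dvd by blast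
qed simp

lemma (in chart_param) divides_power_weierstrass:
  assumes "y1 = 0" "u \<noteq> (0, 0)" "2 * k \<le> subdegree (\<Psi> u)"
  shows "[:- x1, 1:] ^ k dvd fst u \<and> [:- x1, 1:] ^ k dvd snd u"
  using assms(2,3)
proof (induction k arbitrary: u)
  case (Suc k)
  have d: "subdegree (U - fps_const x1) = 2"
    using param_weierstrass[of fc x1 U V] param assms(1) on_chart by simp
  have "\<Psi> u $ 0 = 0" "\<Psi> u $ 1 = 0"
    using Suc.prems(2) by (auto intro: nth_less_subdegree_zero)
  then obtain v where v: "u = pair_mult fc ([:- x1, 1:], 0) v"
    using divides_weierstrass assms(1) by blast
  have v0: "v \<noteq> (0, 0)" using v Suc.prems(1) by (metis pair_mult_zero(2))
  have "subdegree (\<Psi> u) = 2 + subdegree (\<Psi> v)"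
    unfolding v \<Psi>_mult \<Psi>_linear using U_nonconst v0 d by (simp add: subdegree_mult \<Psi>_eq_0_iff)
  then have IH: "[:- x1, 1:] ^ k dvd fst v \<and> [:- x1, 1:] ^ k dvd snd v"
    using Suc.IH[OF v0] Suc.prems(2) by simp
  have "fst u = [:- x1, 1:] * fst v" "snd u = [:- x1, 1:] * snd v"
    unfolding v by (cases v, simp only: pair_mult_const fst_conv snd_conv)+
  then show ?case using IH by (metis mult_dvd_mono dvd_refl power_Suc)
qed simp

lemma sqrt_exists: "\<exists>y. y\<^sup>2 = (c :: 'a::alg_closed_field)"
proof -
  obtain y where "poly [:- c, 0, 1:] y = 0"
    using alg_closed_imp_poly_has_root[of "[:- c, 0, 1:]"] by auto
  then show ?thesis by (intro exI[of _ y]) (simp add: power2_eq_square)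
qed

text \<open>For y \<noteq> 0 there are two points (x1, y) and (x1, -y) above x1; the half sum and
  the half difference of the two expansions isolate a and b y. For y = 0 there is one point, at
  which x - x1 has order 2.\<close>

lemma divisible_at_abscissa:
  fixes fc :: "'a::{alg_closed_field, field_char_0} poly"
  assumes "\<And>y U V. param fc x1 y U V \<Longrightarrow> \<exists>f \<eta> \<kappa> P. chart_param f fc \<eta> \<kappa> x1 y P U V"
    and "(a, b) \<noteq> (0, 0)"
    and "poly fc x1 = 0 \<Longrightarrow> poly (pderiv fc) x1 \<noteq> 0"
    and sub: "\<And>y U V. param fc x1 y U V \<Longrightarrow>
      k * subdegree (U - fps_const x1) \<le> subdegree (pair_ev U V (a, b))"
  shows "[:- x1, 1:] ^ k dvd a \<and> [:- x1, 1:] ^ k dvd b"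
proof -
  obtain y where y: "y\<^sup>2 = poly fc x1" using sqrt_exists by blast
  have "y = 0 \<Longrightarrow> poly (pderiv fc) x1 \<noteq> 0" using assms(3) y by simp
  then obtain U V where p: "param fc x1 y U V" using param_exists[OF y] by blast
  show ?thesis
  proof (cases "y = 0")
    case True
    obtain f \<eta> \<kappa> P where c: "chart_param f fc \<eta> \<kappa> x1 y P U V" using assms(1)[OF p] by blast
    interpret chart_param f fc \<eta> \<kappa> x1 y P U V by (rule c)
    have "subdegree (U - fps_const x1) = 2"
      using param_weierstrass[of fc x1 U V] p True on_chart by simp
    then show ?thesis
      using divides_power_weierstrass[OF True assms(2), of k] sub[OF p] by (simp add: mult.commute)
  next
    case False
    have d: "U - fps_const x1 \<noteq> 0" "subdegree (U - fps_const x1) = 1"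
      using param_simple[OF p False] by auto
    have p': "param fc x1 (- y) U (- V)" using p by (simp add: param_def)
    have s: "pair_ev U V (a, b) $ i = 0" "pair_ev U (- V) (a, b) $ i = 0" if "i < k" for i
      using sub[OF p] sub[OF p'] d that by (auto intro!: nth_less_subdegree_zero)
    have V0: "V $ 0 \<noteq> 0" using p False by (simp add: param_def)
    have 1: "pev a U $ i = 0" if "i < k" for i
    proof -
      have "2 * pev a U $ i = pair_ev U V (a, b) $ i + pair_ev U (- V) (a, b) $ i"
        by (simp add: pair_ev_def)
      then show ?thesis using s[OF that] by simp
    qed
    have 2: "(pev b U * V) $ i = 0" if "i < k" for i
    proof -
      have "2 * (pev b U * V) $ i = pair_ev U V (a, b) $ i - pair_ev U (- V) (a, b) $ i"
        by (simp add: pair_ev_def)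
      then show ?thesis using s[OF that] by simp
    qed
    have 3: "pev b U $ i = 0" if "i < k" for i
    proof (cases "pev b U = 0")
      case False
      have "V \<noteq> 0" "subdegree V = 0" using V0 by (auto simp: subdegree_eq_0)
      moreover have "k \<le> subdegree (pev b U * V)"
        using False calculation 2 by (intro subdegree_geI) auto
      ultimately have "k \<le> subdegree (pev b U)" using False by (simp add: subdegree_mult)
      then show ?thesis using that by (intro nth_less_subdegree_zero) simp
    qed simp
    show ?thesis
      using linear_power_dvd[OF _ d] 1 3 p by (auto simp: param_def)
  qed
qed

lemma emb_mult: "ffm f (emb u) (emb v) = emb (pair_mult f u v)"
  by (simp add: emb_def pair_mult_def)

lemma emb_eq_iff: "emb u = emb v \<longleftrightarrow> u = v"
  by (auto simp: emb_def eq_fract prod_eq_iff)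

lemma emb_zero: "emb (0, 0) = (0, 0)"
  by (simp add: emb_def Zero_fract_def)

lemma emb_eq_0_iff: "emb u = (0, 0) \<longleftrightarrow> u = (0, 0)"
  using emb_eq_iff[of u "(0, 0)"] by (simp add: emb_zero)

text \<open>This is v^n p(1/v), for p of degree at most n. Reversal with respect to a fixed n is
  linear, unlike reversal with respect to the degree.\<close>

definition rev_poly :: "nat \<Rightarrow> 'a::field poly \<Rightarrow> 'a poly" where
  "rev_poly n p = monom 1 (n - degree p) * reflect_poly p"

lemma coeff_rev_poly:
  assumes "degree p \<le> n"
  shows "coeff (rev_poly n p) i = (if i \<le> n then coeff p (n - i) else 0)"
proof -
  have "coeff (rev_poly n p) i
    = (if i < n - degree p then 0 else coeff (reflect_poly p) (i - (n - degree p)))"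
    unfolding rev_poly_def monom_altdef
    by (metis coeff_monom_mult monom_altdef mult_1)
  then show ?thesis using assms by (auto simp: coeff_reflect_poly coeff_eq_0)
qed

lemma rev_poly_0 [simp]: "rev_poly n 0 = 0"
  by (simp add: rev_poly_def)

lemma rev_poly_eq_0_iff [simp]: "rev_poly n p = 0 \<longleftrightarrow> p = 0"
  by (simp add: rev_poly_def)

lemma eval_inv_x_rev_poly:
  "degree p \<le> n \<Longrightarrow> eval_inv_x (rev_poly n p) = inverse fract_x ^ n * Fract p 1"
  by (simp only: rev_poly_def eval_inv_x_mult eval_inv_x_monom eval_inv_x_reflect
      mult.assoc[symmetric] power_add[symmetric] le_add_diff_inverse2)

context hyperelliptic
begin

lemma ord_at_affine_eq:
  assumes "param f x y U V" "u \<noteq> (0, 0)" "v \<noteq> (0, 0)" "ffm f h (emb u) = emb v"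
  shows "ord_at f (Affine x y) h = int (subdegree (pair_ev U V v)) - int (subdegree (pair_ev U V u))"
proof -
  interpret chart_param f f "\<lambda>p. Fract p 1" 1 x y "Affine x y" U V
    by (rule chart_param_affine[OF assms(1)])
  have "emb u = \<chi> u" for u by (cases u) (simp add: emb_def)
  then show ?thesis using ord_at_eq assms(2,3,4) by metis
qed

text \<open>The coordinate ring of the affine chart is integrally closed: the denominator c loses
  one root at a time, because h has no pole above it and therefore x - x1 divides both components of
  the numerator.\<close>

lemma regular_imp_polynomial:
  assumes "h \<noteq> (0, 0)" "c \<noteq> 0" "ffm f h (emb (c, 0)) = emb u"
    "\<And>x y. y\<^sup>2 = poly f x \<Longrightarrow> ord_at f (Affine x y) h \<ge> 0"
  shows "\<exists>v. h = emb v"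
  using assms(2,3)
proof (induction "degree c" arbitrary: c u)
  case 0
  then obtain z where z: "c = [:z:]" using degree_eq_zeroE by metis
  then have "z \<noteq> 0" using 0 by auto
  have "ffm f (emb (c, 0)) (emb (pair_mult f ([:1 / z:], 0) u)) = emb u"
    using \<open>z \<noteq> 0\<close> by (simp only: emb_mult pair_mult_assoc[symmetric]) (simp add: z flip: one_pCons)
  then have "ffm f (emb (c, 0)) (emb (pair_mult f ([:1 / z:], 0) u)) = ffm f (emb (c, 0)) h"
    using 0 by (simp only: pair_mult_comm)
  then have "emb (pair_mult f ([:1 / z:], 0) u) = h"
    using ffm_cancel[OF nonsquare_f] 0 by (metis emb_eq_0_iff prod.inject)
  then show ?case by blast
next
  case (Suc n)
  obtain x1 where x1: "poly c x1 = 0"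
    using alg_closed_imp_poly_has_root[of c] Suc.hyps(2) by auto
  obtain c' where c': "c = [:- x1, 1:] * c'" using x1 by (metis poly_eq_0_iff_dvd dvdE)
  obtain a b where u: "u = (a, b)" by (cases u)
  have c'0: "c' \<noteq> 0" using c' Suc.prems(1) by auto
  have u0: "u \<noteq> (0, 0)"
    using Suc.prems assms(1) ffm_eq_0_iff[OF nonsquare_f, of h "emb (c, 0)"] by (auto simp: emb_eq_0_iff)
  have "[:- x1, 1:] ^ 1 dvd a \<and> [:- x1, 1:] ^ 1 dvd b"
  proof (rule divisible_at_abscissa)
    fix y U V assume p: "param f x1 y U V"
    show "\<exists>f' \<eta> \<kappa> P. chart_param f' f \<eta> \<kappa> x1 y P U V" using chart_param_affine[OF p] by blast
    interpret chart_param f f "\<lambda>p. Fract p 1" 1 x1 y "Affine x1 y" U V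
      by (rule chart_param_affine[OF p])
    have "subdegree (\<Psi> (c, 0)) = subdegree ((U - fps_const x1) * \<Psi> (c', 0))"
      unfolding \<Psi>_linear[symmetric] \<Psi>_mult[symmetric] by (simp only: pair_mult_const c' mult_zero_right)
    also have "\<dots> \<ge> subdegree (U - fps_const x1)"
      using U_nonconst c'0 by (simp add: subdegree_mult \<Psi>_eq_0_iff)
    finally have "subdegree (U - fps_const x1) \<le> subdegree (\<Psi> (c, 0))" .
    moreover have "0 \<le> int (subdegree (\<Psi> u)) - int (subdegree (\<Psi> (c, 0)))"
      using ord_at_affine_eq[OF p _ u0 Suc.prems(2)] Suc.prems(1) assms(4)[OF param_on_curve[OF p]] by simp
    ultimately show "1 * subdegree (U - fps_const x1) \<le> subdegree (\<Psi> (a, b))" using u by simp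
  qed (use simple_roots u0 u in auto)
  then obtain a' b' where ab: "a = [:- x1, 1:] * a'" "b = [:- x1, 1:] * b'"
    by (metis dvdE power_one_right)
  have "ffm f (emb ([:- x1, 1:], 0)) (ffm f h (emb (c', 0))) = ffm f h (emb (pair_mult f ([:- x1, 1:], 0) (c', 0)))"
    by (simp only: emb_mult[symmetric] pair_mult_left_comm)
  also have "\<dots> = emb u"
    using Suc.prems(2) by (simp only: pair_mult_const c' mult_zero_right)
  also have "\<dots> = ffm f (emb ([:- x1, 1:], 0)) (emb (a', b'))"
    by (simp only: emb_mult pair_mult_const u ab)
  finally have "ffm f h (emb (c', 0)) = emb (a', b')"
    by (rule ffm_cancel[OF nonsquare_f, rotated]) (simp add: emb_eq_0_iff)
  moreover have "n = degree c'"
    using Suc.hyps(2) c'0 unfolding c' by (subst (asm) degree_mult_eq) simp_all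
  ultimately show ?case using Suc.hyps(1)[of c' "(a', b')"] c'0 by blast
qed

text \<open>Multiplication by v^n = x^(-n) turns A + B y into the pair of reversed polynomials,
  where B y v^n becomes the reversed B times w. The subtracted term is the order of v^n.\<close>

lemma ord_infty_emb:
  assumes "param (inf_poly f) 0 w U V" "(A, B) \<noteq> (0, 0)" "degree A \<le> n" "B = 0 \<or> degree B + genus f + 1 \<le> n"
  shows "ord_at f (Infty w) (emb (A, B))
    = int (subdegree (pair_ev U V (rev_poly n A, rev_poly (n - (genus f + 1)) B))) - int n * int (subdegree U)"
proof -
  interpret chart_param f "inf_poly f" eval_inv_x "Fract 1 [:0, 1:] ^ (genus f + 1)" 0 w "Infty w" U V
    by (rule chart_param_infty[OF assms(1)])
  let ?u = "(monom 1 n :: 'a poly, 0)" and ?v = "(rev_poly n A, rev_poly (n - (genus f + 1)) B)"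
  have e: "eval_inv_x (rev_poly (n - (genus f + 1)) B) * inverse fract_x ^ (genus f + 1)
     = inverse fract_x ^ n * Fract B 1"
  proof (cases "B = 0")
    case False
    then have le: "genus f + 1 \<le> n" "degree B \<le> n - (genus f + 1)" using assms(4) by auto
    have "inverse fract_x ^ n = inverse fract_x ^ (n - (genus f + 1)) * inverse (fract_x :: 'a poly fract) ^ (genus f + 1)"
      using le(1) by (simp only: power_add[symmetric] le_add_diff_inverse2)
    then show ?thesis by (simp only: eval_inv_x_rev_poly[OF le(2)] mult_ac)
  qed (simp add: eval_inv_x_ev Zero_fract_def[symmetric])
  have "ffm f (emb (A, B)) (\<chi> ?u) = \<chi> ?v"
    unfolding \<chi>_def inverse_fract_x emb_def pair_mult_def fst_conv snd_conv e eval_inv_x_monom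
      eval_inv_x_rev_poly[OF assms(3)]
    by (simp add: eval_inv_x_ev mult.commute del: inverse_fract)
  moreover have "?v \<noteq> (0, 0)" "?u \<noteq> (0, 0)" using assms(2) by auto
  ultimately have "ord_at f (Infty w) (emb (A, B)) = int (subdegree (\<Psi> ?v)) - int (subdegree (\<Psi> ?u))"
    by (intro ord_at_eq)
  moreover have "subdegree (\<Psi> ?u) = n * subdegree U"
    by (simp add: pair_ev_def fps_ev.ev_monom subdegree_power)
  ultimately show ?thesis by simp
qed

text \<open>The hypothesis says that A + B y has no larger pole at infinity than x^n. As
  \<open>subdegree U\<close> is 1 at each of two points at infinity and 2 at a single one, one
  formula covers both kinds of curves.\<close>

lemma degree_le_if_ord_infty:
  assumes "(A, B) \<noteq> (0, 0)"
    "\<And>w U V. param (inf_poly f) 0 w U V \<Longrightarrow> ord_at f (Infty w) (emb (A, B)) \<ge> - int n * int (subdegree U)"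
  shows "degree A \<le> n \<and> (B = 0 \<or> degree B + genus f + 1 \<le> n)"
proof -
  \<comment> \<open>An a priori bound for the degrees. Its surplus m - n is an exponent of v that
    must divide both reversed polynomials, which removes the top coefficients.\<close>
  define m where "m = n + degree A + degree B + genus f + 1"
  have m: "degree A \<le> m" "B = 0 \<or> degree B + genus f + 1 \<le> m" "degree B \<le> m - (genus f + 1)"
    by (simp_all add: m_def)
  let ?a = "rev_poly m A" and ?b = "rev_poly (m - (genus f + 1)) B"
  have ab: "(?a, ?b) \<noteq> (0, 0)" using assms(1) by simp
  have "[:- 0, 1:] ^ (m - n) dvd ?a \<and> [:- 0, 1:] ^ (m - n) dvd ?b"
  proof (rule divisible_at_abscissa[OF _ ab])
    fix w U V assume p: "param (inf_poly f) 0 w U V"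
    show "\<exists>f' \<eta> \<kappa> P. chart_param f' (inf_poly f) \<eta> \<kappa> 0 w P U V" using chart_param_infty[OF p] by blast
    have "- int n * int (subdegree U) \<le> int (subdegree (pair_ev U V (?a, ?b))) - int m * int (subdegree U)"
      using ord_infty_emb[OF p assms(1) m(1,2)] assms(2)[OF p] by simp
    then have "int m * int (subdegree U) - int n * int (subdegree U) \<le> int (subdegree (pair_ev U V (?a, ?b)))"
      by simp
    moreover have "int ((m - n) * subdegree U) = int m * int (subdegree U) - int n * int (subdegree U)"
      by (simp add: m_def algebra_simps)
    ultimately have "int ((m - n) * subdegree U) \<le> int (subdegree (pair_ev U V (?a, ?b)))"
      by (simp only:)
    then show "(m - n) * subdegree (U - fps_const 0) \<le> subdegree (pair_ev U V (?a, ?b))"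
      by (simp only: fps_const_0_eq_0 diff_zero of_nat_le_iff)
  qed (use simple_inf_poly in auto)
  then have d: "monom 1 (m - n) dvd ?a" "monom 1 (m - n) dvd ?b"
    by (simp_all add: monom_altdef)
  have "degree A \<le> n"
  proof (rule degree_le, intro allI impI)
    fix i assume i: "i > n"
    show "coeff A i = 0"
    proof (cases "i \<le> m")
      case True
      then have "coeff ?a (m - i) = coeff A i" using coeff_rev_poly[OF m(1)] by simp
      moreover have "coeff ?a (m - i) = 0"
        using d(1) i True by (simp add: monom_1_dvd_iff')
      ultimately show ?thesis by simp
    qed (use m(1) in \<open>simp add: coeff_eq_0\<close>)
  qed
  moreover have "degree B + genus f + 1 \<le> n" if "B \<noteq> 0"
  proof (rule ccontr)
    assume "\<not> degree B + genus f + 1 \<le> n"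
    then have "m - (genus f + 1) - degree B < m - n" by (simp add: m_def)
    then have "coeff ?b (m - (genus f + 1) - degree B) = 0"
      using d(2) by (simp add: monom_1_dvd_iff')
    moreover have "coeff ?b (m - (genus f + 1) - degree B) = lead_coeff B"
    proof -
      have "m - (genus f + 1) - (m - (genus f + 1) - degree B) = degree B" using m(3) by simp
      then show ?thesis using coeff_rev_poly[OF m(3), of "m - (genus f + 1) - degree B"] by simp
    qed
    ultimately show False using that by simp
  qed
  ultimately show ?thesis by blast
qed

end

section \<open>The Galois action\<close>

locale field_hom = coeff_hom s for s :: "'a::field \<Rightarrow> 'b::field"
begin

lemma eq_0_iff: "s c = 0 \<longleftrightarrow> c = 0"
proof
  assume "s c = 0"
  show "c = 0"
  proof (rule ccontr)
    assume "c \<noteq> 0"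
    then have "s c * s (inverse c) = 1" using mult[of c "inverse c"] one by simp
    then show False using \<open>s c = 0\<close> by simp
  qed
qed (simp add: zero)

lemma degree_map: "degree (map_poly s p) = degree p"
  using degree_map_poly[of s p] eq_0_iff by (cases "p = 0") auto

lemma map_monom_mult: "map_poly s (monom 1 n * p) = monom 1 n * map_poly s p"
  by (rule poly_eqI) (simp add: coeff_map_poly coeff_monom_mult zero one)

lemma map_reflect: "map_poly s (reflect_poly p) = reflect_poly (map_poly s p)"
  using map_poly_reflect eq_0_iff by blast

lemma map_rev_poly: "map_poly s (rev_poly n p) = rev_poly n (map_poly s p)"
  by (simp add: rev_poly_def map_monom_mult map_reflect degree_map)

lemma genus_map: "genus (map_poly s f) = genus f"
  by (simp add: genus_def degree_map)

lemma map_inf_poly: "map_poly s (inf_poly f) = inf_poly (map_poly s f)"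
  by (simp add: inf_poly_def map_monom_mult map_reflect degree_map genus_map)

lemma map_eq_0_iff: "map_poly s p = 0 \<longleftrightarrow> p = 0"
  by (auto simp: poly_eq_iff coeff_map_poly zero eq_0_iff)

lemma poly_map: "poly (map_poly s p) (s x) = s (poly p x)"
  using ev_hom by (simp add: ev_def)

lemma map_pderiv: "map_poly s (pderiv p) = pderiv (map_poly s p)"
  by (rule poly_eqI) (simp add: coeff_map_poly coeff_pderiv mult of_nat zero one add)

definition fps_map :: "'a fps \<Rightarrow> 'b fps" where
  "fps_map F = Abs_fps (\<lambda>n. s (F $ n))"

lemma fps_map_nth [simp]: "fps_map F $ n = s (F $ n)"
  by (simp add: fps_map_def)

lemma fps_map_add: "fps_map (F + G) = fps_map F + fps_map G"
  by (rule fps_ext) (simp add: add)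

lemma fps_map_mult: "fps_map (F * G) = fps_map F * fps_map G"
  by (rule fps_ext) (simp add: fps_mult_nth sum mult)

lemma fps_map_const: "fps_map (fps_const c) = fps_const (s c)"
  by (rule fps_ext) (simp add: zero)

lemma fps_map_0: "fps_map 0 = 0"
  by (rule fps_ext) (simp add: zero)

lemma pev_map: "pev (map_poly s p) (fps_map U) = fps_map (pev p U)"
  by (induction p) (simp_all add: map_poly_pCons zero fps_map_0 fps_map_add fps_map_mult fps_map_const)

lemma subdegree_map: "subdegree (fps_map F) = subdegree F"
proof (cases "F = 0")
  case False
  then show ?thesis
    by (intro subdegreeI) (auto simp: eq_0_iff intro: nth_less_subdegree_zero)
qed (simp add: fps_map_0)

lemma param_map:
  assumes "param f x y U V"
  shows "param (map_poly s f) (s x) (s y) (fps_map U) (fps_map V)"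
proof -
  have "(fps_map V)\<^sup>2 = pev (map_poly s f) (fps_map U)"
    using assms unfolding pev_map by (simp add: param_def power2_eq_square flip: fps_map_mult)
  then show ?thesis using assms by (auto simp: param_def eq_0_iff)
qed

definition pair_map :: "'a poly \<times> 'a poly \<Rightarrow> 'b poly \<times> 'b poly" where
  "pair_map u = (map_poly s (fst u), map_poly s (snd u))"

lemma pair_ev_map: "pair_ev (fps_map U) (fps_map V) (pair_map u) = fps_map (pair_ev U V u)"
  by (simp add: pair_ev_def pair_map_def pev_map fps_map_add fps_map_mult)

lemma pair_map_eq_0_iff: "pair_map u = (0, 0) \<longleftrightarrow> u = (0, 0)"
  by (auto simp: pair_map_def map_eq_0_iff prod_eq_iff)

end

interpretation to_ac: field_hom "to_ac :: 'a::field \<Rightarrow> 'a alg_closure"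
  by unfold_locales simp_all

lemma map_hpoint_on_curve:
  assumes "field_hom s" "P \<in> curve_points f"
  shows "map_hpoint s P \<in> curve_points (map_poly s f)"
proof -
  interpret field_hom s by fact
  show ?thesis
    using assms(2) poly_map[of "inf_poly f" 0]
    by (cases P) (auto simp: curve_points_def poly_map zero map_inf_poly simp flip: power)
qed

lemma divisor_degree_superset:
  assumes "finite S" "Poly_Mapping.keys D \<subseteq> S"
  shows "divisor_degree D = (\<Sum>P\<in>S. Poly_Mapping.lookup D P)"
  unfolding divisor_degree_def using assms
  by (intro sum.mono_neutral_left) (auto simp: in_keys_iff)

lemma divisor_degree_add: "divisor_degree (D + E) = divisor_degree D + divisor_degree E"
proof -
  let ?S = "Poly_Mapping.keys D \<union> Poly_Mapping.keys E"
  have "Poly_Mapping.keys (D + E) \<subseteq> ?S" by (rule keys_add)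
  then show ?thesis
    by (simp add: divisor_degree_superset[of ?S] lookup_add sum.distrib)
qed

lemma divisor_degree_minus: "divisor_degree (- D) = - divisor_degree D"
  by (simp add: divisor_degree_def keys_minus sum_negf)

lemma lookup_conj_divisor:
  assumes "inj \<sigma>"
  shows "Poly_Mapping.lookup (conj_divisor \<sigma> D) (map_hpoint \<sigma> P) = Poly_Mapping.lookup D P"
proof -
  have inj: "map_hpoint \<sigma> P = map_hpoint \<sigma> Q \<longleftrightarrow> P = Q" for P Q
    using assms hpoint.inj_map by (auto dest: injD)
  have "Poly_Mapping.lookup (conj_divisor \<sigma> D) (map_hpoint \<sigma> P)
     = (\<Sum>Q\<in>Poly_Mapping.keys D. if P = Q then Poly_Mapping.lookup D Q else 0)"
    unfolding conj_divisor_def frag_extend_def lookup_sum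
    by (intro sum.cong) (auto simp: inj)
  also have "\<dots> = Poly_Mapping.lookup D P"
    by (simp add: in_keys_iff)
  finally show ?thesis .
qed

lemma conj_divisor_add: "conj_divisor \<sigma> (D + E) = conj_divisor \<sigma> D + conj_divisor \<sigma> E"
  by (simp add: conj_divisor_def frag_extend_add)

lemma conj_divisor_minus: "conj_divisor \<sigma> (- D) = - conj_divisor \<sigma> D"
  by (simp add: conj_divisor_def frag_extend_minus)

lemma keys_conj_divisor: "Poly_Mapping.keys (conj_divisor \<sigma> D) \<subseteq> map_hpoint \<sigma> ` Poly_Mapping.keys D"
  unfolding conj_divisor_def using keys_frag_extend by fastforce

lemma conj_divisor_compose: "conj_divisor \<sigma> (conj_divisor \<tau> D) = conj_divisor (\<sigma> \<circ> \<tau>) D"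
  unfolding conj_divisor_def
  using frag_extend_compose[of "\<lambda>P. frag_of (map_hpoint \<sigma> P)" "map_hpoint \<tau>" D]
  by (simp add: o_def hpoint.map_comp)

lemma conj_divisor_id: "conj_divisor id D = D"
  using frag_expansion[of D] by (simp add: conj_divisor_def hpoint.map_id)

lemma galois_Q_field_hom: "\<sigma> \<in> galois_Q \<Longrightarrow> field_hom \<sigma>"
  unfolding galois_Q_def by unfold_locales (auto, metis to_ac_1)

lemma galois_Q_inverse: "\<sigma> \<in> galois_Q \<Longrightarrow> inv_into UNIV \<sigma> \<in> galois_Q"
  unfolding galois_Q_def
proof (safe, goal_cases)
  case 1
  from 1(1) show ?case by (rule bij_imp_bij_inv)
next
  case (2 x y)
  then show ?case
    by (intro inv_f_eq) (auto simp: bij_is_inj bij_is_surj surj_f_inv_f)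
next
  case (3 x y)
  then show ?case
    by (intro inv_f_eq) (auto simp: bij_is_inj bij_is_surj surj_f_inv_f)
next
  case (4 q)
  then show ?case by (intro inv_f_eq) (auto simp: bij_is_inj)
qed

lemma galois_Q_map_rational:
  assumes "\<sigma> \<in> galois_Q" shows "map_poly \<sigma> (map_poly to_ac p) = map_poly to_ac p"
proof (rule poly_eqI)
  fix i
  interpret field_hom \<sigma> by (rule galois_Q_field_hom[OF assms])
  show "coeff (map_poly \<sigma> (map_poly to_ac p)) i = coeff (map_poly to_ac p) i"
    using assms by (simp add: coeff_map_poly zero galois_Q_def)
qed

locale hyperelliptic_Q =
  fixes f0 :: "rat poly"
  assumes hyper: "hyperelliptic (map_poly to_ac f0)"
begin

abbreviation f where "f \<equiv> map_poly to_ac f0"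

sublocale hyperelliptic f by (rule hyper)

lemma galois_on_curve:
  "\<sigma> \<in> galois_Q \<Longrightarrow> P \<in> curve_points f \<Longrightarrow> map_hpoint \<sigma> P \<in> curve_points f"
  using map_hpoint_on_curve[OF galois_Q_field_hom] galois_Q_map_rational by metis

text \<open>A parametrisation at P conjugates to one at the image of P. Along it the conjugate of u
  has the conjugate expansion, hence the same order.\<close>

lemma ord_galois_emb:
  assumes "\<sigma> \<in> galois_Q" "P \<in> curve_points f" "u \<noteq> (0, 0)"
  shows "ord_at f (map_hpoint \<sigma> P) (emb (map_poly \<sigma> (fst u), map_poly \<sigma> (snd u))) = ord_at f P (emb u)"
proof -
  interpret s: field_hom \<sigma> by (rule galois_Q_field_hom[OF assms(1)])
  have fix_f: "map_poly \<sigma> f = f" by (rule galois_Q_map_rational[OF assms(1)])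
  have u': "s.pair_map u \<noteq> (0, 0)" using assms(3) by (simp add: s.pair_map_eq_0_iff)
  show ?thesis
  proof (cases P)
    case (Affine x y)
    then have "y\<^sup>2 = poly f x" using assms by (simp add: curve_points_def)
    then obtain U V where p: "param f x y U V" using param_exists simple_roots by (metis zero_power2)
    show ?thesis
      using ord_emb[OF p assms(3)] ord_emb[OF s.param_map[OF p, unfolded fix_f] u'] Affine
      by (simp add: s.pair_ev_map s.subdegree_map) (simp add: s.pair_map_def)
  next
    case (Infty w)
    then have "w\<^sup>2 = poly (inf_poly f) 0" using assms by (simp add: curve_points_def)
    then obtain U V where p: "param (inf_poly f) 0 w U V" using param_exists simple_inf_poly by (metis zero_power2)
    obtain A B where u: "u = (A, B)" by (cases u)
    define n where "n = degree A + degree B + genus f + 1"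
    let ?m = "n - (genus f + 1)"
    have p': "param (inf_poly f) 0 (\<sigma> w) (s.fps_map U) (s.fps_map V)"
      using s.param_map[OF p] by (simp only: s.map_inf_poly fix_f s.zero)
    have 1: "ord_at f (Infty w) (emb (A, B))
       = int (subdegree (pair_ev U V (rev_poly n A, rev_poly ?m B))) - int n * int (subdegree U)"
      using assms(3) u by (intro ord_infty_emb[OF p]) (auto simp: n_def)
    have 2: "ord_at f (Infty (\<sigma> w)) (emb (map_poly \<sigma> A, map_poly \<sigma> B))
       = int (subdegree (pair_ev (s.fps_map U) (s.fps_map V) (rev_poly n (map_poly \<sigma> A), rev_poly ?m (map_poly \<sigma> B))))
         - int n * int (subdegree (s.fps_map U))"
      using u' u by (intro ord_infty_emb[OF p']) (auto simp: n_def s.degree_map s.pair_map_def)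
    have 3: "(rev_poly n (map_poly \<sigma> A), rev_poly ?m (map_poly \<sigma> B)) = s.pair_map (rev_poly n A, rev_poly ?m B)"
      by (simp add: s.pair_map_def s.map_rev_poly)
    show ?thesis
      using 1 2 Infty u unfolding 3 s.pair_ev_map s.subdegree_map by simp
  qed
qed

lemma fraction_of_polys:
  obtains c u where "c \<noteq> 0" "ffm f h (emb (c, 0)) = emb u"
proof -
  obtain a1 c1 where 1: "fst h = Fract a1 c1" "c1 \<noteq> 0" by (cases "fst h") auto
  obtain a2 c2 where 2: "snd h = Fract a2 c2" "c2 \<noteq> 0" by (cases "snd h") auto
  have "ffm f h (emb (c1 * c2, 0)) = emb (a1 * c2, a2 * c1)"
    using 1 2 by (simp add: emb_def pair_mult_def Zero_fract_def[symmetric] eq_fract mult_ac)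
  then show ?thesis using 1 2 that[of "c1 * c2"] by simp
qed

lemma principal_conj:
  assumes "\<sigma> \<in> galois_Q" "D \<in> principal_divisors f"
  shows "conj_divisor \<sigma> D \<in> principal_divisors f"
proof -
  interpret s: field_hom \<sigma> by (rule galois_Q_field_hom[OF assms(1)])
  obtain h where h: "Poly_Mapping.keys D \<subseteq> curve_points f" "h \<noteq> (0, 0)"
    "\<And>P. P \<in> curve_points f \<Longrightarrow> Poly_Mapping.lookup D P = ord_at f P h"
    using assms(2) unfolding principal_divisors_iff by blast
  obtain c u where cu: "c \<noteq> 0" "ffm f h (emb (c, 0)) = emb u" using fraction_of_polys by blast
  have u0: "u \<noteq> (0, 0)"
    using cu h(2) ffm_eq_0_iff[OF nonsquare_f, of h "emb (c, 0)"] by (auto simp: emb_eq_0_iff)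
  let ?c = "emb (s.pair_map (c, 0))" and ?u = "emb (s.pair_map u)"
  have c0: "?c \<noteq> (0, 0)" and u0': "?u \<noteq> (0, 0)" using cu u0 by (simp_all add: emb_eq_0_iff s.pair_map_eq_0_iff)
  obtain z where z: "ffm f ?c z = (1, 0)" using ffm_inverse[OF nonsquare_f c0] by blast
  \<comment> \<open>The conjugate of h: as \<sigma> acts on polynomials, it is formed from the
    numerator u and the denominator c.\<close>
  define k where "k = ffm f ?u z"
  have k: "ffm f k ?c = ?u" unfolding k_def using z by (simp add: pair_mult_assoc pair_mult_comm[of _ z])
  have k0: "k \<noteq> (0, 0)" using k u0' by auto
  have ord: "ord_at f (map_hpoint \<sigma> P) k = ord_at f P h" if P: "P \<in> curve_points f" for P
  proof -
    have "ord_at f (map_hpoint \<sigma> P) k + ord_at f (map_hpoint \<sigma> P) ?c = ord_at f (map_hpoint \<sigma> P) ?u"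
      using ord_mult[OF galois_on_curve[OF assms(1) P] k0 c0] k by simp
    moreover have "ord_at f P h + ord_at f P (emb (c, 0)) = ord_at f P (emb u)"
      using ord_mult[OF P h(2), of "emb (c, 0)"] cu by (simp add: emb_eq_0_iff)
    moreover have "ord_at f (map_hpoint \<sigma> P) ?c = ord_at f P (emb (c, 0))"
      "ord_at f (map_hpoint \<sigma> P) ?u = ord_at f P (emb u)"
      using ord_galois_emb[OF assms(1) P] cu(1) u0 unfolding s.pair_map_def by blast+
    ultimately show ?thesis by simp
  qed
  have surj: "\<exists>Q\<in>curve_points f. P = map_hpoint \<sigma> Q" if P: "P \<in> curve_points f" for P
  proof
    show "map_hpoint (inv_into UNIV \<sigma>) P \<in> curve_points f"
      using galois_on_curve[OF galois_Q_inverse[OF assms(1)] P] .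
    have "\<sigma> \<circ> inv_into UNIV \<sigma> = id"
      using assms(1) by (auto simp: galois_Q_def fun_eq_iff bij_is_surj surj_f_inv_f)
    then show "P = map_hpoint \<sigma> (map_hpoint (inv_into UNIV \<sigma>) P)"
      by (simp add: hpoint.map_comp hpoint.map_id)
  qed
  have inj: "inj \<sigma>" using assms(1) by (auto simp: galois_Q_def bij_is_inj)
  have "\<forall>P\<in>curve_points f. Poly_Mapping.lookup (conj_divisor \<sigma> D) P = ord_at f P k"
    using surj ord h(3) lookup_conj_divisor[OF inj] by metis
  moreover have "Poly_Mapping.keys (conj_divisor \<sigma> D) \<subseteq> curve_points f"
    using keys_conj_divisor[of \<sigma> D] h(1) galois_on_curve[OF assms(1)] by blast
  ultimately show ?thesis unfolding principal_divisors_iff using k0 by blast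
qed

lemma principal_conj_image:
  assumes "\<sigma> \<in> galois_Q" shows "conj_divisor \<sigma> ` principal_divisors f = principal_divisors f"
proof (intro equalityI subsetI)
  fix D assume "D \<in> principal_divisors f"
  then have "conj_divisor (inv_into UNIV \<sigma>) D \<in> principal_divisors f"
    using principal_conj galois_Q_inverse assms by blast
  moreover have "\<sigma> \<circ> inv_into UNIV \<sigma> = id"
    using assms by (auto simp: galois_Q_def fun_eq_iff bij_is_surj surj_f_inv_f)
  then have "D = conj_divisor \<sigma> (conj_divisor (inv_into UNIV \<sigma>) D)"
    by (simp add: conj_divisor_compose conj_divisor_id)
  ultimately show "D \<in> conj_divisor \<sigma> ` principal_divisors f" by blast
qed (use principal_conj assms in blast)

end

section \<open>Torsion in the Jacobian\<close>

text \<open>An element of infinite order would form an independent set by itself.\<close>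

lemma abelian_rank_0_torsion:
  assumes "comm_group G" "abelian_rank G = 0" "c \<in> carrier G"
  shows "\<exists>n::int. n \<noteq> 0 \<and> c [^]\<^bsub>G\<^esub> n = \<one>\<^bsub>G\<^esub>"
proof (rule ccontr)
  assume neg: "\<not> ?thesis"
  interpret comm_group G by fact
  have "Z_independent G {c}"
    unfolding Z_independent_def
  proof (intro conjI allI impI)
    fix n :: "'a \<Rightarrow> int" assume "(\<Otimes>\<^bsub>G\<^esub>a\<in>{c}. a [^]\<^bsub>G\<^esub> n a) = \<one>\<^bsub>G\<^esub>"
    then have "c [^]\<^bsub>G\<^esub> n c = \<one>\<^bsub>G\<^esub>"
      using assms(3) by (subst (asm) finprod_insert) auto
    then show "\<forall>a\<in>{c}. n a = 0" using neg by auto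
  qed (use assms(3) in auto)
  then have "enat (card {c}) \<le> abelian_rank G"
    unfolding abelian_rank_def by (intro Sup_upper) blast
  then show False using assms(2) by (simp add: enat_0_iff)
qed

context hyperelliptic_Q
begin

abbreviation F where "F \<equiv> free_Abelian_group (curve_points f)"
abbreviation H where "H \<equiv> principal_divisors f"

lemma normal_H: "H \<lhd> F"
  using principal_divisors_subgroup abelian_free_Abelian_group comm_group.normal_iff_subgroup by blast

lemma comm_group_F_mod_H: "comm_group (F Mod H)"
  by (rule comm_group.abelian_FactGroup[OF abelian_free_Abelian_group principal_divisors_subgroup])

lemma F_coset: "H #>\<^bsub>F\<^esub> D = (\<lambda>h. h + D) ` H"
  by (auto simp: r_coset_def)

lemma conj_coset:
  assumes "\<sigma> \<in> galois_Q"
  shows "conj_divisor \<sigma> ` (H #>\<^bsub>F\<^esub> D) = H #>\<^bsub>F\<^esub> conj_divisor \<sigma> D"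
proof -
  have "conj_divisor \<sigma> ` (H #>\<^bsub>F\<^esub> D) = (\<lambda>h. h + conj_divisor \<sigma> D) ` conj_divisor \<sigma> ` H"
    by (simp add: F_coset image_image conj_divisor_add)
  then show ?thesis by (simp add: principal_conj_image[OF assms] F_coset)
qed

text \<open>
  Viewed inside the quotient of the group of all divisors, the Picard group is a group even before
  principal divisors are known to have degree 0; that fact is never needed.
\<close>

definition jacobian_carrier where
  "jacobian_carrier = {H #>\<^bsub>F\<^esub> D | D. D \<in> carrier F \<and> divisor_degree D = 0 \<and>
     (\<forall>\<sigma>\<in>galois_Q. H #>\<^bsub>F\<^esub> conj_divisor \<sigma> D = H #>\<^bsub>F\<^esub> D)}"

text \<open>Cosets and their products depend only on the addition of divisors, which
  \<open>div0_group\<close> shares with the group of all divisors. The Galois condition on a coset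
  becomes a condition on any representative.\<close>

lemma jacobian_Q_eq: "jacobian_Q f0 = (F Mod H)\<lparr>carrier := jacobian_carrier\<rparr>"
proof -
  have "set_mult (div0_group f) = set_mult F" "r_coset (div0_group f) H = r_coset F H"
    by (auto simp: set_mult_def r_coset_def div0_group_def fun_eq_iff)
  then have e: "pic0 f = (F Mod H)\<lparr>carrier := r_coset F H ` {D \<in> carrier F. divisor_degree D = 0}\<rparr>"
    by (auto simp: pic0_def FactGroup_def RCOSETS_def div0_group_def)
  have "{c \<in> r_coset F H ` {D \<in> carrier F. divisor_degree D = 0}. \<forall>\<sigma>\<in>galois_Q. conj_divisor \<sigma> ` c = c}
     = {H #>\<^bsub>F\<^esub> D | D. D \<in> carrier F \<and> divisor_degree D = 0 \<and>
         (\<forall>\<sigma>\<in>galois_Q. conj_divisor \<sigma> ` (H #>\<^bsub>F\<^esub> D) = H #>\<^bsub>F\<^esub> D)}"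
    by blast
  also have "\<dots> = jacobian_carrier"
    unfolding jacobian_carrier_def by (simp only: conj_coset cong: ball_cong)
  finally show ?thesis
    unfolding jacobian_Q_def e by simp
qed

lemma conj_carrier:
  assumes "\<sigma> \<in> galois_Q" "D \<in> carrier F" shows "conj_divisor \<sigma> D \<in> carrier F"
  using assms keys_conj_divisor[of \<sigma> D] galois_on_curve[OF assms(1)] by fastforce

lemma coset_add:
  "D \<in> carrier F \<Longrightarrow> E \<in> carrier F \<Longrightarrow> (H #>\<^bsub>F\<^esub> D) <#>\<^bsub>F\<^esub> (H #>\<^bsub>F\<^esub> E) = H #>\<^bsub>F\<^esub> (D + E)"
  using normal.rcos_sum[OF normal_H] by simp

lemma coset_minus:
  assumes "D \<in> carrier F" shows "inv\<^bsub>F Mod H\<^esub> (H #>\<^bsub>F\<^esub> D) = H #>\<^bsub>F\<^esub> (- D)"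
proof -
  interpret Q: comm_group "F Mod H" by (rule comm_group_F_mod_H)
  have minus: "- D \<in> carrier F" using assms by (simp add: keys_minus)
  have "(H #>\<^bsub>F\<^esub> (- D)) <#>\<^bsub>F\<^esub> (H #>\<^bsub>F\<^esub> D) = \<one>\<^bsub>F Mod H\<^esub>"
    unfolding coset_add[OF minus assms] by (simp add: F_coset)
  then show ?thesis
    using assms minus Q.inv_equality[of "H #>\<^bsub>F\<^esub> (- D)" "H #>\<^bsub>F\<^esub> D"]
    by (simp add: carrier_FactGroup del: carrier_free_Abelian_group_iff)
qed

lemma jacobian_subgroup: "subgroup jacobian_carrier (F Mod H)"
proof
  show "jacobian_carrier \<subseteq> carrier (F Mod H)"
    unfolding jacobian_carrier_def carrier_FactGroup by blast
next
  fix c d assume "c \<in> jacobian_carrier" "d \<in> jacobian_carrier"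
  then obtain D E where *: "c = H #>\<^bsub>F\<^esub> D" "d = H #>\<^bsub>F\<^esub> E" "D \<in> carrier F" "E \<in> carrier F"
    "divisor_degree D = 0" "divisor_degree E = 0"
    "\<And>\<sigma>. \<sigma> \<in> galois_Q \<Longrightarrow> H #>\<^bsub>F\<^esub> conj_divisor \<sigma> D = H #>\<^bsub>F\<^esub> D"
    "\<And>\<sigma>. \<sigma> \<in> galois_Q \<Longrightarrow> H #>\<^bsub>F\<^esub> conj_divisor \<sigma> E = H #>\<^bsub>F\<^esub> E"
    unfolding jacobian_carrier_def by blast
  have "H #>\<^bsub>F\<^esub> conj_divisor \<sigma> (D + E) = H #>\<^bsub>F\<^esub> (D + E)" if "\<sigma> \<in> galois_Q" for \<sigma>
    using coset_add[OF conj_carrier[OF that *(3)] conj_carrier[OF that *(4)]] coset_add[OF *(3,4)] *(7,8)[OF that]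
    by (simp add: conj_divisor_add)
  moreover have "D + E \<in> carrier F"
    using *(3,4) keys_add[of D E] by auto
  moreover have "c \<otimes>\<^bsub>F Mod H\<^esub> d = H #>\<^bsub>F\<^esub> (D + E)"
    using coset_add[OF *(3,4)] *(1,2) by simp
  ultimately show "c \<otimes>\<^bsub>F Mod H\<^esub> d \<in> jacobian_carrier"
    unfolding jacobian_carrier_def using *(5,6) divisor_degree_add[of D E] by auto
next
  have "H = H #>\<^bsub>F\<^esub> 0" by (simp add: F_coset)
  moreover have "divisor_degree (0 :: rat alg_closure hpoint \<Rightarrow>\<^sub>0 int) = 0"
    "conj_divisor \<sigma> (0 :: rat alg_closure hpoint \<Rightarrow>\<^sub>0 int) = 0" for \<sigma>
    by (simp_all add: divisor_degree_def conj_divisor_def)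
  ultimately show "\<one>\<^bsub>F Mod H\<^esub> \<in> jacobian_carrier"
    unfolding jacobian_carrier_def one_FactGroup mem_Collect_eq
    by (intro exI[of _ 0]) simp
next
  fix c assume "c \<in> jacobian_carrier"
  then obtain D where *: "c = H #>\<^bsub>F\<^esub> D" "D \<in> carrier F" "divisor_degree D = 0"
    "\<And>\<sigma>. \<sigma> \<in> galois_Q \<Longrightarrow> H #>\<^bsub>F\<^esub> conj_divisor \<sigma> D = H #>\<^bsub>F\<^esub> D"
    unfolding jacobian_carrier_def by blast
  have "H #>\<^bsub>F\<^esub> conj_divisor \<sigma> (- D) = H #>\<^bsub>F\<^esub> (- D)" if "\<sigma> \<in> galois_Q" for \<sigma>
    using coset_minus[OF conj_carrier[OF that *(2)]] coset_minus[OF *(2)] *(4)[OF that]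
    by (simp add: conj_divisor_minus)
  moreover have "- D \<in> carrier F" using *(2) by (simp add: keys_minus)
  moreover have "inv\<^bsub>F Mod H\<^esub> c = H #>\<^bsub>F\<^esub> (- D)"
    using coset_minus[OF *(2)] *(1) by simp
  ultimately show "inv\<^bsub>F Mod H\<^esub> c \<in> jacobian_carrier"
    using *(3) divisor_degree_minus[of D] unfolding jacobian_carrier_def mem_Collect_eq
    by (intro exI[of _ "- D"]) simp
qed

lemma comm_group_jacobian: "comm_group (jacobian_Q f0)"
proof -
  interpret Q: comm_group "F Mod H" by (rule comm_group_F_mod_H)
  show ?thesis
    unfolding jacobian_Q_eq
  proof (rule group.group_comm_groupI)
    show "group ((F Mod H)\<lparr>carrier := jacobian_carrier\<rparr>)"
      by (rule Q.subgroup_imp_group[OF jacobian_subgroup])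
    fix c d assume "c \<in> carrier ((F Mod H)\<lparr>carrier := jacobian_carrier\<rparr>)" "d \<in> carrier ((F Mod H)\<lparr>carrier := jacobian_carrier\<rparr>)"
    then have "c \<in> carrier (F Mod H)" "d \<in> carrier (F Mod H)"
      using subgroup.subset[OF jacobian_subgroup] by auto
    then show "c \<otimes>\<^bsub>(F Mod H)\<lparr>carrier := jacobian_carrier\<rparr>\<^esub> d = d \<otimes>\<^bsub>(F Mod H)\<lparr>carrier := jacobian_carrier\<rparr>\<^esub> c"
      using Q.m_comm by simp
  qed
qed

theorem rational_divisor_torsion:
  assumes "abelian_rank (jacobian_Q f0) = 0" "Poly_Mapping.keys D \<subseteq> curve_points f" "divisor_degree D = 0"
    "\<And>\<sigma>. \<sigma> \<in> galois_Q \<Longrightarrow> conj_divisor \<sigma> D = D"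
  shows "\<exists>n>0. frag_cmul (int n) D \<in> principal_divisors f"
proof -
  interpret Q: comm_group "F Mod H" by (rule comm_group_F_mod_H)
  let ?c = "H #>\<^bsub>F\<^esub> D"
  have c: "?c \<in> jacobian_carrier"
    unfolding jacobian_carrier_def using assms(2-4) by auto
  then obtain n :: int where n: "n \<noteq> 0" "?c [^]\<^bsub>jacobian_Q f0\<^esub> n = \<one>\<^bsub>jacobian_Q f0\<^esub>"
    using abelian_rank_0_torsion[OF comm_group_jacobian assms(1), of ?c]
    by (auto simp: jacobian_Q_eq)
  have "?c [^]\<^bsub>F Mod H\<^esub> n = H"
    using n(2) Q.int_pow_consistent[OF jacobian_subgroup c] by (simp add: jacobian_Q_eq)
  moreover have "?c [^]\<^bsub>F Mod H\<^esub> n = H #>\<^bsub>F\<^esub> (D [^]\<^bsub>F\<^esub> n)"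
    using normal.FactGroup_int_pow[OF normal_H] assms(2) by simp
  ultimately have "H #>\<^bsub>F\<^esub> frag_cmul n D = H" using assms(2) by simp
  moreover have "0 \<in> H"
    using subgroup.one_closed[OF principal_divisors_subgroup] by simp
  ultimately have mem: "frag_cmul n D \<in> H"
    unfolding F_coset by force
  have "inv\<^bsub>F\<^esub> (frag_cmul n D) \<in> H"
    by (rule subgroup.m_inv_closed[OF principal_divisors_subgroup mem])
  then have "frag_cmul (- n) D \<in> H"
    using mem unfolding principal_divisors_iff[of "frag_cmul n D"] by simp
  \<comment> \<open>The torsion exponent is only known to be nonzero; a negative one is replaced by
    its opposite.\<close>
  then show ?thesis using mem n(1)
    by (cases "n > 0") (intro exI[of _ "nat n"] exI[of _ "nat (- n)"], simp)+
qed

end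

section \<open>Descent to the rational numbers\<close>

text \<open>Over the rationals the single vector \<alpha> is independent, so \<alpha> \<mapsto> 1
  extends to a linear functional on the algebraic closure.\<close>

lemma rational_functional:
  fixes \<alpha> :: "rat alg_closure"
  assumes "\<alpha> \<noteq> 0"
  shows "\<exists>\<phi> :: rat alg_closure \<Rightarrow> rat. \<phi> \<alpha> = 1 \<and> (\<forall>x y. \<phi> (x + y) = \<phi> x + \<phi> y) \<and>
     (\<forall>q x. \<phi> (to_ac q * x) = q * \<phi> x)"
proof -
  interpret vector_space_pair "\<lambda>q (x :: rat alg_closure). to_ac q * x" "\<lambda>q (x :: rat). q * x"
    by unfold_locales (simp_all add: algebra_simps)
  have "vs1.independent {\<alpha>}"
    using assms by (simp add: vs1.dependent_single)
  then obtain \<phi> where "Vector_Spaces.linear (\<lambda>q x. to_ac q * x) (\<lambda>q x. q * x) \<phi>" "\<phi> \<alpha> = 1"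
    using linear_independent_extend[of "{\<alpha>}" "\<lambda>_. 1"] by auto
  then show ?thesis
    by (auto simp: Vector_Spaces.linear_iff)
qed

text \<open>Along a parametrisation with rational coefficients, every coefficient of the expansion
  is a rational linear combination of the coefficients of A. The factor W absorbs the powers of U in
  the induction.\<close>

lemma pev_functional:
  fixes \<phi> :: "rat alg_closure \<Rightarrow> rat"
  assumes add: "\<And>x y. \<phi> (x + y) = \<phi> x + \<phi> y" and scale: "\<And>q x. \<phi> (to_ac q * x) = q * \<phi> x"
  shows "\<phi> ((pev A (to_ac.fps_map U) * to_ac.fps_map W) $ i) = (pev (map_poly \<phi> A) U * W) $ i"
proof -
  have 0: "\<phi> 0 = 0" using scale[of 0 0] by simp
  show ?thesis
  proof (induction A arbitrary: W)
    case (pCons a A)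
    have "\<phi> ((pev A (to_ac.fps_map U) * to_ac.fps_map (U * W)) $ i) = (pev (map_poly \<phi> A) U * (U * W)) $ i"
      by (rule pCons.IH)
    moreover have "\<phi> (a * to_ac (W $ i)) = \<phi> a * W $ i"
      using scale[of "W $ i" a] by (simp add: mult.commute)
    ultimately show ?case
      by (simp add: map_poly_pCons 0 add distrib_right distrib_left to_ac.fps_map_mult mult_ac)
  qed (simp add: 0)
qed

lemma to_ac_fps_map_1: "to_ac.fps_map 1 = 1"
  by (rule fps_ext) simp

text \<open>The last clause is the version for the chart at infinity, where the degree bounds make
  the functional commute with reversal.\<close>

lemma rational_descent:
  fixes A B :: "rat alg_closure poly"
  assumes "(A, B) \<noteq> (0, 0)"
  shows "\<exists>A' B' :: rat poly. (A', B') \<noteq> (0, 0) \<and> degree A' \<le> degree A \<and> degree B' \<le> degree B \<and>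
    (B = 0 \<longrightarrow> B' = 0) \<and>
    (\<forall>U V i. pair_ev (to_ac.fps_map U) (to_ac.fps_map V) (A, B) $ i = 0 \<longrightarrow> pair_ev U V (A', B') $ i = 0) \<and>
    (\<forall>m n U V i. degree A \<le> m \<longrightarrow> degree B \<le> n \<longrightarrow>
       pair_ev (to_ac.fps_map U) (to_ac.fps_map V) (rev_poly m A, rev_poly n B) $ i = 0 \<longrightarrow>
       pair_ev U V (rev_poly m A', rev_poly n B') $ i = 0)"
proof -
  \<comment> \<open>Normalising the functional at a nonzero coefficient of A or B keeps the image
    pair nonzero.\<close>
  obtain \<alpha> where \<alpha>: "\<alpha> \<noteq> 0" "(\<exists>i. \<alpha> = coeff A i) \<or> (\<exists>i. \<alpha> = coeff B i)"
    using assms by (metis leading_coeff_neq_0)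
  obtain \<phi> where \<phi>: "\<phi> \<alpha> = 1" and add: "\<And>x y. \<phi> (x + y) = \<phi> x + \<phi> y"
    and scale: "\<And>q x. \<phi> (to_ac q * x) = q * \<phi> x"
    using rational_functional[OF \<alpha>(1)] by blast
  have 0: "\<phi> 0 = 0" using scale[of 0 0] by simp
  have ev: "\<phi> (pair_ev (to_ac.fps_map U) (to_ac.fps_map V) (C, D) $ i) = pair_ev U V (map_poly \<phi> C, map_poly \<phi> D) $ i"
    for U V C D i
    using pev_functional[OF add scale, of C U 1 i] pev_functional[OF add scale, of D U V i]
    by (simp add: pair_ev_def add scale to_ac_fps_map_1)
  have deg: "degree (map_poly \<phi> C) \<le> degree C" for C
    by (rule degree_le) (auto simp: coeff_map_poly 0 coeff_eq_0)
  have rev: "map_poly \<phi> (rev_poly m C) = rev_poly m (map_poly \<phi> C)" if "degree C \<le> m" for m C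
  proof (rule poly_eqI)
    fix i
    have "degree (map_poly \<phi> C) \<le> m" using deg that le_trans by blast
    then show "coeff (map_poly \<phi> (rev_poly m C)) i = coeff (rev_poly m (map_poly \<phi> C)) i"
      using that by (simp add: coeff_map_poly 0 coeff_rev_poly)
  qed
  have "(map_poly \<phi> A, map_poly \<phi> B) \<noteq> (0, 0)"
  proof
    assume "(map_poly \<phi> A, map_poly \<phi> B) = (0, 0)"
    then have "\<phi> (coeff A i) = 0" "\<phi> (coeff B i) = 0" for i
      by (metis 0 coeff_0 coeff_map_poly prod.inject)+
    then show False using \<alpha>(2) \<phi> by auto
  qed
  moreover have "\<forall>U V i. pair_ev (to_ac.fps_map U) (to_ac.fps_map V) (A, B) $ i = 0 \<longrightarrow>
      pair_ev U V (map_poly \<phi> A, map_poly \<phi> B) $ i = 0"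
    using ev 0 by metis
  moreover have "\<forall>m n U V i. degree A \<le> m \<longrightarrow> degree B \<le> n \<longrightarrow>
       pair_ev (to_ac.fps_map U) (to_ac.fps_map V) (rev_poly m A, rev_poly n B) $ i = 0 \<longrightarrow>
       pair_ev U V (rev_poly m (map_poly \<phi> A), rev_poly n (map_poly \<phi> B)) $ i = 0"
    using ev 0 rev by metis
  ultimately show ?thesis
    using deg by (intro exI[of _ "map_poly \<phi> A"] exI[of _ "map_poly \<phi> B"]) simp
qed

section \<open>Functions with prescribed zeros obtained from torsion\<close>

context hyperelliptic_Q
begin

text \<open>No affine poles means polynomial in x and y, and a pole at infinity bounded by that of
  x^n means the degree bounds.\<close>

lemma polynomial_of_order_bounds:
  assumes "h \<noteq> (0, 0)"
    "\<And>x y. y\<^sup>2 = poly f x \<Longrightarrow> ord_at f (Affine x y) h \<ge> 0"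
    "\<And>w U V. param (inf_poly f) 0 w U V \<Longrightarrow> ord_at f (Infty w) h \<ge> - int n * int (subdegree U)"
  shows "\<exists>A B. h = emb (A, B) \<and> (A, B) \<noteq> (0, 0) \<and> degree A \<le> n \<and> (B = 0 \<or> degree B + genus f0 + 1 \<le> n)"
proof -
  obtain c u where "c \<noteq> 0" "ffm f h (emb (c, 0)) = emb u" using fraction_of_polys by blast
  then obtain v where "h = emb v" using regular_imp_polynomial assms(1,2) by blast
  then obtain A B where h: "h = emb (A, B)" by (cases v) blast
  then have "(A, B) \<noteq> (0, 0)" using assms(1) emb_zero by metis
  then show ?thesis
    using degree_le_if_ord_infty[of A B n] assms(3) h by (auto simp: to_ac.genus_map)
qed

lemma rational_on_curve: "y\<^sup>2 = poly f0 x \<Longrightarrow> (to_ac y)\<^sup>2 = poly f (to_ac x)"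
  by (metis to_ac.poly_map to_ac_power)

lemma on_curve_affine: "y\<^sup>2 = poly f x \<Longrightarrow> Affine x y \<in> curve_points f"
  by (simp add: curve_points_def)

lemma on_curve_infty: "w\<^sup>2 = poly (inf_poly f) 0 \<Longrightarrow> Infty w \<in> curve_points f"
  by (simp add: curve_points_def)

lemma galois_Q_to_ac: "\<sigma> \<in> galois_Q \<Longrightarrow> \<sigma> (to_ac q) = to_ac q"
  by (simp add: galois_Q_def)

lemma divisor_degree_difference: "divisor_degree (frag_cmul k (frag_of P - frag_of Q)) = 0"
proof -
  have "divisor_degree (frag_cmul k (frag_of P - frag_of Q))
     = (\<Sum>R\<in>{P, Q}. Poly_Mapping.lookup (frag_cmul k (frag_of P - frag_of Q)) R)"
    by (rule divisor_degree_superset) (auto simp: in_keys_iff lookup_minus split: if_splits)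
  then show ?thesis by (cases "P = Q") (auto simp: lookup_minus)
qed

text \<open>Torsion is applied to k (P - Q), so that k divides the resulting multiplicity; k = 5 is
  wanted for y^2 = x^5 + d.\<close>

lemma torsion_difference:
  assumes "abelian_rank (jacobian_Q f0) = 0" "k > 0"
    "P \<in> curve_points f" "Q \<in> curve_points f"
    "\<And>\<sigma>. \<sigma> \<in> galois_Q \<Longrightarrow> map_hpoint \<sigma> P = P" "\<And>\<sigma>. \<sigma> \<in> galois_Q \<Longrightarrow> map_hpoint \<sigma> Q = Q"
  shows "\<exists>n h. n > 0 \<and> k dvd n \<and> h \<noteq> (0, 0) \<and>
    (\<forall>R\<in>curve_points f. ord_at f R h = int n * ((if R = P then 1 else 0) - (if R = Q then 1 else 0)))"
proof -
  let ?D = "frag_cmul (int k) (frag_of P - frag_of Q)"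
  have keys: "Poly_Mapping.keys ?D \<subseteq> curve_points f"
    using assms(3,4) by (auto simp: in_keys_iff lookup_minus split: if_splits)
  have conj: "conj_divisor \<sigma> ?D = ?D" if "\<sigma> \<in> galois_Q" for \<sigma>
    using assms(5,6)[OF that] unfolding conj_divisor_def by (simp add: frag_extend_cmul frag_extend_diff)
  obtain n where n: "n > 0" "frag_cmul (int n) ?D \<in> principal_divisors f"
    using rational_divisor_torsion[OF assms(1) keys divisor_degree_difference conj] by blast
  then obtain h where h: "h \<noteq> (0, 0)"
    "\<And>R. R \<in> curve_points f \<Longrightarrow> Poly_Mapping.lookup (frag_cmul (int n) ?D) R = ord_at f R h"
    unfolding principal_divisors_iff by blast
  have "ord_at f R h = int (k * n) * ((if R = P then 1 else 0) - (if R = Q then 1 else 0))"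
    if "R \<in> curve_points f" for R
    using h(2)[OF that] by (simp add: lookup_minus mult_ac)
  then show ?thesis using h(1) n assms(2) by (intro exI[of _ "k * n"] exI[of _ h]) simp
qed

text \<open>Torsion gives h with divisor n (P - P'), where P' is the conjugate of P. Multiplication
  by (x - x0)^n cancels the pole at P' and doubles the zero at P; the product has poles only at
  infinity, no larger than those of x^n.\<close>

theorem conjugate_pair_function:
  assumes "abelian_rank (jacobian_Q f0) = 0" "y0\<^sup>2 = poly f0 x0" "y0 \<noteq> 0" "k > 0"
  shows "\<exists>n A B. n > 0 \<and> k dvd n \<and> (A, B) \<noteq> (0, 0) \<and> degree A \<le> n \<and> (B = 0 \<or> degree B + genus f0 + 1 \<le> n) \<and>
    (\<forall>U V i. param f0 x0 y0 U V \<longrightarrow> i < 2 * n \<longrightarrow> pair_ev U V (A, B) $ i = 0)"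
proof -
  let ?x = "to_ac x0" and ?y = "to_ac y0"
  let ?P = "Affine ?x ?y" and ?Q = "Affine ?x (- ?y)"
  have P: "?y\<^sup>2 = poly f ?x" using rational_on_curve assms(2) by blast
  then have Q: "(- ?y)\<^sup>2 = poly f ?x" by simp
  have y: "?y \<noteq> 0" "- ?y \<noteq> 0" using assms(3) by simp_all
  then have PQ: "?P \<noteq> ?Q" by simp
  have fixed: "map_hpoint \<sigma> ?P = ?P" "map_hpoint \<sigma> ?Q = ?Q" if "\<sigma> \<in> galois_Q" for \<sigma>
    using galois_Q_to_ac[OF that, of x0] galois_Q_to_ac[OF that, of y0] galois_Q_to_ac[OF that, of "- y0"] by simp_all
  obtain n h where n: "n > 0" "k dvd n" "h \<noteq> (0, 0)" and
    h: "\<And>R. R \<in> curve_points f \<Longrightarrow> ord_at f R h = int n * ((if R = ?P then 1 else 0) - (if R = ?Q then 1 else 0))"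
    using torsion_difference[OF assms(1,4) on_curve_affine[OF P] on_curve_affine[OF Q] fixed] by blast
  let ?l = "[:- ?x, 1:] ^ n"
  let ?e = "emb (?l, 0)"
  have l0: "(?l, 0) \<noteq> (0, 0 :: rat alg_closure poly)" by simp
  have e0: "?e \<noteq> (0, 0)" by (simp add: emb_eq_0_iff)
  let ?g = "ffm f h ?e"
  have g0: "?g \<noteq> (0, 0)" using n(3) e0 ffm_eq_0_iff[OF nonsquare_f] by blast
  have e_ord: "ord_at f (Affine ?x y) ?e = int n" if p: "param f ?x y U V" "y \<noteq> 0" for y U V
  proof -
    have "U - fps_const ?x \<noteq> 0" "subdegree (U - fps_const ?x) = 1"
      using param_simple[OF p] by auto
    moreover have "pair_ev U V (?l, 0) = (U - fps_const ?x) ^ n"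
      by (simp add: pair_ev_def fps_ev.ev_power flip: fps_const_neg)
    ultimately show ?thesis
      using ord_emb[OF p(1) l0] by (simp add: subdegree_power)
  qed
  have g_P: "ord_at f ?P ?g = int (2 * n)" and g_Q: "ord_at f ?Q ?g = 0"
  proof -
    obtain U V where "param f ?x ?y U V" using param_exists[OF P] y by blast
    moreover obtain U' V' where "param f ?x (- ?y) U' V'" using param_exists[OF Q] y by blast
    ultimately show "ord_at f ?P ?g = int (2 * n)" "ord_at f ?Q ?g = 0"
      using ord_mult[OF on_curve_affine[OF P] n(3) e0] ord_mult[OF on_curve_affine[OF Q] n(3) e0]
        e_ord y h[OF on_curve_affine[OF P]] h[OF on_curve_affine[OF Q]] PQ by simp_all
  qed
  have "\<exists>A B. ?g = emb (A, B) \<and> (A, B) \<noteq> (0, 0) \<and> degree A \<le> n \<and> (B = 0 \<or> degree B + genus f0 + 1 \<le> n)"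
  proof (rule polynomial_of_order_bounds[OF g0])
    fix x y assume R: "y\<^sup>2 = poly f x"
    show "ord_at f (Affine x y) ?g \<ge> 0"
    proof (cases "Affine x y = ?Q")
      case True
      then show ?thesis using g_Q by simp
    next
      case False
      obtain U V where p: "param f x y U V" using param_exists[OF R] simple_roots R by (metis zero_power2)
      have "ord_at f (Affine x y) ?e \<ge> 0" using ord_emb[OF p l0] by simp
      then show ?thesis
        using ord_mult[OF on_curve_affine[OF R] n(3) e0] h[OF on_curve_affine[OF R]] False by simp
    qed
  next
    fix w U V assume p: "param (inf_poly f) 0 w U V"
    have R: "Infty w \<in> curve_points f" using param_on_curve[OF p] by (rule on_curve_infty)
    have d: "degree ?l = n" by (simp add: degree_power_eq)
    have "coeff ?l n = 1" by (rule coeff_linear_power)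
    then have "pair_ev U V (rev_poly n ?l, rev_poly (n - (genus f + 1)) 0) $ 0 = 1"
      using p d coeff_rev_poly[of ?l n 0] by (simp add: pair_ev_def pev_nth_0 param_def poly_0_coeff_0)
    then have "subdegree (pair_ev U V (rev_poly n ?l, rev_poly (n - (genus f + 1)) 0)) = 0"
      by (simp add: subdegree_eq_0)
    then have "ord_at f (Infty w) ?e = - int n * int (subdegree U)"
      using ord_infty_emb[OF p l0, of n] d by simp
    then show "ord_at f (Infty w) ?g \<ge> - int n * int (subdegree U)"
      using ord_mult[OF R n(3) e0] h[OF R] by simp
  qed
  then obtain A B where AB: "?g = emb (A, B)" "(A, B) \<noteq> (0, 0)" "degree A \<le> n" "B = 0 \<or> degree B + genus f0 + 1 \<le> n"
    by blast
  obtain A' B' where *: "(A', B') \<noteq> (0, 0)" "degree A' \<le> degree A" "degree B' \<le> degree B" "B = 0 \<longrightarrow> B' = 0"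
    "\<And>U V i. pair_ev (to_ac.fps_map U) (to_ac.fps_map V) (A, B) $ i = 0 \<Longrightarrow> pair_ev U V (A', B') $ i = 0"
    using rational_descent[OF AB(2)] by blast
  have "pair_ev U V (A', B') $ i = 0" if p: "param f0 x0 y0 U V" and i: "i < 2 * n" for U V i
  proof (rule *(5), rule nth_less_subdegree_zero)
    have "subdegree (pair_ev (to_ac.fps_map U) (to_ac.fps_map V) (A, B)) = 2 * n"
      using ord_emb[OF to_ac.param_map[OF p] AB(2)] g_P unfolding AB(1) by simp
    then show "i < subdegree (pair_ev (to_ac.fps_map U) (to_ac.fps_map V) (A, B))" using i by simp
  qed
  moreover have "degree A' \<le> n" "B' = 0 \<or> degree B' + genus f0 + 1 \<le> n"
    using AB *(2-4) by auto
  ultimately show ?thesis using n(1,2) *(1) by blast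
qed

text \<open>Let Q be the point at infinity with coordinate w. A function h with divisor n (P - Q) is
  polynomial as it stands. That it has no pole at the other point at infinity means that the
  reversed pair, which is v^n h, vanishes there to order n.\<close>

theorem point_infinity_function:
  assumes "abelian_rank (jacobian_Q f0) = 0" "y0\<^sup>2 = poly f0 x0" "w\<^sup>2 = poly (inf_poly f0) 0" "w \<noteq> 0"
  shows "\<exists>n A B. n > 0 \<and> (A, B) \<noteq> (0, 0) \<and> degree A \<le> n \<and> (B = 0 \<or> degree B + genus f0 + 1 \<le> n) \<and>
    (\<forall>U V i. param f0 x0 y0 U V \<longrightarrow> i < n \<longrightarrow> pair_ev U V (A, B) $ i = 0) \<and>
    (\<forall>U V i. param (inf_poly f0) 0 (- w) U V \<longrightarrow> i < n \<longrightarrow>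
       pair_ev U V (rev_poly n A, rev_poly (n - (genus f0 + 1)) B) $ i = 0)"
proof -
  let ?x = "to_ac x0" and ?y = "to_ac y0" and ?w = "to_ac w"
  let ?P = "Affine ?x ?y" and ?Q = "Infty ?w"
  have P: "?y\<^sup>2 = poly f ?x" using rational_on_curve assms(2) by blast
  have Q: "?w\<^sup>2 = poly (inf_poly f) 0"
    using assms(3) by (metis to_ac.poly_map to_ac_power to_ac_0 to_ac.map_inf_poly)
  have w: "?w \<noteq> 0" using assms(4) by simp
  have fixed: "map_hpoint \<sigma> ?P = ?P" "map_hpoint \<sigma> ?Q = ?Q" if "\<sigma> \<in> galois_Q" for \<sigma>
    using galois_Q_to_ac[OF that, of x0] galois_Q_to_ac[OF that, of y0] galois_Q_to_ac[OF that, of w] by simp_all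
  obtain n h where n: "n > 0" "h \<noteq> (0, 0)" and
    h: "\<And>R. R \<in> curve_points f \<Longrightarrow> ord_at f R h = int n * ((if R = ?P then 1 else 0) - (if R = ?Q then 1 else 0))"
    using torsion_difference[OF assms(1) zero_less_one on_curve_affine[OF P] on_curve_infty[OF Q] fixed] by blast
  have "\<exists>A B. h = emb (A, B) \<and> (A, B) \<noteq> (0, 0) \<and> degree A \<le> n \<and> (B = 0 \<or> degree B + genus f0 + 1 \<le> n)"
  proof (rule polynomial_of_order_bounds[OF n(2)])
    fix x y assume "y\<^sup>2 = poly f x"
    then show "ord_at f (Affine x y) h \<ge> 0" using h[OF on_curve_affine] by simp
  next
    fix v U V assume p: "param (inf_poly f) 0 v U V"
    have R: "Infty v \<in> curve_points f" using param_on_curve[OF p] by (rule on_curve_infty)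
    have "subdegree U \<ge> 1" if "v = ?w"
      using param_simple[OF p] w that by simp
    then show "ord_at f (Infty v) h \<ge> - int n * int (subdegree U)"
      using h[OF R] by (auto simp: mult_le_cancel_left1)
  qed
  then obtain A B where AB: "h = emb (A, B)" "(A, B) \<noteq> (0, 0)" "degree A \<le> n" "B = 0 \<or> degree B + genus f0 + 1 \<le> n"
    by blast
  let ?m = "n - (genus f0 + 1)"
  have B: "degree B \<le> ?m" using AB(4) by auto
  obtain A' B' where *: "(A', B') \<noteq> (0, 0)" "degree A' \<le> degree A" "degree B' \<le> degree B" "B = 0 \<longrightarrow> B' = 0"
    "\<And>U V i. pair_ev (to_ac.fps_map U) (to_ac.fps_map V) (A, B) $ i = 0 \<Longrightarrow> pair_ev U V (A', B') $ i = 0"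
    "\<And>U V i. pair_ev (to_ac.fps_map U) (to_ac.fps_map V) (rev_poly n A, rev_poly ?m B) $ i = 0 \<Longrightarrow>
       pair_ev U V (rev_poly n A', rev_poly ?m B') $ i = 0"
    using rational_descent[OF AB(2)] AB(3) B by metis
  have "pair_ev U V (A', B') $ i = 0" if p: "param f0 x0 y0 U V" and i: "i < n" for U V i
  proof (rule *(5), rule nth_less_subdegree_zero)
    have "subdegree (pair_ev (to_ac.fps_map U) (to_ac.fps_map V) (A, B)) = n"
      using ord_emb[OF to_ac.param_map[OF p] AB(2)] h[OF on_curve_affine[OF P]] unfolding AB(1) by simp
    then show "i < subdegree (pair_ev (to_ac.fps_map U) (to_ac.fps_map V) (A, B))" using i by simp
  qed
  moreover have "pair_ev U V (rev_poly n A', rev_poly ?m B') $ i = 0"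
    if p: "param (inf_poly f0) 0 (- w) U V" and i: "i < n" for U V i
  proof (rule *(6), rule nth_less_subdegree_zero)
    have p': "param (inf_poly f) 0 (- ?w) (to_ac.fps_map U) (to_ac.fps_map V)"
      using to_ac.param_map[OF p] by (simp add: to_ac.map_inf_poly)
    have R: "Infty (- ?w) \<in> curve_points f" using param_on_curve[OF p'] by (rule on_curve_infty)
    have "- ?w \<noteq> 0" using w by simp
    then have "subdegree (to_ac.fps_map U) = 1" using param_simple[OF p'] by simp
    moreover have "ord_at f (Infty (- ?w)) (emb (A, B)) = 0"
      using h[OF R] w unfolding AB(1) by simp
    ultimately have "subdegree (pair_ev (to_ac.fps_map U) (to_ac.fps_map V) (rev_poly n A, rev_poly ?m B)) = n"
      using ord_infty_emb[OF p' AB(2,3)] AB(4) by (simp add: to_ac.genus_map)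
    then show "i < subdegree (pair_ev (to_ac.fps_map U) (to_ac.fps_map V) (rev_poly n A, rev_poly ?m B))"
      using i by simp
  qed
  moreover have "degree A' \<le> n" "B' = 0 \<or> degree B' + genus f0 + 1 \<le> n"
    using AB *(2-4) by auto
  ultimately show ?thesis using n(1) *(1) by blast
qed

end

section \<open>Power series over the local ring at p\<close>

locale odd_prime =
  fixes p :: nat
  assumes prime: "Factorial_Ring.prime p" and ge_3: "p \<ge> 3"
begin

lemma prime_int: "Factorial_Ring.prime (int p)"
  using prime by simp

lemma p_pos: "(of_nat p :: rat) > 0"
  using ge_3 by simp

text \<open>The p-adic valuation is at least k, with 0 divisible by everything:
  \<open>pdvd 0\<close> is the local ring of the rationals at p and \<open>pdvd 1\<close> its
  maximal ideal.\<close>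

definition pdvd :: "nat \<Rightarrow> rat \<Rightarrow> bool" where
  "pdvd k q \<longleftrightarrow> (\<exists>a b. \<not> int p dvd b \<and> q * of_int b = of_nat p ^ k * of_int a)"

lemma pdvdI: "\<not> int p dvd b \<Longrightarrow> q * of_int b = of_nat p ^ k * of_int a \<Longrightarrow> pdvd k q"
  unfolding pdvd_def by blast

lemma pdvd_0 [simp]: "pdvd k 0"
  by (rule pdvdI[of 1 _ _ 0]) (use prime_int in auto)

lemma pdvd_of_int: "pdvd 0 (of_int z)"
  by (rule pdvdI[of 1 _ _ z]) (use prime_int in auto)

lemma pdvd_of_nat: "pdvd 0 (of_nat n)"
  using pdvd_of_int[of "int n"] by simp

lemma pdvd_numeral [simp]: "pdvd 0 (numeral n)" and pdvd_1 [simp]: "pdvd 0 1"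
  using pdvd_of_nat[of "numeral n"] pdvd_of_nat[of 1] by simp_all

lemma pdvd_add: assumes "pdvd k q" "pdvd k r" shows "pdvd k (q + r)"
proof -
  obtain a b c d where *: "\<not> int p dvd b" "q * of_int b = of_nat p ^ k * of_int a"
    "\<not> int p dvd d" "r * of_int d = of_nat p ^ k * of_int c"
    using assms unfolding pdvd_def by blast
  have "(q + r) * of_int (b * d) = (q * of_int b) * of_int d + (r * of_int d) * of_int b"
    by (simp add: algebra_simps)
  also have "\<dots> = of_nat p ^ k * of_int (a * d + c * b)"
    unfolding *(2,4) by (simp add: algebra_simps)
  finally show ?thesis
    by (rule pdvdI[rotated]) (use * prime_int in \<open>simp add: prime_dvd_mult_iff\<close>)
qed

lemma pdvd_mult: assumes "pdvd k q" "pdvd l r" shows "pdvd (k + l) (q * r)"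
proof -
  obtain a b c d where *: "\<not> int p dvd b" "q * of_int b = of_nat p ^ k * of_int a"
    "\<not> int p dvd d" "r * of_int d = of_nat p ^ l * of_int c"
    using assms unfolding pdvd_def by blast
  have "(q * r) * of_int (b * d) = (q * of_int b) * (r * of_int d)"
    by (simp add: algebra_simps)
  also have "\<dots> = of_nat p ^ (k + l) * of_int (a * c)"
    unfolding *(2,4) by (simp add: algebra_simps power_add)
  finally show ?thesis
    by (rule pdvdI[rotated]) (use * prime_int in \<open>simp add: prime_dvd_mult_iff\<close>)
qed

lemma pdvd_mult_right: "pdvd k q \<Longrightarrow> pdvd 0 r \<Longrightarrow> pdvd k (q * r)"
  and pdvd_mult_left: "pdvd 0 q \<Longrightarrow> pdvd k r \<Longrightarrow> pdvd k (q * r)"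
  using pdvd_mult[of k q 0 r] pdvd_mult[of 0 q k r] by simp_all

lemma pdvd_minus: "pdvd k q \<Longrightarrow> pdvd k (- q)"
  using pdvd_mult_left[OF pdvd_of_int[of "-1"]] by simp

lemma pdvd_minus_iff: "pdvd k (- q) \<longleftrightarrow> pdvd k q"
  using pdvd_minus[of k q] pdvd_minus[of k "- q"] by auto

lemma pdvd_diff: "pdvd k q \<Longrightarrow> pdvd k r \<Longrightarrow> pdvd k (q - r)"
  using pdvd_add[of k q "- r"] pdvd_minus by simp

lemma pdvd_sum: "(\<And>i. i \<in> A \<Longrightarrow> pdvd k (h i)) \<Longrightarrow> pdvd k (sum h A)"
  by (induction A rule: infinite_finite_induct) (auto intro: pdvd_add)

lemma pdvd_power_p: "pdvd k (of_nat p ^ k)"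
  by (rule pdvdI[of 1 _ _ 1]) (use prime_int in auto)

lemma pdvd_mono: assumes "pdvd l q" "k \<le> l" shows "pdvd k q"
proof -
  obtain a b where *: "\<not> int p dvd b" "q * of_int b = of_nat p ^ l * of_int a"
    using assms(1) unfolding pdvd_def by blast
  have "(of_nat p :: rat) ^ l = of_nat p ^ k * of_int (int p ^ (l - k))"
    using assms(2) by (simp flip: power_add)
  then show ?thesis using * by (intro pdvdI[of b _ _ "int p ^ (l - k) * a"]) auto
qed

lemma pdvd_pint: "pdvd k q \<Longrightarrow> pdvd 0 q"
  using pdvd_mono by blast

lemma pdvd_power: "pdvd k q \<Longrightarrow> pdvd (k * n) (q ^ n)"
  by (induction n) (auto dest: pdvd_mult)

lemma pint_power: "pdvd 0 q \<Longrightarrow> pdvd 0 (q ^ n)"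
  using pdvd_power[of 0 q n] by simp

lemma pdvd_cancel_p: "pdvd (k + l) (of_nat p ^ k * q) \<longleftrightarrow> pdvd l q"
proof
  assume "pdvd (k + l) (of_nat p ^ k * q)"
  then obtain a b where *: "\<not> int p dvd b" "of_nat p ^ k * q * of_int b = of_nat p ^ (k + l) * of_int a"
    unfolding pdvd_def by blast
  then have "q * of_int b = of_nat p ^ l * of_int a"
    using p_pos by (simp add: power_add)
  then show "pdvd l q" using * pdvdI by blast
qed (rule pdvd_mult[OF pdvd_power_p])

lemma pdvd_1_of_int_iff: "pdvd 1 (of_int z) \<longleftrightarrow> int p dvd z"
proof
  assume "pdvd 1 (of_int z)"
  then obtain a b where *: "\<not> int p dvd b" "(of_int z :: rat) * of_int b = of_nat p ^ 1 * of_int a"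
    unfolding pdvd_def by blast
  then have "(of_int (z * b) :: rat) = of_int (int p * a)" by simp
  then have "z * b = int p * a" by (simp only: of_int_eq_iff)
  then have "int p dvd z * b" by simp
  then show "int p dvd z" using * prime_int by (simp add: prime_dvd_mult_iff)
next
  assume "int p dvd z"
  then obtain a where "z = int p * a" by blast
  then show "pdvd 1 (of_int z)" by (intro pdvdI[of 1 _ _ a]) (use prime_int in auto)
qed

definition punit :: "rat \<Rightarrow> bool" where
  "punit u \<longleftrightarrow> pdvd 0 u \<and> \<not> pdvd 1 u"

lemma punit_pint: "punit u \<Longrightarrow> pdvd 0 u"
  by (simp add: punit_def)

lemma punit_nonzero: "punit u \<Longrightarrow> u \<noteq> 0"
  by (auto simp: punit_def)

lemma punit_inverse: assumes "punit u" shows "pdvd 0 (inverse u)"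
proof -
  obtain a b where *: "\<not> int p dvd b" "u * of_int b = of_int a"
    using assms unfolding punit_def pdvd_def by auto
  have "\<not> int p dvd a"
  proof
    assume "int p dvd a"
    then obtain c where "a = int p * c" by blast
    then have "pdvd 1 u" using * by (intro pdvdI[of b _ _ c]) auto
    then show False using assms by (simp add: punit_def)
  qed
  moreover have "inverse u * of_int a = of_int b"
    using * punit_nonzero[OF assms] by (simp flip: *(2))
  ultimately show ?thesis by (intro pdvdI[of a _ _ b]) auto
qed

lemma pdvd_cancel_unit: assumes "punit u" shows "pdvd k (u * q) \<longleftrightarrow> pdvd k q"
proof
  assume "pdvd k (u * q)"
  then have "pdvd k (inverse u * (u * q))" by (rule pdvd_mult_left[OF punit_inverse[OF assms]])
  then show "pdvd k q" using punit_nonzero[OF assms] by (simp add: mult.assoc[symmetric])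
qed (use assms in \<open>auto simp: punit_def intro: pdvd_mult_left\<close>)

lemma punit_mult: "punit u \<Longrightarrow> punit v \<Longrightarrow> punit (u * v)"
  unfolding punit_def[of "u * v"] using pdvd_cancel_unit[of u _ v] by (simp add: punit_def)

lemma punit_power: "punit u \<Longrightarrow> punit (u ^ n)"
  by (induction n) (auto simp: punit_mult, use prime_int pdvd_1_of_int_iff[of 1] in \<open>auto simp: punit_def\<close>)

lemma punit_add: "punit u \<Longrightarrow> pdvd 1 q \<Longrightarrow> punit (u + q)"
  unfolding punit_def using pdvd_add pdvd_diff[of 1 "u + q" q] pdvd_pint by auto

lemma punit_of_int_iff: "punit (of_int z) \<longleftrightarrow> \<not> int p dvd z"
  unfolding punit_def using pdvd_of_int pdvd_1_of_int_iff by simp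

lemma punit_1: "punit 1" and punit_2: "punit 2"
  using punit_of_int_iff[of 1] punit_of_int_iff[of 2] ge_3 prime_int zdvd_imp_le[of "int p" 2] by auto

lemma punit_minus: "punit (- u) \<longleftrightarrow> punit u"
  by (simp add: punit_def pdvd_minus_iff)

lemma pdvd_decompose:
  assumes "pdvd 0 q" "q \<noteq> 0"
  obtains e u where "q = of_nat p ^ e * u" "punit u"
proof -
  obtain a b where *: "\<not> int p dvd b" "q * of_int b = of_int a"
    using assms(1) unfolding pdvd_def by auto
  have b: "punit (of_int b)" using * punit_of_int_iff by blast
  have a0: "a \<noteq> 0" using * b assms(2) punit_nonzero by fastforce
  obtain c where c: "a = int p ^ multiplicity (int p) a * c" "\<not> int p dvd c"
    using multiplicity_decompose'[of a "int p"] a0 not_prime_unit[of "int p"] prime_int by blast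
  let ?e = "multiplicity (int p) a"
  have "q = of_nat p ^ ?e * (of_int c * inverse (of_int b))"
    using *(2) punit_nonzero[OF b] arg_cong[OF c(1), of "of_int :: int \<Rightarrow> rat"]
    by (simp add: field_simps)
  moreover have "punit (of_int c * inverse (of_int b))"
  proof (intro punit_mult)
    show "punit (of_int c)" using c punit_of_int_iff by blast
    show "punit (inverse (of_int b))"
      using punit_inverse[OF b] pdvd_mult_right[of 1 "inverse (of_int b)" "of_int b"] punit_nonzero[OF b] b
        punit_1 by (auto simp: punit_def)
  qed
  ultimately show ?thesis using that by blast
qed

lemma pdvd_unbounded:
  assumes "pdvd 0 q" "q \<noteq> 0" shows "\<exists>e. \<forall>k. pdvd k q \<longrightarrow> k \<le> e"
proof -
  obtain e u where *: "q = of_nat p ^ e * u" "punit u" using pdvd_decompose assms by blast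
  have "\<not> pdvd (e + 1) q" unfolding *(1) pdvd_cancel_p using *(2) by (simp add: punit_def)
  then show ?thesis using pdvd_mono by (metis not_less_eq_eq Suc_eq_plus1)
qed

lemma pdvd_prime: "pdvd 1 (q * r) \<Longrightarrow> pdvd 0 q \<Longrightarrow> pdvd 0 r \<Longrightarrow> pdvd 1 q \<or> pdvd 1 r"
  using pdvd_cancel_unit by (auto simp: punit_def)

lemma pdvd_inverse_if_not_pint:
  assumes "\<not> pdvd 0 q" shows "pdvd 1 (inverse q)"
proof -
  obtain a b where ab: "quotient_of q = (a, b)" by (cases "quotient_of q")
  have q: "q = of_int a / of_int b" "b > 0" "coprime a b"
    using ab quotient_of_div quotient_of_denom_pos quotient_of_coprime by auto
  have "int p dvd b"
    using assms q by (metis nonzero_divide_eq_eq of_int_0_eq_iff order_less_irrefl pdvdI power_0 mult_1)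
  then obtain c where c: "b = int p * c" by blast
  then have "\<not> int p dvd a" using q(3) prime_int
    by (metis \<open>int p dvd b\<close> coprime_common_divisor not_prime_unit)
  moreover have "a \<noteq> 0" using calculation by auto
  ultimately show ?thesis
    using q c by (intro pdvdI[of a _ _ c]) auto
qed

section \<open>Power series with p-integral coefficients and their orders modulo p\<close>

definition fint :: "rat fps \<Rightarrow> bool" where
  "fint F \<longleftrightarrow> (\<forall>i. pdvd 0 (F $ i))"

text \<open>The reduction modulo p vanishes to order at least m, possibly identically.\<close>

definition pord :: "nat \<Rightarrow> rat fps \<Rightarrow> bool" where
  "pord m F \<longleftrightarrow> fint F \<and> (\<forall>i<m. pdvd 1 (F $ i))"

lemma pord_0: "pord 0 F \<longleftrightarrow> fint F"
  by (simp add: pord_def)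

lemma pord_fint: "pord m F \<Longrightarrow> fint F"
  by (simp add: pord_def)

lemma pord_mono: "pord m F \<Longrightarrow> n \<le> m \<Longrightarrow> pord n F"
  by (simp add: pord_def)

lemma pord_add: "pord m F \<Longrightarrow> pord m G \<Longrightarrow> pord m (F + G)"
  and pord_diff: "pord m F \<Longrightarrow> pord m G \<Longrightarrow> pord m (F - G)"
  by (auto simp: pord_def fint_def intro: pdvd_add pdvd_diff)

lemma fint_mult: "fint F \<Longrightarrow> fint G \<Longrightarrow> fint (F * G)"
  unfolding fint_def fps_mult_nth by (blast intro: pdvd_sum pdvd_mult_left)

lemma pord_mult: assumes "pord m F" "pord n G" shows "pord (m + n) (F * G)"
proof -
  have "pdvd 1 ((F * G) $ i)" if i: "i < m + n" for i
    unfolding fps_mult_nth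
  proof (rule pdvd_sum)
    fix j assume "j \<in> {0..i}"
    then have "j < m \<or> i - j < n" using i by auto
    then show "pdvd 1 (F $ j * G $ (i - j))"
      using assms by (auto simp: pord_def fint_def intro: pdvd_mult_left pdvd_mult_right)
  qed
  then show ?thesis using assms fint_mult by (simp add: pord_def)
qed

lemma pord_power: "pord m F \<Longrightarrow> pord (m * n) (F ^ n)"
proof (induction n)
  case 0
  then show ?case by (auto simp: pord_def fint_def)
qed (auto dest: pord_mult simp: algebra_simps)

lemma fint_const: "pdvd 0 c \<Longrightarrow> fint (fps_const c)" and fint_X: "fint fps_X" and fint_1: "fint 1"
  by (auto simp: fint_def fps_X_def)

lemma pord_X: "pord 1 fps_X"
  by (auto simp: pord_def fint_X)

lemma pord_const: "pdvd 1 c \<Longrightarrow> pord 1 (fps_const c)"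
  by (auto simp: pord_def fint_const pdvd_pint)

lemma fint_add: "fint F \<Longrightarrow> fint G \<Longrightarrow> fint (F + G)" and fint_diff: "fint F \<Longrightarrow> fint G \<Longrightarrow> fint (F - G)"
  using pord_add[of 0] pord_diff[of 0] by (simp_all add: pord_0)

lemma fint_power: "fint F \<Longrightarrow> fint (F ^ n)"
  using pord_power[of 0 F n] by (simp add: pord_0)

text \<open>Modulo p, U is X^d times a unit. Coefficient i + d of U G is U_d G_i up to earlier
  coefficients of G and multiples of p, so the G_i are treated in turn.\<close>

lemma pord_cancel:
  assumes "pord m (U * G)" "fint G" "pord d U" "punit (U $ d)"
  shows "pord (m - d) G"
proof -
  have "pdvd 1 (G $ i)" if "i < m - d" for i
    using that
  proof (induction i rule: less_induct)
    case (less i)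
    have "(U * G) $ (i + d) = (\<Sum>j\<in>{0..i + d} - {d}. U $ j * G $ (i + d - j)) + U $ d * G $ i"
      unfolding fps_mult_nth by (subst sum.remove[of _ d]) auto
    moreover have "pdvd 1 (\<Sum>j\<in>{0..i + d} - {d}. U $ j * G $ (i + d - j))"
    proof (rule pdvd_sum)
      fix j assume j: "j \<in> {0..i + d} - {d}"
      show "pdvd 1 (U $ j * G $ (i + d - j))"
      proof (cases "j < d")
        case True
        then show ?thesis using assms(2,3) by (auto simp: pord_def fint_def intro: pdvd_mult_right)
      next
        case False
        then have "i + d - j < i" using j by auto
        then have "pdvd 1 (G $ (i + d - j))" using less by simp
        then show ?thesis using assms(3) by (auto simp: pord_def fint_def intro: pdvd_mult_left)
      qed
    qed
    moreover have "pdvd 1 ((U * G) $ (i + d))"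
      using assms(1) less.prems by (simp add: pord_def)
    ultimately have "pdvd 1 (((U * G) $ (i + d)) - (\<Sum>j\<in>{0..i + d} - {d}. U $ j * G $ (i + d - j)))"
      by (intro pdvd_diff)
    then have "pdvd 1 (U $ d * G $ i)"
      using \<open>(U * G) $ (i + d) = _\<close> by simp
    then show ?case using pdvd_cancel_unit[OF assms(4)] by blast
  qed
  then show ?thesis using assms(2) by (simp add: pord_def)
qed

definition pint_poly :: "rat poly \<Rightarrow> bool" where
  "pint_poly A \<longleftrightarrow> (\<forall>i. pdvd 0 (coeff A i))"

lemma pint_poly_pCons: "pint_poly (pCons a A) \<longleftrightarrow> pdvd 0 a \<and> pint_poly A"
  by (auto simp: pint_poly_def coeff_pCons split: nat.splits)

lemma fint_pev: "pint_poly A \<Longrightarrow> fint U \<Longrightarrow> fint (pev A U)"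
  by (induction A) (auto simp: pint_poly_pCons fint_const intro: fint_add fint_mult, simp add: fint_def)

text \<open>U reduces to a uniformizer, so the index of the first coefficient of A that is not
  divisible by p would be the order of A(U) modulo p.\<close>

lemma coeff_pdvd_if_pord:
  assumes "pord 1 U" "punit (U $ 1)" "pint_poly A" "pord m (pev A U)" "j < m"
  shows "pdvd 1 (coeff A j)"
  using assms(3-5)
proof (induction A arbitrary: m j)
  case (pCons a A)
  have A: "pdvd 0 a" "pint_poly A" using pCons.prems by (simp_all add: pint_poly_pCons)
  have U: "pdvd 1 (U $ 0)" "fint U" using assms(1) by (simp_all add: pord_def)
  have fA: "fint (pev A U)" using fint_pev[OF A(2) U(2)] .
  have "0 < m" using pCons.prems(3) by simp
  then have "pdvd 1 (pev (pCons a A) U $ 0)" using pCons.prems(2) unfolding pord_def by blast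
  moreover have "pdvd 1 (U $ 0 * pev A U $ 0)"
    using U fA by (auto simp: fint_def intro: pdvd_mult_right)
  ultimately have a: "pdvd 1 a"
    using pdvd_diff[of 1 "a + U $ 0 * pev A U $ 0" "U $ 0 * pev A U $ 0"] by simp
  have "pord m (U * pev A U)"
  proof -
    have "pord m (pev (pCons a A) U - fps_const a)"
      using pCons.prems(2) a A(1) by (intro pord_diff) (auto simp: pord_def fint_const)
    then show ?thesis by simp
  qed
  then have "pord (m - 1) (pev A U)"
    using pord_cancel fA assms(1,2) by blast
  then show ?case
    using a pCons.IH[OF A(2)] pCons.prems(3) by (cases j) auto
qed simp

lemma first_coeffs_pdvd_weierstrass:
  assumes "pord 2 U" "pord 1 V" "punit (V $ 1)" "pint_poly A" "pint_poly B"
    "pord m (pair_ev U V (A, B))"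
  shows "(0 < m \<longrightarrow> pdvd 1 (coeff A 0)) \<and> (1 < m \<longrightarrow> pdvd 1 (coeff B 0))"
proof (intro conjI impI)
  have U: "pdvd 1 (U $ 0)" "pdvd 1 (U $ 1)" "pdvd 1 (V $ 0)" "fint U" "fint V"
    using assms(1,2) by (simp_all add: pord_def)
  obtain a A' where A: "A = pCons a A'" by (cases A)
  obtain b B' where B: "B = pCons b B'" by (cases B)
  have i: "pdvd 0 a" "pdvd 0 b" "pint_poly A'" "pint_poly B'"
    using assms(4,5) by (simp_all add: A B pint_poly_pCons)
  let ?R = "U * pev A' U + U * pev B' U * V"
  have fi: "fint (pev A' U)" "fint (pev B' U)"
    using fint_pev i U by auto
  have R: "pord 2 ?R"
    using pord_mult[OF assms(1), of 0] fi U(5) pord_0 fint_mult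
    by (auto intro!: pord_add simp: mult.assoc)
  have e: "pair_ev U V (A, B) = fps_const a + fps_const b * V + ?R"
    by (simp add: pair_ev_def A B algebra_simps)
  show "pdvd 1 (coeff A 0)" if "0 < m"
  proof -
    have "pdvd 1 (pair_ev U V (A, B) $ 0)" using assms(6) that by (simp add: pord_def)
    moreover have "pdvd 1 (b * V $ 0 + ?R $ 0)"
    proof (intro pdvd_add pdvd_mult_left)
      have "(0 :: nat) < 2" by simp
      then show "pdvd 1 (?R $ 0)" using R unfolding pord_def by blast
    qed (use U(3) i(2) in auto)
    moreover have "a = pair_ev U V (A, B) $ 0 - (b * V $ 0 + ?R $ 0)" unfolding e by simp
    ultimately have "pdvd 1 a" by (metis pdvd_diff)
    then show ?thesis by (simp add: A)
  qed
  show "pdvd 1 (coeff B 0)" if "1 < m"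
  proof -
    have "pdvd 1 (pair_ev U V (A, B) $ 1)" using assms(6) that by (simp add: pord_def)
    moreover have "(1 :: nat) < 2" by simp
    then have "pdvd 1 (?R $ 1)" using R unfolding pord_def by blast
    moreover have "V $ 1 * b = pair_ev U V (A, B) $ 1 - ?R $ 1" unfolding e by simp
    ultimately have "pdvd 1 (V $ 1 * b)" by (metis pdvd_diff)
    then show ?thesis using pdvd_cancel_unit[OF assms(3)] by (simp add: B)
  qed
qed

text \<open>Modulo p the monomials U^j have order 2 j and U^j V order 2 j + 1. These orders are all
  different, so nothing cancels. The induction removes the constant coefficients and divides by
  U.\<close>

lemma coeff_pdvd_if_pord_weierstrass:
  assumes "pord 2 U" "punit (U $ 2)" "pord 1 V" "punit (V $ 1)" "pint_poly A" "pint_poly B"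
    "pord m (pair_ev U V (A, B))"
  shows "(2 * j < m \<longrightarrow> pdvd 1 (coeff A j)) \<and> (2 * j + 1 < m \<longrightarrow> pdvd 1 (coeff B j))"
  using assms(5-7)
proof (induction j arbitrary: A B m)
  case (0 A B m)
  then show ?case using first_coeffs_pdvd_weierstrass[OF assms(1,3,4)] by simp
next
  case (Suc j A B m)
  have U: "fint U" "fint V" using assms(1,3) by (simp_all add: pord_def)
  obtain a A' where A: "A = pCons a A'" by (cases A)
  obtain b B' where B: "B = pCons b B'" by (cases B)
  have i: "pdvd 0 a" "pdvd 0 b" "pint_poly A'" "pint_poly B'"
    using Suc.prems by (simp_all add: A B pint_poly_pCons)
  show ?case
  proof (cases "m \<ge> 3")
    case True
    then have ab: "pdvd 1 a" "pdvd 1 b"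
      using first_coeffs_pdvd_weierstrass[OF assms(1,3,4) Suc.prems] by (simp_all add: A B)
    have "pord (m - 2) (pair_ev U V (A', B'))"
    proof (rule pord_cancel[OF _ _ assms(1,2)])
      have "U * pair_ev U V (A', B') = pair_ev U V (A, B) - (fps_const a + fps_const b * V)"
        by (simp add: pair_ev_def A B algebra_simps)
      moreover have "pord m (fps_const a + fps_const b * V)"
        using ab i U unfolding pord_def
        by (auto simp: fint_def intro!: pdvd_add intro: pdvd_mult_right pdvd_mult_left)
      ultimately show "pord m (U * pair_ev U V (A', B'))"
        using pord_diff[OF Suc.prems(3)] by simp
      show "fint (pair_ev U V (A', B'))"
        using i U by (auto simp: pair_ev_def intro!: fint_add fint_mult fint_pev)
    qed
    then show ?thesis using Suc.IH[OF i(3,4)] by (auto simp: A B)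
  qed auto
qed

text \<open>If p^j divides i > 0 and j > 0, this yields j + 2 \<le> i for every odd p. With base 2
  it would fail at j = 1.\<close>

lemma pow3_ge: "Suc (Suc j) \<le> 3 ^ j \<or> j = 0"
proof (induction j)
  case (Suc j)
  then show ?case by (cases "j = 0") auto
qed simp

text \<open>If p^j exactly divides i, the valuation of q is at least r + e i - j, and e (i - 1)
  \<ge> i - 1 \<ge> j + 1 lifts this above r + e. In the application i is the order of a pole term
  and q its coefficient.\<close>

lemma pdvd_binomial_coefficient:
  assumes "of_nat i * q = of_nat m * z * b ^ i" "i \<ge> 2" "pdvd 0 z" "pdvd r (of_nat m)" "pdvd e b" "e \<ge> 1"
  shows "pdvd (r + e + 1) q"
proof -
  have i0: "(of_nat i :: rat) \<noteq> 0" using assms(2) by simp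
  obtain j u where j: "(of_nat i :: rat) = of_nat p ^ j * u" "punit u"
    using pdvd_decompose[OF pdvd_of_nat i0] by blast
  have "j + 1 \<le> i - 1"
  proof (cases "j = 0")
    case False
    have "int p ^ j dvd int i"
    proof -
      obtain a b where *: "\<not> int p dvd b" "u * of_int b = of_int a"
        using j(2) unfolding punit_def pdvd_def by auto
      have "(of_int (int i * b) :: rat) = of_int (int p ^ j * a)"
        using j(1) *(2) by (simp add: mult.assoc)
      then have "int i * b = int p ^ j * a" by (simp only: of_int_eq_iff)
      then have "int p ^ j dvd int i * b" by simp
      moreover have "coprime (int p ^ j) b"
        using * prime_int by (simp add: prime_imp_coprime)
      ultimately show ?thesis using coprime_dvd_mult_left_iff by blast
    qed
    then have "p ^ j \<le> i"
      using assms(2) by (intro dvd_imp_le) (simp_all flip: of_nat_power)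
    moreover have "3 ^ j \<le> p ^ j" using ge_3 by (rule power_mono) simp
    ultimately show ?thesis using pow3_ge[of j] False by linarith
  qed (use assms(2) in simp)
  also have "i - 1 \<le> e * (i - 1)" using assms(6) by simp
  finally have "e + (j + 1) \<le> e + e * (i - 1)" by simp
  also have "e + e * (i - 1) = e * i" using assms(2) by (cases i) simp_all
  finally have le: "j + (r + e + 1) \<le> r + e * i" by simp
  have "pdvd (r + 0 + e * i) (of_nat m * z * b ^ i)"
    using assms by (intro pdvd_mult pdvd_power)
  then have "pdvd (j + (r + e + 1)) (u * (of_nat p ^ j * q))"
    using pdvd_mono[OF _ le] unfolding assms(1)[symmetric] j(1) by (simp add: mult_ac)
  then show ?thesis using pdvd_cancel_unit[OF j(2)] pdvd_cancel_p by blast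
qed

text \<open>
  Here \<open>Q\<close> plays the role of \<open>(s + b)^m\<close> and the like, up to a power of \<open>s\<close>: the coefficient of
  \<open>s^(M-1)\<close> has a smaller valuation than all the coefficients of lower powers of \<open>s\<close>, so that \<open>Q/s^M\<close> is,
  modulo a suitable power of \<open>p\<close>, a Laurent series with at most a simple pole.
\<close>

lemma simple_pole_reduction:
  assumes Q: "\<And>i. 2 \<le> i \<Longrightarrow> i \<le> M \<Longrightarrow> \<exists>z. pdvd 0 z \<and> of_nat i * Q $ (M - i) = of_nat m * z * b ^ i"
    and Q1: "Q $ (M - 1) = of_nat m * \<rho> * b" and "punit \<rho>" "m > 0" "b \<noteq> 0" "pdvd 1 b" "M > 0"
    and W: "fint W" "punit (W $ 0)"
  shows "\<exists>s. \<forall>k G U. fint G \<longrightarrow> fps_const (of_nat p ^ k) * G = fps_X ^ M * U - Q * W \<longrightarrow>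
    k \<le> s \<and> pord (M - 1) G"
proof -
  obtain r \<mu> where r: "(of_nat m :: rat) = of_nat p ^ r * \<mu>" "punit \<mu>"
    using pdvd_decompose[OF pdvd_of_nat, of m] assms(4) by auto
  obtain e \<beta> where e: "b = of_nat p ^ e * \<beta>" "punit \<beta>"
    using pdvd_decompose[OF pdvd_pint[OF assms(6)] assms(5)] by blast
  have e1: "e \<ge> 1"
    using assms(6) e by (cases e) (auto simp: punit_def)
  have em: "pdvd r (of_nat m)" "pdvd e b"
    using r e pdvd_mult_right[OF pdvd_power_p] by (auto simp: punit_def)
  \<comment> \<open>The valuation of coefficient M - 1 of Q, which is m b up to a unit.\<close>
  define s where "s = r + e"
  have low: "pdvd (s + 1) (Q $ i)" if "i < M - 1" for i
  proof -
    have "M - (M - i) = i" "2 \<le> M - i" "M - i \<le> M" using that by auto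
    then obtain z where "pdvd 0 z" "of_nat (M - i) * Q $ i = of_nat m * z * b ^ (M - i)"
      using Q[of "M - i"] by auto
    then show ?thesis
      using pdvd_binomial_coefficient[of "M - i" "Q $ i" m z b r e] \<open>2 \<le> M - i\<close> em e1 by (simp add: s_def)
  qed
  have QW: "pdvd (s + 1) ((Q * W) $ i)" if "i < M - 1" for i
    unfolding fps_mult_nth using that W(1) low
    by (intro pdvd_sum pdvd_mult_right) (auto simp: fint_def)
  \<comment> \<open>Modulo p^(s+1) only the product of coefficient M - 1 of Q with W_0 contributes,
    and it has valuation exactly s.\<close>
  have top: "\<not> pdvd (s + 1) ((Q * W) $ (M - 1))"
  proof
    assume a: "pdvd (s + 1) ((Q * W) $ (M - 1))"
    have "{0..M - 1} = insert (M - 1) {0..<M - 1}" by auto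
    then have "(Q * W) $ (M - 1) = (\<Sum>j\<in>{0..<M - 1}. Q $ j * W $ (M - 1 - j)) + Q $ (M - 1) * W $ 0"
      unfolding fps_mult_nth by simp
    moreover have "pdvd (s + 1) (\<Sum>j\<in>{0..<M - 1}. Q $ j * W $ (M - 1 - j))"
      using W(1) low by (intro pdvd_sum pdvd_mult_right) (auto simp: fint_def)
    ultimately have "pdvd (s + 1) (Q $ (M - 1) * W $ 0)"
      using pdvd_diff[OF a] by fastforce
    moreover have "Q $ (M - 1) * W $ 0 = of_nat p ^ s * (\<mu> * \<rho> * \<beta> * W $ 0)"
      unfolding Q1 r(1) s_def by (subst e(1)) (simp add: power_add mult_ac)
    ultimately have "pdvd 1 (\<mu> * \<rho> * \<beta> * W $ 0)"
      using pdvd_cancel_p by metis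
    moreover have "punit (\<mu> * \<rho> * \<beta> * W $ 0)"
      using assms(3) r e W by (intro punit_mult)
    ultimately show False by (simp add: punit_def)
  qed
  show ?thesis
  proof (intro exI[of _ s] allI impI)
    fix k G U assume G: "fint G" "fps_const (of_nat p ^ k) * G = fps_X ^ M * U - Q * W"
    \<comment> \<open>Below degree M the series X^M U does not contribute. Coefficient M - 1 then
      bounds k by s, and the earlier coefficients of G are divisible by p.\<close>
    have c: "of_nat p ^ k * G $ i = - (Q * W) $ i" if "i < M" for i
    proof -
      have "(fps_const (of_nat p ^ k) * G) $ i = (fps_X ^ M * U - Q * W) $ i" using G(2) by (rule arg_cong)
      then show ?thesis using that by (simp add: fps_X_power_mult_nth)
    qed
    have k: "k \<le> s"
    proof (rule ccontr)
      assume "\<not> k \<le> s"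
      then have "pdvd (s + 1) (of_nat p ^ k * G $ (M - 1))"
        using G(1) pdvd_mono[OF pdvd_mult_right[OF pdvd_power_p]] by (simp add: fint_def)
      then show False using top c[of "M - 1"] assms(7) pdvd_minus_iff by simp
    qed
    moreover have "pdvd 1 (G $ i)" if "i < M - 1" for i
    proof -
      have "pdvd (s + 1) (of_nat p ^ k * G $ i)"
        using c[of i] QW[OF that] that pdvd_minus_iff by simp
      then have "pdvd (k + 1) (of_nat p ^ k * G $ i)" using k pdvd_mono by simp
      then show ?thesis using pdvd_cancel_p by blast
    qed
    ultimately show "k \<le> s \<and> pord (M - 1) G" using G(1) by (simp add: pord_def)
  qed
qed

lemma pint_poly_smult: "pdvd 0 c \<Longrightarrow> pint_poly A \<Longrightarrow> pint_poly (smult c A)"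
  by (auto simp: pint_poly_def intro: pdvd_mult_left)

lemma pint_poly_diff: "pint_poly A \<Longrightarrow> pint_poly B \<Longrightarrow> pint_poly (A - B)"
  by (auto simp: pint_poly_def intro: pdvd_diff)

lemma pint_poly_add: "pint_poly A \<Longrightarrow> pint_poly B \<Longrightarrow> pint_poly (A + B)"
  by (auto simp: pint_poly_def intro: pdvd_add)

lemma pint_poly_mult: "pint_poly A \<Longrightarrow> pint_poly B \<Longrightarrow> pint_poly (A * B)"
  unfolding pint_poly_def coeff_mult by (blast intro: pdvd_sum pdvd_mult_left)

lemma clear_denominators: "\<exists>d::int. d \<noteq> 0 \<and> pint_poly (smult (of_int d) A)"
proof (induction A)
  case 0
  then show ?case by (intro exI[of _ 1]) (simp add: pint_poly_def)
next
  case (pCons a A)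
  then obtain d where d: "d \<noteq> 0" "pint_poly (smult (of_int d) A)" by blast
  obtain n e where ne: "quotient_of a = (n, e)" by (cases "quotient_of a")
  have a: "a = of_int n / of_int e" "e > 0"
    using ne quotient_of_div quotient_of_denom_pos by auto
  have "smult (of_int (d * e)) (pCons a A) = pCons (of_int (d * n)) (smult (of_int e) (smult (of_int d) A))"
    using a by (simp add: mult.commute)
  moreover have "pint_poly (pCons (of_int (d * n)) (smult (of_int e) (smult (of_int d) A)))"
    using d by (simp only: pint_poly_pCons) (simp add: pdvd_of_int pint_poly_smult del: of_int_mult smult_smult)
  ultimately show ?case using d a by (intro exI[of _ "d * e"]) simp
qed

text \<open>A pair with a nonzero reduction modulo p.\<close>

definition primitive :: "rat poly \<Rightarrow> rat poly \<Rightarrow> bool" where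
  "primitive A B \<longleftrightarrow> pint_poly A \<and> pint_poly B \<and> \<not> ((\<forall>i. pdvd 1 (coeff A i)) \<and> (\<forall>i. pdvd 1 (coeff B i)))"

lemma primitive_part:
  assumes "pint_poly A" "pint_poly B" "(A, B) \<noteq> (0, 0)"
  obtains k A' B' where "A = smult (of_nat p ^ k) A'" "B = smult (of_nat p ^ k) B'" "primitive A' B'"
proof -
  define P where "P k \<longleftrightarrow> (\<forall>i. pdvd k (coeff A i)) \<and> (\<forall>i. pdvd k (coeff B i))" for k
  obtain q where q: "q \<noteq> 0" "pdvd 0 q" "\<And>k. P k \<Longrightarrow> pdvd k q"
    using assms unfolding P_def pint_poly_def by (metis leading_coeff_neq_0)
  obtain e where e: "\<And>k. P k \<Longrightarrow> k \<le> e" using pdvd_unbounded[OF q(2,1)] q(3) by blast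
  have "P 0" using assms by (simp add: P_def pint_poly_def)
  \<comment> \<open>The largest common power of p exists because some coefficient is nonzero and so
    has a finite valuation.\<close>
  define k where "k = Greatest P"
  have k: "P k" unfolding k_def using \<open>P 0\<close> e by (rule GreatestI_nat)
  have notk: "\<not> P (k + 1)" using Greatest_le_nat[of P "k + 1" e] e unfolding k_def[symmetric] by auto
  let ?c = "inverse (of_nat p ^ k) :: rat"
  have pk: "(of_nat p ^ k :: rat) \<noteq> 0" using p_pos by simp
  have "A = smult (of_nat p ^ k) (smult ?c A)" "B = smult (of_nat p ^ k) (smult ?c B)"
    using pk by simp_all
  moreover have c: "pdvd (k + l) q \<longleftrightarrow> pdvd l (?c * q)" for l q
    using pdvd_cancel_p[of k l "?c * q"] pk by (simp add: mult.assoc[symmetric])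
  have "primitive (smult ?c A) (smult ?c B)"
    using k notk c[of 0] unfolding primitive_def P_def pint_poly_def coeff_smult
    by (simp flip: c)
  ultimately show ?thesis using that by blast
qed

lemma primitive_multiple:
  assumes "(A, B) \<noteq> (0, 0)"
  obtains c where "c \<noteq> 0" "primitive (smult c A) (smult c B)"
proof -
  obtain d where d: "d \<noteq> 0" "pint_poly (smult (of_int d) A)" using clear_denominators by blast
  obtain e where e: "e \<noteq> 0" "pint_poly (smult (of_int e) B)" using clear_denominators by blast
  let ?de = "of_int (d * e) :: rat"
  have "pint_poly (smult ?de A)" "pint_poly (smult ?de B)"
    using pint_poly_smult[OF pdvd_of_int[of e] d(2)] pint_poly_smult[OF pdvd_of_int[of d] e(2)]
    by (simp_all add: mult.commute)
  moreover have "(smult ?de A, smult ?de B) \<noteq> (0, 0)" using assms d e by auto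
  ultimately obtain k A' B' where *: "smult ?de A = smult (of_nat p ^ k) A'" "smult ?de B = smult (of_nat p ^ k) B'" "primitive A' B'"
    using primitive_part by metis
  have pk: "(of_nat p ^ k :: rat) \<noteq> 0" using p_pos by simp
  let ?c = "inverse (of_nat p ^ k) * ?de"
  have "smult (inverse (of_nat p ^ k)) (smult ?de A) = A'" "smult (inverse (of_nat p ^ k)) (smult ?de B) = B'"
    unfolding * using pk by simp_all
  then have "primitive (smult ?c A) (smult ?c B)" using *(3) by simp
  moreover have "?c \<noteq> 0" using pk d e by simp
  ultimately show ?thesis using that by blast
qed

lemma pair_ev_smult: "pair_ev U V (smult c A, smult c B) = fps_const c * pair_ev U V (A, B)"
  by (simp add: pair_ev_def fps_ev.ev_smult algebra_simps)

lemma pair_ev_diff: "pair_ev U V (A - A', B - B') = pair_ev U V (A, B) - pair_ev U V (A', B')"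
  by (simp add: pair_ev_def fps_ev.ev_diff algebra_simps)

lemma fint_pair_ev: "fint U \<Longrightarrow> fint V \<Longrightarrow> pint_poly A \<Longrightarrow> pint_poly B \<Longrightarrow> fint (pair_ev U V (A, B))"
  unfolding pair_ev_def by (auto intro!: fint_add fint_mult fint_pev)

lemma vanishing_factor:
  fixes F :: "rat fps"
  assumes "\<And>i. i < M \<Longrightarrow> F $ i = 0" shows "\<exists>G. F = fps_X ^ M * G"
  using assms by (intro exI[of _ "fps_shift M F"]) (simp add: fps_eq_iff fps_X_power_mult_nth)

text \<open>
  The function \<open>E\<close> spans, modulo \<open>p\<close>, the functions of the linear system \<open>L\<close> vanishing to order at least
  \<open>M - 1\<close>; so a function of \<open>L\<close> vanishing to order \<open>M\<close>, suitably scaled, is \<open>E + p^k G\<close>, and \<open>G\<close> modulo \<open>p\<close>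
  is again a multiple of \<open>E\<close>, which the normalisation excludes.
\<close>

theorem residue_disc_contradiction:
  assumes L: "\<And>A B c. L A B \<Longrightarrow> L (smult c A) (smult c B)"
    "\<And>A B A' B'. L A B \<Longrightarrow> L A' B' \<Longrightarrow> L (A - A') (B - B')"
    and E: "L E1 E2" "pint_poly E1" "pint_poly E2" "coeff E1 N = 1" "pair_ev U V (E1, E2) = Q * W"
    and red: "\<exists>s. \<forall>k G U. fint G \<longrightarrow> fps_const (of_nat p ^ k) * G = fps_X ^ M * U - Q * W \<longrightarrow>
      k \<le> s \<and> pord (M - 1) G"
    and UV: "fint U" "fint V"
    and span: "\<And>A B. L A B \<Longrightarrow> pint_poly A \<Longrightarrow> pint_poly B \<Longrightarrow> pord (M - 1) (pair_ev U V (A, B)) \<Longrightarrow>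
      \<exists>c. pdvd 0 c \<and> (\<forall>i. pdvd 1 (coeff A i - c * coeff E1 i)) \<and> (\<forall>i. pdvd 1 (coeff B i - c * coeff E2 i))"
    and AB: "L A B" "(A, B) \<noteq> (0, 0)" "\<And>i. i < M \<Longrightarrow> pair_ev U V (A, B) $ i = 0"
  shows False
proof -
  \<comment> \<open>On the members of L that vanish to order M - 1 modulo p, the reduction is
    determined by the coefficient N, since E has coefficient 1 there and spans them.\<close>
  have span0: "\<not> primitive C D" if CD: "L C D" "pord (M - 1) (pair_ev U V (C, D))" "pdvd 1 (coeff C N)" for C D
  proof
    assume prim: "primitive C D"
    then obtain c where c: "pdvd 0 c" "\<And>i. pdvd 1 (coeff C i - c * coeff E1 i)" "\<And>i. pdvd 1 (coeff D i - c * coeff E2 i)"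
      using span[OF CD(1) _ _ CD(2)] prim unfolding primitive_def by blast
    have "pdvd 1 (coeff C N - (coeff C N - c * coeff E1 N))"
      by (rule pdvd_diff[OF CD(3) c(2)])
    then have c1: "pdvd 1 c" by (simp add: E(4))
    have c2: "pdvd 1 (c * coeff E1 i)" "pdvd 1 (c * coeff E2 i)" for i
      using c1 E(2,3) by (auto simp: pint_poly_def intro: pdvd_mult_right)
    have "pdvd 1 (coeff C i)" "pdvd 1 (coeff D i)" for i
      using pdvd_add[OF c(2)[of i] c2(1)[of i]] pdvd_add[OF c(3)[of i] c2(2)[of i]] by simp_all
    then show False using prim by (simp add: primitive_def)
  qed
  obtain s where s: "\<And>k G U. fint G \<Longrightarrow> fps_const (of_nat p ^ k) * G = fps_X ^ M * U - Q * W \<Longrightarrow> k \<le> s \<and> pord (M - 1) G"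
    using red by blast
  obtain c where c: "c \<noteq> 0" "primitive (smult c A) (smult c B)" using primitive_multiple AB(2) by blast
  let ?A = "smult c A" and ?B = "smult c B"
  have LA: "L ?A ?B" using L(1) AB(1) by blast
  have van: "pair_ev U V (?A, ?B) $ i = 0" if "i < M" for i
    using AB(3)[OF that] by (simp add: pair_ev_smult)
  have po: "pord (M - 1) (pair_ev U V (?A, ?B))"
    using van c(2) UV by (auto simp: pord_def primitive_def intro: fint_pair_ev)
  \<comment> \<open>By \<open>span0\<close> a primitive multiple has a unit as coefficient N, so it
    can be scaled to agree with E there.\<close>
  have u: "punit (coeff ?A N)"
    using span0[OF LA po] c(2) unfolding punit_def primitive_def pint_poly_def by blast
  define l where "l = inverse (coeff ?A N)"
  have l: "pdvd 0 l" "l * coeff ?A N = 1"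
    using punit_inverse[OF u] punit_nonzero[OF u] by (simp_all add: l_def del: coeff_smult)
  define F1 where "F1 = smult l ?A"
  define F2 where "F2 = smult l ?B"
  have F: "L F1 F2" "pint_poly F1" "pint_poly F2" "coeff F1 N = 1"
    using L(1) LA c(2) l by (auto simp: F1_def F2_def primitive_def intro: pint_poly_smult simp del: smult_smult)
  have "pair_ev U V (F1, F2) $ i = 0" if "i < M" for i
    using van[OF that] unfolding F1_def F2_def pair_ev_smult[of U V l] by simp
  then obtain Z where Z: "pair_ev U V (F1, F2) = fps_X ^ M * Z" using vanishing_factor by metis
  have D: "pair_ev U V (F1 - E1, F2 - E2) = fps_X ^ M * Z - Q * W"
    by (simp add: pair_ev_diff Z E(5))
  show False
  proof (cases "(F1 - E1, F2 - E2) = (0, 0)")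
    \<comment> \<open>Here Q W would be X^M Z; taking G = 0 and k = s + 1 contradicts the bound on
      k.\<close>
    case True
    then have "fps_X ^ M * Z - Q * W = fps_const (of_nat p ^ (s + 1)) * 0"
      using D unfolding True by (simp add: pair_ev_def)
    then have "s + 1 \<le> s" using s[of 0 "s + 1" Z] by (simp add: fint_def)
    then show False by simp
  next
    case False
    then obtain k G1 G2 where G: "F1 - E1 = smult (of_nat p ^ k) G1" "F2 - E2 = smult (of_nat p ^ k) G2" "primitive G1 G2"
      using primitive_part[of "F1 - E1" "F2 - E2"] F E pint_poly_diff by metis
    have pk: "(of_nat p ^ k :: rat) \<noteq> 0" using p_pos by simp
    have "G1 = smult (inverse (of_nat p ^ k)) (F1 - E1)" "G2 = smult (inverse (of_nat p ^ k)) (F2 - E2)"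
      unfolding G using pk by simp_all
    then have LG: "L G1 G2" using L F(1) E(1) by metis
    have "fint (pair_ev U V (G1, G2))" using G(3) UV by (auto simp: primitive_def intro: fint_pair_ev)
    moreover have "fps_const (of_nat p ^ k) * pair_ev U V (G1, G2) = fps_X ^ M * Z - Q * W"
      using D unfolding G(1,2) pair_ev_smult .
    ultimately have "pord (M - 1) (pair_ev U V (G1, G2))" using s by blast
    \<comment> \<open>F and E share the coefficient N, so their difference has none;
      \<open>span0\<close> then contradicts the primitivity of G.\<close>
    moreover have "coeff G1 N = 0"
      using arg_cong[OF G(1), of "\<lambda>q. coeff q N"] F(4) E(4) ge_3 by simp
    ultimately show False using span0[OF LG] G(3) by simp
  qed
qed

end

section \<open>Points in one residue disc\<close>

lemma coeff_pcompose_scale: "coeff (pcompose R [:0, b:]) i = b ^ i * coeff R i"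
  for b :: "'a::comm_ring_1"
proof (induction R arbitrary: i)
  case (pCons a R)
  then show ?case by (cases i) (simp_all add: pcompose_pCons mult_ac)
qed simp

lemma pcompose_power_poly: "pcompose (R ^ n) q = pcompose R q ^ n"
  by (induction n) (simp_all add: pcompose_mult pcompose_1)

lemma pev_eq_if_eq_upto:
  assumes "\<And>j. j \<le> l \<Longrightarrow> U $ j = U' $ j"
  shows "pev A U $ l = pev A U' $ l"
  using assms
proof (induction A arbitrary: l)
  case (pCons a A)
  have "(U * pev A U) $ l = (U' * pev A U') $ l"
    unfolding fps_mult_nth using pCons.prems pCons.IH by (intro sum.cong) auto
  then show ?case by simp
qed simp

context odd_prime
begin

text \<open>The hypothesis on the reversal says that q is homogeneous in X and b, so that q^m =
  X^(\<delta> m) R(b/X)^m. It is applied to q = X + b, which gives the binomial series, and to q =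
  (X + b)^5 - b^5, the product over the five zeros of y - y(P).\<close>

lemma homogeneous_coefficients:
  fixes q R :: "rat poly" and l :: nat
  assumes q: "degree q = \<delta>" "lead_coeff q = 1" "reflect_poly q = pcompose R [:0, b:]"
    and R: "pint_poly R" "coeff R 0 = 1" and "\<delta> > 0" "m > 0"
  defines "Q \<equiv> fps_X ^ l * fps_of_poly (q ^ m)" and "M \<equiv> l + \<delta> * m"
  shows "2 \<le> i \<Longrightarrow> i \<le> M \<Longrightarrow> \<exists>z. pdvd 0 z \<and> of_nat i * Q $ (M - i) = of_nat m * z * b ^ i"
    and "Q $ (M - 1) = of_nat m * coeff R 1 * b"
proof -
  have dq: "degree (q ^ m) = \<delta> * m"
    using q(1,2) by (metis degree_power_eq leading_coeff_0_iff mult.commute one_neq_zero)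
  have c: "Q $ (M - i) = b ^ i * coeff (R ^ m) i" if "i \<le> \<delta> * m" for i
  proof -
    have "Q $ (M - i) = coeff (q ^ m) (\<delta> * m - i)"
      using that by (simp add: Q_def M_def fps_X_power_mult_nth)
    also have "\<dots> = coeff (reflect_poly (q ^ m)) i"
      using that dq by (simp add: coeff_reflect_poly)
    also have "\<dots> = b ^ i * coeff (R ^ m) i"
      unfolding reflect_poly_power q(3) pcompose_power_poly[symmetric] coeff_pcompose_scale ..
    finally show ?thesis .
  qed
  \<comment> \<open>From (R^m)' = m R^(m-1) R': the source of the factor m and of the division by
    the index.\<close>
  have Rm: "of_nat (Suc i) * coeff (R ^ m) (Suc i) = of_nat m * coeff (R ^ (m - 1) * pderiv R) i" for i
    by (simp add: coeff_pderiv[symmetric] pderiv_power del: of_nat_Suc)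
  have pintR: "pint_poly (R ^ k)" for k
    by (induction k) (auto intro: pint_poly_mult R, auto simp: pint_poly_def one_pCons coeff_pCons split: nat.splits)
  have pintdR: "pint_poly (pderiv R)"
    using R(1) pdvd_of_nat by (auto simp: pint_poly_def coeff_pderiv simp del: of_nat_Suc intro: pdvd_mult_left)
  show "\<exists>z. pdvd 0 z \<and> of_nat i * Q $ (M - i) = of_nat m * z * b ^ i" if i: "2 \<le> i" "i \<le> M" for i
  proof (cases "i \<le> \<delta> * m")
    case True
    obtain j where j: "i = Suc j" using i by (cases i) auto
    have "pdvd 0 (coeff (R ^ (m - 1) * pderiv R) j)"
      using pint_poly_mult[OF pintR pintdR] by (simp add: pint_poly_def)
    moreover have "of_nat i * Q $ (M - i) = of_nat m * coeff (R ^ (m - 1) * pderiv R) j * b ^ i"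
      using c[OF True] Rm[of j] unfolding j by (simp add: mult_ac)
    ultimately show ?thesis by blast
  next
    case False
    then have "Q $ (M - i) = 0" using i by (simp add: Q_def M_def fps_X_power_mult_nth)
    then show ?thesis by (intro exI[of _ 0]) simp
  qed
  have "1 \<le> \<delta> * m" using assms(6,7) by (simp add: Suc_le_eq)
  then have "Q $ (M - 1) = b * coeff (R ^ m) 1" using c[of 1] by simp
  moreover have "coeff (R ^ m) 1 = of_nat m * coeff R 1"
    using Rm[of 0] R(2) by (simp add: coeff_mult coeff_pderiv coeff_0_power)
  ultimately show "Q $ (M - 1) = of_nat m * coeff R 1 * b" by (simp add: mult_ac)
qed

lemma fint_cancel_unit:
  assumes "fint R" "punit (R $ 0)" "fint (R * G)" shows "fint G"
proof -
  have "pdvd 0 (G $ i)" for i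
  proof (induction i rule: less_induct)
    case (less i)
    have "{0..i} = insert 0 {1..i}" by auto
    then have "R $ 0 * G $ i = (R * G) $ i - (\<Sum>j\<in>{1..i}. R $ j * G $ (i - j))"
      unfolding fps_mult_nth by simp
    moreover have "pdvd 0 (\<Sum>j\<in>{1..i}. R $ j * G $ (i - j))"
      using assms(1) less by (intro pdvd_sum pdvd_mult_left) (auto simp: fint_def)
    ultimately have "pdvd 0 (R $ 0 * G $ i)"
      using assms(3) pdvd_diff by (simp add: fint_def)
    then show ?case using pdvd_cancel_unit[OF assms(2)] by blast
  qed
  then show ?thesis by (simp add: fint_def)
qed

lemma fint_inverse:
  assumes "fint R" "punit (R $ 0)" shows "fint (inverse R)"
proof (rule fint_cancel_unit[OF assms])
  have "R * inverse R = 1"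
    using punit_nonzero[OF assms(2)] by (simp add: inverse_mult_eq_1')
  then show "fint (R * inverse R)" using fint_1 by simp
qed

text \<open>For i > 0, coefficient i of V^2 is 2 V_0 V_i plus products of earlier coefficients, and
  2 V_0 is a unit.\<close>

lemma fint_sqrt:
  assumes "fint F" "V\<^sup>2 = F" "punit (V $ 0)" shows "fint V"
proof -
  have "pdvd 0 (V $ i)" for i
  proof (induction i rule: less_induct)
    case (less i)
    show ?case
    proof (cases "i = 0")
      case True
      then show ?thesis using assms(3) by (simp add: punit_def)
    next
      case False
      then have "{0..i} = insert 0 (insert i {1..<i})" by auto
      then have "F $ i = V $ 0 * V $ i + (V $ i * V $ 0 + (\<Sum>j\<in>{1..<i}. V $ j * V $ (i - j)))"
        unfolding assms(2)[symmetric] power2_eq_square fps_mult_nth using False by simp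
      then have "(2 * V $ 0) * V $ i = F $ i - (\<Sum>j\<in>{1..<i}. V $ j * V $ (i - j))" by simp
      moreover have "pdvd 0 (\<Sum>j\<in>{1..<i}. V $ j * V $ (i - j))"
        using less by (intro pdvd_sum pdvd_mult_left) auto
      ultimately have "pdvd 0 ((2 * V $ 0) * V $ i)"
        using assms(1) pdvd_diff by (simp add: fint_def)
      then show ?thesis using pdvd_cancel_unit[OF punit_mult[OF punit_2 assms(3)]] by blast
    qed
  qed
  then show ?thesis by (simp add: fint_def)
qed

text \<open>Coefficient i of U q(U) is q_0 U_i plus terms in earlier coefficients of U, and q_0 is a
  unit.\<close>

lemma fint_implicit:
  assumes "pint_poly q" "punit (coeff q 0)" "U $ 0 = 0" "fint (U * pev q U)" shows "fint U"
proof -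
  have "pdvd 0 (U $ i)" for i
  proof (induction i rule: less_induct)
    case (less i)
    have R: "pdvd 0 (pev q U $ l)" if "l < i" for l
    proof -
      \<comment> \<open>Coefficients of q(U) below i depend only on those of U below i, so U may be
        truncated to a series already known to be integral.\<close>
      define U' where "U' = fps_cutoff i U"
      have "fint U'" using less by (auto simp: U'_def fint_def)
      then have "fint (pev q U')" using fint_pev assms(1) by blast
      moreover have "pev q U $ l = pev q U' $ l"
        using that by (intro pev_eq_if_eq_upto) (auto simp: U'_def)
      ultimately show ?thesis by (simp add: fint_def)
    qed
    show ?case
    proof (cases "i = 0")
      case False
      then have "{0..i} = insert 0 (insert i {1..<i})" by auto
      then have "(U * pev q U) $ i = U $ i * coeff q 0 + (\<Sum>j\<in>{1..<i}. U $ j * pev q U $ (i - j))"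
        unfolding fps_mult_nth using False assms(3) by (simp add: pev_nth_0 poly_0_coeff_0)
      then have "coeff q 0 * U $ i = (U * pev q U) $ i - (\<Sum>j\<in>{1..<i}. U $ j * pev q U $ (i - j))"
        by simp
      moreover have "pdvd 0 (\<Sum>j\<in>{1..<i}. U $ j * pev q U $ (i - j))"
        using less R by (intro pdvd_sum pdvd_mult_left) auto
      ultimately have "pdvd 0 (coeff q 0 * U $ i)"
        using assms(4) pdvd_diff by (simp add: fint_def)
      then show ?thesis using pdvd_cancel_unit[OF assms(2)] by blast
    qed (simp add: assms(3))
  qed
  then show ?thesis by (simp add: fint_def)
qed

text \<open>
  The pairs \<open>A, B\<close> such that \<open>A + B y\<close> has poles only at infinity, of order at most \<open>n\<close> relative to \<open>x\<close>.
\<close>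

definition Riemann_Roch_space :: "nat \<Rightarrow> nat \<Rightarrow> rat poly \<Rightarrow> rat poly \<Rightarrow> bool" where
  "Riemann_Roch_space n g A B \<longleftrightarrow> (\<forall>i>n. coeff A i = 0) \<and> (\<forall>i. i + g + 1 > n \<longrightarrow> coeff B i = 0)"

lemma Riemann_Roch_space_smult: "Riemann_Roch_space n g A B \<Longrightarrow> Riemann_Roch_space n g (smult c A) (smult c B)"
  by (simp add: Riemann_Roch_space_def)

lemma Riemann_Roch_space_diff:
  "Riemann_Roch_space n g A B \<Longrightarrow> Riemann_Roch_space n g A' B' \<Longrightarrow> Riemann_Roch_space n g (A - A') (B - B')"
  by (simp add: Riemann_Roch_space_def)

lemma Riemann_Roch_space_iff:
  "Riemann_Roch_space n g A B \<longleftrightarrow> degree A \<le> n \<and> (B = 0 \<or> degree B + g + 1 \<le> n)"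
proof
  assume *: "Riemann_Roch_space n g A B"
  have "degree A \<le> n" using * by (intro degree_le) (simp add: Riemann_Roch_space_def)
  moreover have "degree B + g + 1 \<le> n" if "B \<noteq> 0"
  proof (rule ccontr)
    assume "\<not> degree B + g + 1 \<le> n"
    then have "lead_coeff B = 0" using * by (simp add: Riemann_Roch_space_def)
    then show False using that by simp
  qed
  ultimately show "degree A \<le> n \<and> (B = 0 \<or> degree B + g + 1 \<le> n)" by blast
qed (auto simp: Riemann_Roch_space_def coeff_eq_0)

lemma pint_poly_monom: "pint_poly (monom 1 n)" and pint_poly_0: "pint_poly 0"
  by (auto simp: pint_poly_def)

lemma reflect_linear: "reflect_poly [:b, 1:] = pcompose [:1, 1:] [:0, b :: rat:]"
  by (cases "b = 0") (simp_all add: reflect_poly_def cCons_def pcompose_pCons)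

lemma fps_of_linear_power: "fps_of_poly ([:b, 1:] ^ n) = (fps_X + fps_const b) ^ n"
  by (simp add: fps_of_poly_power fps_of_poly_pCons add.commute)

text \<open>The case q = X + b, R = 1 + X; the factor X^l accounts for zeros of the reference
  function at the base point itself.\<close>

lemma linear_power_reduction:
  assumes "n > 0" "b \<noteq> 0" "pdvd 1 b" "fint W" "punit (W $ 0)"
  shows "\<exists>s. \<forall>k G U. fint G \<longrightarrow>
    fps_const (of_nat p ^ k) * G = fps_X ^ (l + n) * U - fps_X ^ l * (fps_X + fps_const b) ^ n * W \<longrightarrow>
    k \<le> s \<and> pord (l + n - 1) G"
proof -
  have R: "degree [:b, 1 :: rat:] = 1" "lead_coeff [:b, 1 :: rat:] = 1" "pint_poly [:1, 1:]" "coeff [:1, 1 :: rat:] 0 = 1"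
    by (simp_all add: pint_poly_pCons pint_poly_0)
  note h = homogeneous_coefficients[OF R(1,2) reflect_linear R(3,4) zero_less_one assms(1), where l = l]
  show ?thesis
    unfolding fps_of_linear_power[symmetric]
  proof (rule simple_pole_reduction)
    show "(fps_X ^ l * fps_of_poly ([:b, 1:] ^ n)) $ (l + n - 1) = of_nat n * 1 * b"
      using h(2) by simp
    show "\<exists>z. pdvd 0 z \<and> of_nat i * (fps_X ^ l * fps_of_poly ([:b, 1:] ^ n)) $ (l + n - i) = of_nat n * z * b ^ i"
      if "2 \<le> i" "i \<le> l + n" for i
      using h(1)[of i] that by simp
  qed (use assms punit_1 in auto)
qed

text \<open>The coordinate is X = y - y0, so that P is X = 0 and its conjugate X = -2 y0. The
  reference function x^n has both as n-fold zeros: with f = y0^2 + x q(x), the expansion U of x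
  satisfies U q(U) = X (X + 2 y0), and q(U) is a unit.\<close>

theorem weierstrass_disc_at_origin:
  assumes f: "pint_poly f" "poly f 0 = y0\<^sup>2" "punit (coeff f 1)"
    and y0: "pdvd 1 y0" "y0 \<noteq> 0" and "n > 0" "g \<ge> 1"
    and AB: "Riemann_Roch_space n g A B" "(A, B) \<noteq> (0, 0)"
    "\<And>U V i. param f 0 y0 U V \<Longrightarrow> i < 2 * n \<Longrightarrow> pair_ev U V (A, B) $ i = 0"
  shows False
proof -
  let ?V = "fps_X + fps_const y0" and ?b = "2 * y0"
  define q where "q = synthetic_div f 0"
  have fq: "f = pCons (y0\<^sup>2) q"
    using synthetic_div_correct[of f 0] f(2) by (simp add: q_def)
  have q: "pint_poly q" "punit (coeff q 0)"
    using f(1,3) unfolding fq by (simp_all add: pint_poly_pCons)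
  have "poly (pderiv f) 0 \<noteq> 0"
    using punit_nonzero[OF q(2)] by (simp add: fq pderiv_pCons poly_0_coeff_0)
  then obtain U where U: "U $ 0 = 0" "pev f U = ?V\<^sup>2"
    using pev_solve[of f 0 "?V\<^sup>2"] f(2) by (auto simp: power2_eq_square)
  let ?R = "pev q U"
  have UR: "U * ?R = fps_X * (fps_X + fps_const ?b)"
  proof -
    have "U * ?R = ?V\<^sup>2 - fps_const (y0\<^sup>2)"
      using U(2) by (simp add: fq eq_diff_eq add.commute)
    also have "\<dots> = fps_X * (fps_X + fps_const ?b)"
      by (simp add: power2_eq_square algebra_simps flip: fps_const_mult)
    finally show ?thesis .
  qed
  have b: "pdvd 1 ?b" "?b \<noteq> 0" using y0 pdvd_mult_left by auto
  have fUR: "fint (U * ?R)"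
    unfolding UR using b by (intro fint_mult fint_add fint_X fint_const pdvd_pint[of 1]) auto
  have fU: "fint U" using fint_implicit[OF q U(1) fUR] .
  have fV: "fint ?V" using y0 by (intro fint_add fint_X fint_const) (auto intro: pdvd_pint)
  have R0: "?R $ 0 = coeff q 0" using U(1) by (simp add: pev_nth_0 poly_0_coeff_0)
  have fR: "fint ?R" using fint_pev q(1) fU by blast
  let ?I = "inverse ?R"
  have fI: "fint ?I" using fint_inverse fR q(2) R0 by simp
  have RI: "?R * ?I = 1" using punit_nonzero[OF q(2)] R0 by (simp add: inverse_mult_eq_1')
  have UI: "U = fps_X * (fps_X + fps_const ?b) * ?I"
    unfolding UR[symmetric] mult.assoc RI by simp
  have uI: "punit (?I $ 0)"
  proof -
    have "?R $ 0 * ?I $ 0 = 1" using arg_cong[OF RI, of "\<lambda>F. F $ 0"] by simp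
    then show ?thesis
      using pdvd_cancel_unit[of "?R $ 0" 1 "?I $ 0"] q(2) R0 punit_1 punit_inverse[OF q(2)] by (simp add: punit_def)
  qed
  have pU: "pord 2 U"
  proof -
    have "pord 1 (fps_X + fps_const ?b)" by (intro pord_add pord_X pord_const b)
    then have "pord (1 + 1 + 0) (fps_X * (fps_X + fps_const ?b) * ?I)"
      using fI by (intro pord_mult pord_X) (simp_all add: pord_0)
    then show ?thesis unfolding UI[symmetric] by (simp add: numeral_2_eq_2)
  qed
  have U2: "punit (U $ 2)"
  proof -
    have "U $ 2 = ((fps_X + fps_const ?b) * ?I) $ 1"
      by (subst UI) (simp only: mult.assoc, simp add: numeral_2_eq_2)
    also have "\<dots> = ?I $ 0 + ?b * ?I $ 1" by (simp add: fps_mult_nth)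
    finally show ?thesis
      using punit_add[OF uI] pdvd_mult_right[OF b(1)] fI by (simp add: fint_def)
  qed
  have pV: "pord 1 ?V" using y0 by (intro pord_add pord_X pord_const)
  have V1: "punit (?V $ 1)" using punit_1 by simp
  have param: "param f 0 y0 U ?V"
    using U by (simp add: param_def)
  have E: "pair_ev U ?V (monom 1 n, 0) = fps_X ^ n * (fps_X + fps_const ?b) ^ n * ?I ^ n"
    unfolding pair_ev_def fst_conv snd_conv fps_ev.ev_monom by (subst UI) (simp add: power_mult_distrib)
  show False
  proof (rule residue_disc_contradiction[where L = "Riemann_Roch_space n g" and ?E1.0 = "monom 1 n" and ?E2.0 = 0
        and N = n and U = U and V = ?V and Q = "fps_X ^ n * (fps_X + fps_const ?b) ^ n" and W = "?I ^ n"
        and M = "n + n" and A = A and B = B])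
    show "\<exists>s. \<forall>k G U. fint G \<longrightarrow> fps_const (of_nat p ^ k) * G
        = fps_X ^ (n + n) * U - fps_X ^ n * (fps_X + fps_const ?b) ^ n * ?I ^ n \<longrightarrow> k \<le> s \<and> pord (n + n - 1) G"
      using linear_power_reduction[OF \<open>n > 0\<close> b(2,1), of "?I ^ n" n] fint_power[OF fI] punit_power[OF uI]
      by (simp add: fps_nth_power_0)
  next
    fix C D assume CD: "Riemann_Roch_space n g C D" "pint_poly C" "pint_poly D" "pord (n + n - 1) (pair_ev U ?V (C, D))"
    note w = coeff_pdvd_if_pord_weierstrass[OF pU U2 pV V1 CD(2,3,4)]
    have "pdvd 1 (coeff C i - coeff C n * coeff (monom 1 n) i)" for i
    proof (cases "i < n")
      case True
      then show ?thesis using w[of i] by simp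
    next
      case False
      then show ?thesis using CD(1) by (cases "i = n") (auto simp: Riemann_Roch_space_def)
    qed
    \<comment> \<open>Order 2 n - 1 annihilates the coefficients of D below n - 1, and the pole
      bound those from n - 1 on, because g \<ge> 1. For genus 0 the function y x^(n-1) would
      survive.\<close>
    moreover have "pdvd 1 (coeff D i - coeff C n * coeff 0 i)" for i
    proof (cases "i + g + 1 > n")
      case True
      then show ?thesis using CD(1) by (simp add: Riemann_Roch_space_def)
    next
      case False
      then show ?thesis using w[of i] \<open>g \<ge> 1\<close> by simp
    qed
    ultimately show "\<exists>c. pdvd 0 c \<and> (\<forall>i. pdvd 1 (coeff C i - c * coeff (monom 1 n) i)) \<and> (\<forall>i. pdvd 1 (coeff D i - c * coeff 0 i))"
      using CD(2) by (intro exI[of _ "coeff C n"]) (simp add: pint_poly_def)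
  qed (use AB param E fU fV pint_poly_monom pint_poly_0 in
      \<open>auto simp: Riemann_Roch_space_smult Riemann_Roch_space_diff Riemann_Roch_space_def\<close>)
qed

end

context odd_prime
begin

lemma pev_cong_mod:
  assumes "pint_poly A" "fint U" "fint U'" "pord m (U - U')"
  shows "pord m (pev A U - pev A U')"
  using assms(1)
proof (induction A)
  case 0
  then show ?case using assms(4) by (auto simp: pord_def fint_def)
next
  case (pCons a A)
  then have A: "pint_poly A" by (simp add: pint_poly_pCons)
  have "pev (pCons a A) U - pev (pCons a A) U' = (U - U') * pev A U + U' * (pev A U - pev A U')"
    by (simp add: algebra_simps)
  moreover have "pord (m + 0) ((U - U') * pev A U)"
    using assms A by (intro pord_mult) (simp_all add: pord_0 fint_pev)
  moreover have "pord (0 + m) (U' * (pev A U - pev A U'))"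
    using assms pCons.IH[OF A] by (intro pord_mult) (simp_all add: pord_0)
  ultimately show ?case by (simp add: pord_add)
qed

lemma pord_const_any: "pdvd 1 c \<Longrightarrow> pord m (fps_const c)"
  by (auto simp: pord_def fint_const pdvd_pint)

lemma pord_half: assumes "pord m (F + F)" shows "pord m (F :: rat fps)"
proof -
  have e: "F + F = fps_const 2 * F" by (rule fps_ext) (simp only: fps_add_nth fps_mult_left_const_nth mult_2)
  have 2: "fint (fps_const 2)" "punit (fps_const 2 $ 0)" using fint_const punit_2 by simp_all
  have "fint (fps_const 2 * F)" using assms pord_fint unfolding e by blast
  then have F: "fint F" by (rule fint_cancel_unit[OF 2])
  have "pord (m - 0) F"
    using assms F 2 unfolding e by (intro pord_cancel[of m "fps_const 2"]) (simp_all only: pord_0)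
  then show ?thesis by simp
qed

lemma pev_pzero:
  assumes "\<And>i. pdvd 1 (coeff D i)" "fint U" shows "pord m (pev D U)"
proof -
  have "pint_poly D" using assms(1) by (auto simp: pint_poly_def intro: pdvd_pint)
  moreover have "pdvd 1 (pev D U $ i)" for i
    unfolding fps_ev.ev_altdef fps_sum_nth
    using assms(1) fint_power[OF assms(2)] by (intro pdvd_sum) (auto simp: fint_def intro: pdvd_mult_right)
  ultimately show ?thesis using fint_pev assms(2) by (simp add: pord_def)
qed

text \<open>The disc contains P = (v0, w0), at X = 0, and T = (0, w1), at X = -v0. The given
  function vanishes to order n at P and at T' = (0, -w1), the reference function x^n at T and T'.
  The condition at T' is built into the space L, so that only the zeros in the disc differ.\<close>

theorem ordinary_disc_at_origin:
  assumes f: "pint_poly f" "poly f 0 = w1\<^sup>2" "v0 \<noteq> 0" "pdvd 1 v0" "w0\<^sup>2 = poly f v0"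
    and w: "punit w0" "punit w1" "pdvd 1 (w0 - w1)" and "n > 0" "g \<ge> 1"
    and AB: "Riemann_Roch_space n g A B" "(A, B) \<noteq> (0, 0)"
    "\<And>U V i. param f v0 w0 U V \<Longrightarrow> i < n \<Longrightarrow> pair_ev U V (A, B) $ i = 0"
    "\<And>U V i. param f 0 (- w1) U V \<Longrightarrow> i < n \<Longrightarrow> pair_ev U V (A, B) $ i = 0"
  shows False
proof -
  let ?U = "fps_X + fps_const v0"
  have nz: "w0 \<noteq> 0" "- w1 \<noteq> 0" using w punit_nonzero by auto
  obtain V where V: "V $ 0 = w0" "V\<^sup>2 = pev f ?U"
    using fps_sqrt_exists[of "pev f ?U" w0] f(5) nz by (auto simp: pev_nth_0)
  obtain V' where V': "V' $ 0 = - w1" "V'\<^sup>2 = pev f fps_X"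
    using fps_sqrt_exists[of "pev f fps_X" "- w1"] f(2) nz by (auto simp: pev_nth_0)
  have p1: "param f v0 w0 ?U V" using V by (simp add: param_def)
  have p2: "param f 0 (- w1) fps_X V'" using V' by (simp add: param_def)
  have fU: "fint ?U" using f(4) by (intro fint_add fint_X fint_const) (auto intro: pdvd_pint)
  have fV: "fint V" using fint_sqrt[OF fint_pev[OF f(1) fU] V(2)] V(1) w(1) by simp
  have fV': "fint V'" using fint_sqrt[OF fint_pev[OF f(1) fint_X] V'(2)] V'(1) w(2) punit_minus by simp
  have UX: "pord m (?U - fps_X)" for m using pord_const_any[OF f(4)] by simp
  \<comment> \<open>V' expands y at T' with x = X instead of X + v0. Modulo p the two series for x
    agree, and V' becomes the conjugate branch -V.\<close>
  have VV': "pord m (V + V')" for m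
  proof -
    have "(V - V') * (V + V') = pev f ?U - pev f fps_X"
      by (simp add: power2_eq_square algebra_simps flip: V(2) V'(2))
    then have "pord m ((V - V') * (V + V'))" using pev_cong_mod[OF f(1) fU fint_X UX] by simp
    moreover have "punit ((V - V') $ 0)"
    proof -
      have "(V - V') $ 0 = 2 * w0 + (- (w0 - w1))" using V V' by simp
      then show ?thesis using punit_add[OF punit_mult[OF punit_2 w(1)] pdvd_minus[OF w(3)]] by simp
    qed
    ultimately have "pord (m - 0) (V + V')"
      using fV fV' by (intro pord_cancel[of m "V - V'"]) (auto simp: pord_0 intro: fint_add fint_diff)
    then show ?thesis by simp
  qed
  define L where "L C D \<longleftrightarrow> Riemann_Roch_space n g C D \<and> (\<forall>i<n. pair_ev fps_X V' (C, D) $ i = 0)" for C D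
  have E: "pair_ev U Y (monom 1 n, 0) = U ^ n" for U Y :: "rat fps"
    by (simp add: pair_ev_def fps_ev.ev_monom)
  show False
  proof (rule residue_disc_contradiction[where L = L and ?E1.0 = "monom 1 n" and ?E2.0 = 0
        and N = n and U = ?U and V = V and Q = "fps_X ^ 0 * ?U ^ n" and W = 1
        and M = "0 + n" and A = A and B = B])
    show "\<exists>s. \<forall>k G U. fint G \<longrightarrow> fps_const (of_nat p ^ k) * G
        = fps_X ^ (0 + n) * U - fps_X ^ 0 * ?U ^ n * 1 \<longrightarrow> k \<le> s \<and> pord (0 + n - 1) G"
      using linear_power_reduction[OF \<open>n > 0\<close> f(3,4), of 1 0] fint_1 punit_1 by simp
    show "L (smult c C) (smult c D)" if "L C D" for C D c
      using that by (simp add: L_def Riemann_Roch_space_smult pair_ev_smult)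
    show "L (C - C') (D - D')" if "L C D" "L C' D'" for C D C' D'
      using that by (simp add: L_def Riemann_Roch_space_diff pair_ev_diff)
    show "L (monom 1 n) 0"
      unfolding L_def E by (auto simp: Riemann_Roch_space_def)
    show "L A B" using AB p2 by (auto simp: L_def)
    show "pair_ev ?U V (A, B) $ i = 0" if "i < 0 + n" for i using AB(3)[OF p1] that by simp
    show "pair_ev ?U V (monom 1 n, 0) = fps_X ^ 0 * ?U ^ n * 1" by (simp add: E)
  next
    fix C D assume CD: "L C D" "pint_poly C" "pint_poly D" "pord (0 + n - 1) (pair_ev ?U V (C, D))"
    have RR: "Riemann_Roch_space n g C D" using CD(1) by (simp add: L_def)
    have fi: "fint (pev C fps_X)" "fint (pev D fps_X)" "fint (pev C ?U)" "fint (pev D ?U)"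
      using fint_pev CD fU fint_X by blast+
    have PX: "pord n (pair_ev fps_X V' (C, D))"
      using CD fint_pair_ev[OF fint_X fV'] by (simp add: pord_def L_def)
    have C': "pord m (pev C ?U - pev C fps_X)" and D': "pord m (pev D ?U - pev D fps_X)" for m
      using pev_cong_mod[OF _ fU fint_X UX] CD by blast+
    have DV: "pord m (pev D ?U * V + pev D fps_X * V')" for m
    proof -
      have "pev D ?U * V + pev D fps_X * V' = (pev D ?U - pev D fps_X) * V + pev D fps_X * (V + V')"
        by (simp add: algebra_simps)
      moreover have "pord (m + 0) ((pev D ?U - pev D fps_X) * V)" using D' fV by (intro pord_mult) (auto simp: pord_0)
      moreover have "pord (0 + m) (pev D fps_X * (V + V'))" using VV' fi by (intro pord_mult) (auto simp: pord_0)
      ultimately show ?thesis by (simp add: pord_add)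
    qed
    have "pord n ((pev C ?U - pev C fps_X) - (pev D ?U * V + pev D fps_X * V') + pair_ev fps_X V' (C, D))"
      by (rule pord_add[OF pord_diff[OF C' DV] PX])
    \<comment> \<open>Modulo p, vanishing at T' becomes vanishing of the conjugate function along
      the branch at P.\<close>
    then have conj: "pord n (pev C ?U - pev D ?U * V)"
      by (simp add: pair_ev_def algebra_simps)
    have main: "pord (n - 1) (pev C ?U + pev D ?U * V)"
      using CD(4) by (simp add: pair_ev_def)
    have "pord (n - 1) ((pev C ?U + pev D ?U * V) - (pev C ?U - pev D ?U * V))"
      by (rule pord_diff[OF main pord_mono[OF conj]]) simp
    moreover have "(pev C ?U + pev D ?U * V) - (pev C ?U - pev D ?U * V) = V * pev D ?U + V * pev D ?U"
      by (simp add: algebra_simps)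
    ultimately have "pord (n - 1) (V * pev D ?U)"
      using pord_half by simp
    then have "pord (n - 1 - 0) (pev D ?U)"
      using V(1) w(1) fV fi by (intro pord_cancel[of "n - 1" V]) (auto simp: pord_0)
    \<comment> \<open>C + D y and its conjugate have order at least n - 1, hence so has D; but its
      degree is at most n - 2, because g \<ge> 1.\<close>
    then have D0: "pdvd 1 (coeff D i)" for i
    proof (cases "i + g + 1 > n")
      case True
      then show ?thesis using RR by (simp add: Riemann_Roch_space_def)
    next
      case False
      have "pord 1 ?U" using f(4) by (intro pord_add pord_X pord_const)
      then show ?thesis
        using coeff_pdvd_if_pord[OF _ _ CD(3) \<open>pord (n - 1 - 0) (pev D ?U)\<close>, of i] False \<open>g \<ge> 1\<close> punit_1 by simp
    qed
    have pD: "pord m (pev D ?U)" for m using pev_pzero[OF D0 fU] .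
    have "pord (n + 0) (pev D ?U * V)" using pD fV by (intro pord_mult) (auto simp: pord_0)
    then have "pord n ((pev C ?U - pev D ?U * V) + pev D ?U * V)" using conj by (intro pord_add) auto
    then have pC: "pord n (pev C ?U)" by simp
    have "pord 1 ?U" using f(4) by (intro pord_add pord_X pord_const)
    then have C0: "pdvd 1 (coeff C i)" if "i < n" for i
      using coeff_pdvd_if_pord[OF _ _ CD(2) pC that] punit_1 by simp
    have "pdvd 1 (coeff C i - coeff C n * coeff (monom 1 n) i)" for i
      using C0[of i] RR by (cases i n rule: linorder_cases) (auto simp: Riemann_Roch_space_def)
    then show "\<exists>c. pdvd 0 c \<and> (\<forall>i. pdvd 1 (coeff C i - c * coeff (monom 1 n) i)) \<and> (\<forall>i. pdvd 1 (coeff D i - c * coeff 0 i))"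
      using CD(2) D0 by (intro exI[of _ "coeff C n"]) (simp add: pint_poly_def)
  qed (use AB fU fV pint_poly_monom pint_poly_0 in auto)
qed

section \<open>Comparison with a power of y - y0 on y^2 = x^5 + d\<close>

definition pzero :: "rat poly \<Rightarrow> bool" where
  "pzero P \<longleftrightarrow> (\<forall>i. pdvd 1 (coeff P i))"

lemma pzero_add: "pzero P \<Longrightarrow> pzero Q \<Longrightarrow> pzero (P + Q)" and pzero_diff: "pzero P \<Longrightarrow> pzero Q \<Longrightarrow> pzero (P - Q)"
  by (auto simp: pzero_def intro: pdvd_add pdvd_diff)

lemma pzero_mult: "pzero P \<Longrightarrow> pint_poly Q \<Longrightarrow> pzero (P * Q)"
  unfolding pzero_def pint_poly_def coeff_mult by (blast intro: pdvd_sum pdvd_mult_right)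

lemma pint_poly_power: "pint_poly P \<Longrightarrow> pint_poly (P ^ k)"
  by (induction k) (auto intro: pint_poly_mult, simp add: pint_poly_def one_pCons coeff_pCons split: nat.splits)

lemma pzero_power_diff:
  assumes "pint_poly P" "pint_poly Q" "pzero (P - Q)" shows "pzero (P ^ k - Q ^ k)"
proof (induction k)
  case (Suc k)
  have "P ^ Suc k - Q ^ Suc k = (P - Q) * P ^ k + (P ^ k - Q ^ k) * Q"
    by (simp add: algebra_simps)
  then show ?case using Suc assms pzero_mult pint_poly_power by (simp add: pzero_add)
qed (simp add: pzero_def)

text \<open>\<open>square_shift f y m\<close> represents \<open>(V - y)^(2 m)\<close>, where \<open>V\<^sup>2 = f\<close>.\<close>

definition square_shift :: "rat poly \<Rightarrow> rat \<Rightarrow> nat \<Rightarrow> rat poly \<times> rat poly" where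
  "square_shift f y m = (pair_mult f (f + [:y\<^sup>2:], [:- 2 * y:]) ^^ m) (1, 0)"

lemma square_shift_Suc: "square_shift f y (Suc m) = pair_mult f (f + [:y\<^sup>2:], [:- 2 * y:]) (square_shift f y m)"
  by (simp add: square_shift_def)

lemma square_shift_0: "square_shift f y 0 = (1, 0)"
  by (simp add: square_shift_def)

lemma pair_ev_square_shift:
  assumes "V\<^sup>2 = pev f U" shows "pair_ev U V (square_shift f y m) = ((V - fps_const y)\<^sup>2) ^ m"
proof (induction m)
  case (Suc m)
  have "pair_ev U V (f + [:y\<^sup>2:], [:- 2 * y:]) = (V - fps_const y)\<^sup>2"
    by (simp add: pair_ev_def fps_ev.ev_add power2_eq_square algebra_simps flip: fps_const_mult fps_const_neg assms)
  then show ?case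
    unfolding square_shift_Suc pair_ev_mult[OF assms[symmetric]] Suc.IH by simp
qed (simp add: square_shift_0 pair_ev_def)

text \<open>An even power of y - y0 has its leading term f^m in the component without y, which
  normalises that component. The bound 5 m - 3 on the other one is the Riemann-Roch bound for n = 5
  m and genus 2.\<close>

lemma square_shift_coeffs:
  assumes "degree f = 5" "lead_coeff f = 1"
  shows "degree (fst (square_shift f y m)) = 5 * m \<and> lead_coeff (fst (square_shift f y m)) = 1 \<and>
    (\<forall>i. i + 3 > 5 * m \<longrightarrow> coeff (snd (square_shift f y m)) i = 0)"
proof (induction m)
  case (Suc m)
  obtain S T where ST: "square_shift f y m = (S, T)" by (cases "square_shift f y m")
  have S: "degree S = 5 * m" "lead_coeff S = 1" and T: "\<And>i. i + 3 > 5 * m \<Longrightarrow> coeff T i = 0"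
    using Suc unfolding ST fst_conv snd_conv by blast+
  have S0: "S \<noteq> 0" using S by auto
  define F where "F = f + [:y\<^sup>2:]"
  have F: "degree F = 5" "lead_coeff F = 1"
    using assms by (simp_all add: F_def degree_add_eq_left coeff_pCons)
  have F0: "F \<noteq> 0" using F by auto
  have FS: "degree (F * S) = 5 * Suc m" "lead_coeff (F * S) = 1"
    using F(1) S(1) S0 F0 by (simp add: degree_mult_eq) (simp only: lead_coeff_mult F(2) S(2) mult_1)
  have high: "coeff (G * T) i = 0" if "degree G \<le> 5" "i > 5 * m + 2" for G i
    unfolding coeff_mult
  proof (rule sum.neutral, rule ballI)
    fix j assume "j \<in> {..i}"
    show "coeff G j * coeff T (i - j) = 0"
    proof (cases "j > 5")
      case True
      then show ?thesis using that(1) by (simp add: coeff_eq_0)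
    next
      case False
      then have "coeff T (i - j) = 0" using that(2) by (intro T) auto
      then show ?thesis by simp
    qed
  qed
  have S': "fst (square_shift f y (Suc m)) = F * S + smult (- 2 * y) (f * T)"
    by (simp add: square_shift_Suc ST pair_mult_def F_def algebra_simps)
  have T': "snd (square_shift f y (Suc m)) = F * T + smult (- 2 * y) S"
    by (simp add: square_shift_Suc ST pair_mult_def F_def algebra_simps)
  have c: "coeff (F * S + smult (- 2 * y) (f * T)) i = coeff (F * S) i" if "i \<ge> 5 * Suc m" for i
    using high[of f i] assms(1) that by simp
  have top: "coeff (F * S + smult (- 2 * y) (f * T)) (5 * Suc m) = 1"
    using c[OF order_refl] FS(2) unfolding FS(1) by (simp only:)
  have "degree (F * S + smult (- 2 * y) (f * T)) = 5 * Suc m"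
  proof (rule antisym)
    show "degree (F * S + smult (- 2 * y) (f * T)) \<le> 5 * Suc m"
    proof (rule degree_le, intro allI impI)
      fix i assume "i > 5 * Suc m"
      then have "coeff (F * S + smult (- 2 * y) (f * T)) i = coeff (F * S) i" "coeff (F * S) i = 0"
        using c[of i] FS(1) by (simp_all only: coeff_eq_0 less_imp_le)
      then show "coeff (F * S + smult (- 2 * y) (f * T)) i = 0" by (simp only:)
    qed
    show "5 * Suc m \<le> degree (F * S + smult (- 2 * y) (f * T))"
      by (rule le_degree) (unfold top, rule one_neq_zero)
  qed
  moreover note top
  moreover have "coeff (F * T + smult (- 2 * y) S) i = 0" if "i + 3 > 5 * Suc m" for i
    using high[of F i] F(1) S(1) that by (simp add: coeff_eq_0)
  ultimately show ?case unfolding S' T' by (simp only:) simp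
qed (auto simp: square_shift_0)

lemma square_shift_pint:
  assumes "pint_poly f" "pdvd 0 y"
  shows "pint_poly (fst (square_shift f y m)) \<and> pint_poly (snd (square_shift f y m))"
proof (induction m)
  case 0
  then show ?case by (simp add: square_shift_0 pint_poly_0) (simp add: one_pCons pint_poly_pCons pint_poly_0)
next
  case (Suc m)
  have "pint_poly (f + [:y\<^sup>2:])" "pint_poly [:- 2 * y:]"
    using assms by (auto simp: pint_poly_pCons pint_poly_0 pdvd_minus_iff intro!: pint_poly_add intro: pint_power pdvd_mult_left)
  then show ?case
    using Suc assms unfolding square_shift_Suc pair_mult_def fst_conv snd_conv
    by (auto intro!: pint_poly_add pint_poly_diff pint_poly_mult pint_poly_smult pdvd_mult_left)
qed

text \<open>Norms are multiplicative and y - y0 has norm y0^2 - f; the even exponent removes the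
  sign.\<close>

lemma square_shift_norm:
  "pair_mult f (square_shift f y m) (fst (square_shift f y m), - snd (square_shift f y m)) = ((f - [:y\<^sup>2:]) ^ (2 * m), 0)"
proof (induction m)
  case (Suc m)
  let ?u = "(f + [:y\<^sup>2:], [:- 2 * y:])"
  obtain S T where ST: "square_shift f y m = (S, T)" by (cases "square_shift f y m")
  have "(f + c\<^sup>2)\<^sup>2 - f * (- 2 * c)\<^sup>2 = (f - c\<^sup>2)\<^sup>2" for c
    by (simp add: power2_eq_square algebra_simps)
  from this[of "[:y:]"] have n: "(f + [:y\<^sup>2:])\<^sup>2 - f * [:- 2 * y:]\<^sup>2 = (f - [:y\<^sup>2:])\<^sup>2"
    by (simp add: power2_eq_square numeral_poly)
  have "S * S - f * (T * T) = (f - [:y\<^sup>2:]) ^ (2 * m)"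
    using Suc by (simp add: ST)
  then have "((f + [:y\<^sup>2:])\<^sup>2 - f * [:- 2 * y:]\<^sup>2) * (S * S - f * (T * T)) = (f - [:y\<^sup>2:]) ^ (2 * Suc m)"
    unfolding n by (simp add: power_add power2_eq_square)
  moreover have "pair_mult f (pair_mult f u (S, T)) (fst (pair_mult f u (S, T)), - snd (pair_mult f u (S, T)))
     = (((fst u)\<^sup>2 - f * (snd u)\<^sup>2) * (S * S - f * (T * T)), 0)" for u
    by (simp add: pair_mult_def power2_eq_square algebra_simps)
  ultimately show ?case
    unfolding square_shift_Suc ST by (metis fst_conv snd_conv)
qed (simp add: square_shift_0)

text \<open>P = (x0, y0) is at X = 0. From (y - y0)(y + y0) = x^5 - x0^5, with y + y0 a unit in the
  disc, the reference function (y - y0)^(2 m) has zeros of order 2 m where x = z x0, z^5 = 1; the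
  given function has a zero of order 10 m at P alone.\<close>

theorem five_torsion_disc:
  assumes f: "f = monom 1 5 + [:d:]" "pdvd 0 d" "y0\<^sup>2 = poly f x0"
    and x0: "x0 \<noteq> 0" "pdvd 1 x0" and y0: "punit y0" and p5: "p \<noteq> 5" and m: "m > 0"
    and AB: "Riemann_Roch_space (5 * m) 2 A B" "(A, B) \<noteq> (0, 0)"
    "\<And>U V i. param f x0 y0 U V \<Longrightarrow> i < 10 * m \<Longrightarrow> pair_ev U V (A, B) $ i = 0"
  shows False
proof -
  let ?U = "fps_X + fps_const x0"
  have fpint: "pint_poly f" using f(2) unfolding f(1) by (intro pint_poly_add pint_poly_monom) (simp add: pint_poly_pCons pint_poly_0)
  have deg: "degree f = 5" "lead_coeff f = 1"
    by (simp_all add: f(1) degree_add_eq_left degree_monom_eq coeff_pCons)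
  have y0n: "y0 \<noteq> 0" using punit_nonzero[OF y0] .
  obtain V where V: "V $ 0 = y0" "V\<^sup>2 = pev f ?U"
    using fps_sqrt_exists[of "pev f ?U" y0] f(3) y0n by (auto simp: pev_nth_0)
  have par: "param f x0 y0 ?U V" using V by (simp add: param_def)
  have fU: "fint ?U" using x0(2) by (intro fint_add fint_X fint_const) (auto intro: pdvd_pint)
  have pU: "pord 1 ?U" "punit (?U $ 1)"
    using punit_1 pord_add[OF pord_X pord_const[OF x0(2)]] by simp_all
  have fV: "fint V" using fint_sqrt[OF fint_pev[OF fpint fU] V(2)] V(1) y0 by simp
  let ?Y = "fps_const y0"
  have pd: "y0\<^sup>2 = x0 ^ 5 + d" using f(3) by (simp add: f(1) poly_monom)
  have VY: "(V + ?Y) * (V - ?Y) = ?U ^ 5 - fps_const (x0 ^ 5)"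
  proof -
    have "(V + ?Y) * (V - ?Y) = V\<^sup>2 - fps_const (y0\<^sup>2)"
      by (simp add: power2_eq_square algebra_simps flip: fps_const_mult)
    then show ?thesis
      unfolding V(2) pd by (simp add: f(1) fps_ev.ev_add fps_ev.ev_monom flip: fps_const_add)
  qed
  have fVY: "fint (V + ?Y)" "fint (V - ?Y)"
    using fV y0 by (auto intro!: fint_add fint_diff fint_const simp: punit_def)
  have "(V + ?Y) $ 0 = 2 * y0" using V(1) by simp
  then have uVY: "punit ((V + ?Y) $ 0)" using punit_mult[OF punit_2 y0] by (simp only:)
  have pVY: "pord 5 (V - ?Y)"
  proof -
    have "pdvd 1 (x0 ^ 5)" using pdvd_mult_right[OF x0(2) pint_power[OF pdvd_pint[OF x0(2)], of 4]]
      by (simp add: power_Suc[symmetric] del: power_Suc)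
    then have "pord (1 * 5) (?U ^ 5 - fps_const (x0 ^ 5))"
      by (intro pord_diff pord_power pU(1) pord_const_any)
    then have "pord (5 - 0) (V - ?Y)"
      using fVY uVY unfolding VY[symmetric] by (intro pord_cancel[of 5 "V + ?Y"]) (simp_all add: pord_0)
    then show ?thesis by simp
  qed
  let ?I = "inverse (V + ?Y)"
  have fI: "fint ?I" using fint_inverse fVY uVY by blast
  have uI: "punit (?I $ 0)"
    using punit_inverse[OF uVY] pdvd_cancel_unit[OF uVY, of 1 "?I $ 0"] punit_1 punit_nonzero[OF uVY]
    by (simp add: punit_def)
  have VI: "V - ?Y = (?U ^ 5 - fps_const (x0 ^ 5)) * ?I"
  proof -
    have "(V + ?Y) * ?I = 1" using punit_nonzero[OF uVY] by (intro inverse_mult_eq_1') simp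
    moreover have "(?U ^ 5 - fps_const (x0 ^ 5)) * ?I = (V - ?Y) * ((V + ?Y) * ?I)"
      unfolding VY[symmetric] by (simp only: mult_ac)
    ultimately show ?thesis by simp
  qed
  \<comment> \<open>This is (X + x0)^5 - x0^5, homogeneous in X and x0. Its reversal comes from (1 +
    Z)^5 - Z^5, whose linear coefficient 5 is the unit \<rho> in the simple pole.\<close>
  let ?q = "[:0, 5 * x0 ^ 4, 10 * x0 ^ 3, 10 * x0\<^sup>2, 5 * x0, 1:]"
  have q: "degree ?q = 5" "lead_coeff ?q = 1" "reflect_poly ?q = pcompose [:1, 5, 10, 10, 5:] [:0, x0:]"
    by (simp_all add: reflect_poly_def cCons_def pcompose_pCons power_numeral_reduce power2_eq_square x0)
  have qU: "fps_of_poly ?q = ?U ^ 5 - fps_const (x0 ^ 5)"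
    by (simp add: fps_of_poly_pCons power_numeral_reduce algebra_simps fps_numeral_fps_const flip: fps_const_mult fps_const_power)
  have R: "pint_poly [:1, 5, 10, 10, 5:]" "coeff [:1, 5, 10, 10, 5 :: rat:] 0 = 1"
    by (simp_all add: pint_poly_pCons pint_poly_0)
  have m2: "2 * m > 0" using m by simp
  have five: "punit 5"
  proof -
    have "\<not> int p dvd 5"
      using p5 prime_int primes_dvd_imp_eq[of "int p" 5] by auto
    then show ?thesis using punit_of_int_iff[of 5] by simp
  qed
  note hom = homogeneous_coefficients[OF q R zero_less_numeral m2, where l = 0]
  let ?Q = "fps_X ^ 0 * fps_of_poly (?q ^ (2 * m))" and ?W = "?I ^ (2 * m)"
  have red: "\<exists>s. \<forall>k G U. fint G \<longrightarrow> fps_const (of_nat p ^ k) * G = fps_X ^ (10 * m) * U - ?Q * ?W \<longrightarrow>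
      k \<le> s \<and> pord (10 * m - 1) G"
  proof (rule simple_pole_reduction)
    show "\<exists>z. pdvd 0 z \<and> of_nat i * ?Q $ (10 * m - i) = of_nat (2 * m) * z * x0 ^ i" if "2 \<le> i" "i \<le> 10 * m" for i
      using hom(1)[of i] that by simp
    show "?Q $ (10 * m - 1) = of_nat (2 * m) * 5 * x0" using hom(2) by simp
    show "fint ?W" "punit (?W $ 0)" using fint_power[OF fI] punit_power[OF uI] by (simp_all only: fps_nth_power_0)
  qed (use five m x0 in auto)
  obtain S T where ST: "square_shift f y0 m = (S, T)" by (cases "square_shift f y0 m")
  have S: "degree S = 5 * m" "coeff S (5 * m) = 1" and T: "\<And>i. i + 3 > 5 * m \<Longrightarrow> coeff T i = 0"
    using square_shift_coeffs[OF deg, of y0 m] unfolding ST by auto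
  have ST_pint: "pint_poly S" "pint_poly T"
    using square_shift_pint[OF fpint punit_pint[OF y0], of m] unfolding ST by auto
  have E: "pair_ev ?U V (S, T) = ?Q * ?W"
    using pair_ev_square_shift[OF V(2), of y0 m] unfolding ST
    by (simp add: VI fps_of_poly_power qU power_mult_distrib flip: power_mult)
  have conj: "pair_ev ?U V (S, - T) = ((V + ?Y)\<^sup>2) ^ m" and conj': "pair_ev ?U (- V) (S, - T) = ((V - ?Y)\<^sup>2) ^ m"
  proof -
    have "(- V)\<^sup>2 = pev f ?U" using V(2) by simp
    then have "pair_ev ?U (- V) (S, T) = ((- V - ?Y)\<^sup>2) ^ m"
      using pair_ev_square_shift[of "- V" f ?U y0 m] unfolding ST by simp
    moreover have "(- V - ?Y)\<^sup>2 = (V + ?Y)\<^sup>2" by (simp add: power2_eq_square algebra_simps)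
    ultimately show "pair_ev ?U V (S, - T) = ((V + ?Y)\<^sup>2) ^ m"
      by (simp add: pair_ev_def fps_ev.ev_minus)
    show "pair_ev ?U (- V) (S, - T) = ((V - ?Y)\<^sup>2) ^ m"
      using pair_ev_square_shift[OF V(2), of y0 m] unfolding ST by (simp add: pair_ev_def fps_ev.ev_minus)
  qed
  let ?N = "(f - [:y0\<^sup>2:]) ^ (2 * m)"
  have N: "S * S - f * (T * T) = ?N"
    using square_shift_norm[of f y0 m] unfolding ST by simp
  have Nz: "pzero (?N - monom 1 (10 * m))"
  proof -
    have "monom 1 (10 * m) = (monom 1 5 :: rat poly) ^ (2 * m)" by (simp add: monom_power)
    moreover have "f - [:y0\<^sup>2:] - monom 1 5 = [:- (x0 ^ 5):]" using pd by (simp add: f(1))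
    moreover have "pzero [:- (x0 ^ 5):]"
      using pdvd_mult_right[OF x0(2) pint_power[OF pdvd_pint[OF x0(2)], of 4]]
      by (auto simp: pzero_def coeff_pCons pdvd_minus_iff power_Suc[symmetric] simp del: power_Suc split: nat.splits)
    moreover have "pint_poly (f - [:y0\<^sup>2:])"
      using fpint pint_power[OF punit_pint[OF y0], of 2] by (intro pint_poly_diff) (auto simp: pint_poly_pCons pint_poly_0)
    ultimately show ?thesis using pzero_power_diff[OF _ pint_poly_monom] by metis
  qed
  show False
  proof (rule residue_disc_contradiction[where L = "Riemann_Roch_space (5 * m) 2" and ?E1.0 = S and ?E2.0 = T
        and N = "5 * m" and U = ?U and V = V and Q = ?Q and W = ?W and M = "10 * m" and A = A and B = B])
    fix C D assume CD: "Riemann_Roch_space (5 * m) 2 C D" "pint_poly C" "pint_poly D"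
      "pord (10 * m - 1) (pair_ev ?U V (C, D))"
    \<comment> \<open>C + D y is multiplied by the conjugate of E, a unit in the disc of P. The
      comparison with E becomes one with the norm of E, which is x^(10 m) modulo p.\<close>
    define C' where "C' = C * S - f * (D * T)"
    define D' where "D' = D * S - C * T"
    have CD': "pint_poly C'" "pint_poly D'"
      unfolding C'_def D'_def using CD ST_pint fpint by (auto intro!: pint_poly_diff pint_poly_mult)
    have pm: "(C', D') = pair_mult f (C, D) (S, - T)" by (simp add: C'_def D'_def)
    have e1: "pair_ev ?U V (C', D') = pair_ev ?U V (C, D) * ((V + ?Y)\<^sup>2) ^ m"
      unfolding pm pair_ev_mult[OF V(2)[symmetric]] conj ..
    have "pev f ?U = (- V)\<^sup>2" using V(2) by simp
    then have e2: "pair_ev ?U (- V) (C', D') = pair_ev ?U (- V) (C, D) * ((V - ?Y)\<^sup>2) ^ m"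
      unfolding pm by (simp only: pair_ev_mult conj')
    have "pord (10 * m - 1 + 0) (pair_ev ?U V (C', D'))"
      unfolding e1 using CD(4) fVY by (intro pord_mult) (auto simp: pord_0 intro: fint_power)
    then have p1: "pord (10 * m - 1) (pev C' ?U + pev D' ?U * V)" by (simp add: pair_ev_def)
    have fV': "fint (- V)" using fV by (auto simp: fint_def pdvd_minus_iff)
    have "pord (0 + 5 * 2 * m) (pair_ev ?U (- V) (C', D'))"
      unfolding e2 using fint_pair_ev[OF fU fV' CD(2,3)] pVY by (intro pord_mult pord_power) (auto simp: pord_0)
    then have p2: "pord (10 * m) (pev C' ?U - pev D' ?U * V)" by (simp add: pair_ev_def)
    have fi: "fint (pev C' ?U)" "fint (pev D' ?U)" using fint_pev CD' fU by blast+
    have "pord (10 * m - 1) ((pev C' ?U + pev D' ?U * V) - (pev C' ?U - pev D' ?U * V))"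
      by (rule pord_diff[OF p1 pord_mono[OF p2]]) simp
    moreover have "(pev C' ?U + pev D' ?U * V) - (pev C' ?U - pev D' ?U * V) = V * pev D' ?U + V * pev D' ?U"
      by (simp add: algebra_simps)
    ultimately have "pord (10 * m - 1) (V * pev D' ?U)" using pord_half by simp
    then have pD': "pord (10 * m - 1 - 0) (pev D' ?U)"
      using V(1) y0 fV fi by (intro pord_cancel[of "10 * m - 1" V]) (auto simp: pord_0)
    have C0: "coeff C i = 0" if "i > 5 * m" for i using CD(1) that by (simp add: Riemann_Roch_space_def)
    have D0: "coeff D i = 0" if "i + 3 > 5 * m" for i using CD(1) that by (simp add: Riemann_Roch_space_def)
    have S0: "coeff S i = 0" if "i > 5 * m" for i using S(1) that by (simp add: coeff_eq_0)
    have prod0: "coeff (G * K) i = 0" if "\<And>i. i > a \<Longrightarrow> coeff G i = 0" "\<And>i. i > b \<Longrightarrow> coeff K i = 0" "i > a + b"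
      for G K :: "rat poly" and a b i
      unfolding coeff_mult
    proof (rule sum.neutral, rule ballI)
      fix j assume "j \<in> {..i}"
      then have "j > a \<or> i - j > b" using that(3) by auto
      then show "coeff G j * coeff K (i - j) = 0" using that(1,2) by auto
    qed
    \<comment> \<open>The pole bounds give D' a degree of at most 10 m - 3, so vanishing to order 10
      m - 1 modulo p annihilates it.\<close>
    have D'0: "coeff D' i = 0" if "i \<ge> 10 * m - 1" for i
    proof -
      have "D = 0 \<and> T = 0 \<or> (\<forall>i > 5 * m - 3. coeff D i = 0) \<and> (\<forall>i > 5 * m - 3. coeff T i = 0)"
        using D0 T by auto
      then show ?thesis
      proof
        assume dt: "(\<forall>i > 5 * m - 3. coeff D i = 0) \<and> (\<forall>i > 5 * m - 3. coeff T i = 0)"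
        have "coeff (D * S) i = 0" "coeff (C * T) i = 0"
          using prod0[of "5 * m - 3" D "5 * m" S i] prod0[of "5 * m" C "5 * m - 3" T i] dt S0 C0 that m by auto
        then show ?thesis by (simp add: D'_def)
      qed (simp add: D'_def)
    qed
    have D'z: "pdvd 1 (coeff D' i)" for i
      using coeff_pdvd_if_pord[OF pU CD'(2) pD', of i] D'0[of i] by (cases "i < 10 * m - 1") auto
    have "pord (10 * m + 0) (pev D' ?U * V)"
      using pev_pzero[OF D'z fU] fV by (intro pord_mult) (auto simp: pord_0)
    then have "pord (10 * m) ((pev C' ?U - pev D' ?U * V) + pev D' ?U * V)"
      using p2 by (intro pord_add) auto
    then have pC': "pord (10 * m) (pev C' ?U)" by simp
    have C'0: "coeff C' i = 0" if "i > 10 * m" for i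
    proof -
      have "coeff (C * S) i = 0" using prod0[of "5 * m" C "5 * m" S i] C0 S0 that by auto
      moreover have "coeff (f * (D * T)) i = 0"
      proof -
        have "coeff (D * T) i = 0" if "i > 10 * m - 5" for i
        proof -
          have dt: "\<forall>i > 5 * m - 3. coeff D i = 0" "\<forall>i > 5 * m - 3. coeff T i = 0" using D0 T by auto
          then show ?thesis using prod0[of "5 * m - 3" D "5 * m - 3" T i] that m by auto
        qed
        moreover have "coeff f i = 0" if "i > 5" for i using deg(1) that by (simp add: coeff_eq_0)
        ultimately show ?thesis using prod0[of 5 f "10 * m - 5" "D * T" i] that m by auto
      qed
      ultimately show ?thesis by (simp add: C'_def)
    qed
    let ?c = "coeff C' (10 * m)"
    have C'z: "pzero (C' - smult ?c (monom 1 (10 * m)))"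
      unfolding pzero_def
    proof
      fix i
      show "pdvd 1 (coeff (C' - smult ?c (monom 1 (10 * m))) i)"
        using coeff_pdvd_if_pord[OF pU CD'(1) pC', of i] C'0[of i] by (cases i "10 * m" rule: linorder_cases) auto
    qed
    have D'zz: "pzero D'" using D'z by (simp add: pzero_def)
    have c: "pdvd 0 ?c" using CD' by (simp add: pint_poly_def)
    \<comment> \<open>Multiplying back by E: modulo p, D' is zero and C' is c x^(10 m), and
      cancelling x^(10 m) leaves C = c S and D = c T.\<close>
    have r1: "C * ?N = C' * S + f * (D' * T)" and r2: "D * ?N = C' * T + D' * S"
      unfolding N[symmetric] C'_def D'_def by (simp_all add: algebra_simps)
    have "monom 1 (10 * m) * (C - smult ?c S)
      = (C' - smult ?c (monom 1 (10 * m))) * S + D' * (f * T) - (?N - monom 1 (10 * m)) * C"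
      using r1 by (simp add: algebra_simps)
    moreover have "monom 1 (10 * m) * (D - smult ?c T)
      = (C' - smult ?c (monom 1 (10 * m))) * T + D' * S - (?N - monom 1 (10 * m)) * D"
      using r2 by (simp add: algebra_simps)
    ultimately have z: "pzero (monom 1 (10 * m) * (C - smult ?c S))" "pzero (monom 1 (10 * m) * (D - smult ?c T))"
      using C'z D'zz Nz ST_pint fpint CD by (auto intro!: pzero_add pzero_diff pzero_mult pint_poly_mult)
    have "pdvd 1 (coeff G i)" if "pzero (monom 1 (10 * m) * G)" for G i
      using that[unfolded pzero_def, rule_format, of "10 * m + i"] by (simp add: coeff_monom_mult)
    then show "\<exists>c. pdvd 0 c \<and> (\<forall>i. pdvd 1 (coeff C i - c * coeff S i)) \<and> (\<forall>i. pdvd 1 (coeff D i - c * coeff T i))"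
      using z c by (intro exI[of _ ?c]) (metis coeff_diff coeff_smult)
  next
    show "Riemann_Roch_space (5 * m) 2 S T"
      using S(1) T by (simp add: Riemann_Roch_space_def coeff_eq_0)
    show "\<exists>s. \<forall>k G U. fint G \<longrightarrow> fps_const (of_nat p ^ k) * G = fps_X ^ (10 * m) * U - ?Q * ?W \<longrightarrow>
      k \<le> s \<and> pord (10 * m - 1) G" by (rule red)
    show "pair_ev ?U V (S, T) = ?Q * ?W" by (rule E)
  qed (use AB par fU fV ST_pint S in \<open>auto intro: Riemann_Roch_space_smult Riemann_Roch_space_diff\<close>)
qed

end

section \<open>Reduction of rational points\<close>

lemma pev_altdef_le:
  assumes "degree p \<le> n" shows "pev p U = (\<Sum>i\<le>n. fps_const (coeff p i) * U ^ i)"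
  unfolding fps_ev.ev_altdef using assms
  by (intro sum.mono_neutral_left) (auto simp: coeff_eq_0)

lemma pev_rev_poly:
  fixes U V :: "'a::field fps"
  assumes "degree p \<le> n" "U * V = 1"
  shows "pev (rev_poly n p) V = V ^ n * pev p U"
proof -
  have "degree (rev_poly n p) \<le> n"
    using assms(1) by (intro degree_le) (simp add: coeff_rev_poly)
  then have "pev (rev_poly n p) V = (\<Sum>i\<le>n. fps_const (coeff (rev_poly n p) i) * V ^ i)"
    by (rule pev_altdef_le)
  also have "\<dots> = (\<Sum>i\<le>n. fps_const (coeff p i) * V ^ (n - i))"
    using assms(1) by (intro sum.reindex_bij_witness[of _ "\<lambda>i. n - i" "\<lambda>i. n - i"]) (auto simp: coeff_rev_poly)
  also have "\<dots> = (\<Sum>i\<le>n. V ^ n * (fps_const (coeff p i) * U ^ i))"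
  proof (rule sum.cong)
    fix i assume "i \<in> {..n}"
    then have "V ^ n * U ^ i = V ^ (n - i) * (U * V) ^ i"
      unfolding power_mult_distrib by (simp add: mult_ac flip: power_add)
    then show "fps_const (coeff p i) * V ^ (n - i) = V ^ n * (fps_const (coeff p i) * U ^ i)"
      using assms(2) by (simp add: mult_ac)
  qed simp
  also have "\<dots> = V ^ n * pev p U"
    by (simp add: pev_altdef_le[OF assms(1)] sum_distrib_left)
  finally show ?thesis .
qed

lemma inf_poly_rev_poly: "inf_poly f = rev_poly (2 * genus f + 2) f"
  by (simp add: inf_poly_def rev_poly_def)

lemma poly_inf_poly:
  assumes "degree f \<ge> 1" "x \<noteq> 0"
  shows "poly (inf_poly f) (inverse x) = poly f x / (x ^ (genus f + 1))\<^sup>2"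
proof -
  have "2 * genus f + 2 - degree f + degree f = (genus f + 1) * 2"
    using inf_poly_exponent[OF assms(1)] by simp
  then have "inverse x ^ (2 * genus f + 2 - degree f) * inverse x ^ degree f = inverse ((x ^ (genus f + 1))\<^sup>2)"
    by (metis power_add power_inverse power_mult)
  then show ?thesis
    using assms(2) by (simp add: inf_poly_def poly_monom poly_reflect_poly_nz divide_inverse mult_ac)
qed

lemma power_coeff_1_eq_0: "(F :: 'a::comm_ring_1 fps) $ 1 = 0 \<Longrightarrow> (F ^ k) $ 1 = 0"
  by (induction k) (simp_all add: fps_mult_nth)

text \<open>The substitution x = 1/v, y = w/v^(g+1) is invertible where v is nonzero. The result is
  unramified because linear terms of V and W can be recovered from those of x and y.\<close>

lemma param_inf_poly:
  fixes f :: "'a::field_char_0 poly"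
  assumes "degree f \<ge> 1" "x \<noteq> 0" "param (inf_poly f) (inverse x) (y / x ^ (genus f + 1)) V W"
  shows "param f x y (inverse V) (W * inverse V ^ (genus f + 1))" and "inverse V * V = 1"
proof -
  have V0: "V $ 0 = inverse x" "V $ 0 \<noteq> 0" using assms by (simp_all add: param_def)
  let ?U = "inverse V" and ?Y = "W * inverse V ^ (genus f + 1)"
  show UV: "?U * V = 1" using V0(2) by (simp add: inverse_mult_eq_1)
  have d: "degree f \<le> 2 * genus f + 2" using inf_poly_exponent[OF assms(1)] by simp
  have "(?U ^ (genus f + 1))\<^sup>2 = ?U ^ ((genus f + 1) * 2)" by (rule power_mult[symmetric])
  also have "(genus f + 1) * 2 = 2 * genus f + 2" by simp
  finally have "?Y\<^sup>2 = W\<^sup>2 * ?U ^ (2 * genus f + 2)" by (simp only: power_mult_distrib)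
  also have "\<dots> = (?U * V) ^ (2 * genus f + 2) * pev f ?U"
    using assms(3) pev_rev_poly[OF d UV] by (simp add: param_def inf_poly_rev_poly power_mult_distrib mult_ac)
  finally have Y2: "?Y\<^sup>2 = pev f ?U" using UV by simp
  have "?U $ 1 \<noteq> 0 \<or> ?Y $ 1 \<noteq> 0"
  proof (rule ccontr)
    assume "\<not> ?thesis"
    then have U1: "?U $ 1 = 0" and Y1: "?Y $ 1 = 0" by auto
    have "(?U * V) $ 1 = 0" using UV by simp
    then have V1: "V $ 1 = 0" using U1 V0 by (simp add: fps_mult_nth)
    have "(?U ^ (genus f + 1)) $ 1 = 0" using power_coeff_1_eq_0[OF U1] by blast
    then have "W $ 1 * (?U ^ (genus f + 1)) $ 0 = 0" using Y1 by (simp add: fps_mult_nth)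
    then have "W $ 1 = 0" using V0 by (simp add: fps_nth_power_0)
    then show False using V1 assms(3) by (simp add: param_def)
  qed
  moreover have U0: "?U $ 0 = x" using V0 by simp
  moreover have "?Y $ 0 = y"
    using U0 assms(2,3) by (simp add: param_def fps_nth_power_0 del: fps_inverse_nth_0)
  ultimately show "param f x y ?U ?Y" using Y2 unfolding param_def by blast
qed

text \<open>In the chart at infinity the pair becomes v^n (A + B y), and v does not vanish at the
  point, so zeros are preserved.\<close>

lemma vanishing_at_infinity_chart:
  fixes f :: "rat poly"
  assumes "degree f \<ge> 1" "x \<noteq> 0" "param (inf_poly f) (inverse x) (y / x ^ (genus f + 1)) V W"
    and "degree A \<le> n" "B = 0 \<or> degree B + genus f + 1 \<le> n"
    and "\<And>U Y i. param f x y U Y \<Longrightarrow> i < M \<Longrightarrow> pair_ev U Y (A, B) $ i = 0" and "i < M"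
  shows "pair_ev V W (rev_poly n A, rev_poly (n - (genus f + 1)) B) $ i = 0"
proof -
  let ?U = "inverse V" and ?Y = "W * inverse V ^ (genus f + 1)"
  note p = param_inf_poly[OF assms(1-3)]
  have "pev (rev_poly (n - (genus f + 1)) B) V * W = V ^ n * (pev B ?U * ?Y)"
  proof (cases "B = 0")
    case False
    then have le: "degree B \<le> n - (genus f + 1)" "genus f + 1 \<le> n" using assms(5) by auto
    have "V ^ n * ?U ^ (genus f + 1) = V ^ (n - (genus f + 1)) * (?U * V) ^ (genus f + 1)"
      unfolding power_mult_distrib using le(2) by (simp add: mult_ac flip: power_add power_Suc)
    then show ?thesis
      unfolding pev_rev_poly[OF le(1) p(2)] p(2) by (simp add: mult_ac)
  qed simp
  then have "pair_ev V W (rev_poly n A, rev_poly (n - (genus f + 1)) B) = V ^ n * pair_ev ?U ?Y (A, B)"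
    by (simp add: pair_ev_def pev_rev_poly[OF assms(4) p(2)] distrib_left)
  moreover have "pair_ev ?U ?Y (A, B) $ j = 0" if "j < M" for j using assms(6)[OF p(1) that] .
  ultimately show ?thesis using \<open>i < M\<close> by (simp add: fps_mult_nth)
qed

context odd_prime
begin

lemma Riemann_Roch_space_rev_poly:
  assumes "Riemann_Roch_space n g A B"
  shows "Riemann_Roch_space n g (rev_poly n A) (rev_poly (n - (g + 1)) B)"
proof -
  have d: "degree A \<le> n" "B = 0 \<or> degree B + g + 1 \<le> n" using assms by (simp_all add: Riemann_Roch_space_iff)
  have dB: "degree B \<le> n - (g + 1)" using d(2) by auto
  have "coeff (rev_poly (n - (g + 1)) B) i = 0" if "i + g + 1 > n" for i
    using that d(2) coeff_rev_poly[OF dB, of i] by (cases "B = 0") auto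
  then show ?thesis using coeff_rev_poly[OF d(1)] by (simp add: Riemann_Roch_space_def)
qed

lemma pint_poly_pcompose: "pint_poly A \<Longrightarrow> pint_poly q \<Longrightarrow> pint_poly (pcompose A q)"
  by (induction A) (auto simp: pcompose_pCons pint_poly_pCons pint_poly_0 intro!: pint_poly_add pint_poly_mult)

text \<open>Translation of x0 to the origin, which preserves the degree bounds.\<close>

theorem weierstrass_disc:
  assumes f: "pint_poly f" "y0\<^sup>2 = poly f x0" "pdvd 0 x0" "punit (poly (pderiv f) x0)"
    and y0: "pdvd 1 y0" "y0 \<noteq> 0" and "n > 0" "g \<ge> 1"
    and AB: "Riemann_Roch_space n g A B" "(A, B) \<noteq> (0, 0)"
    "\<And>U V i. param f x0 y0 U V \<Longrightarrow> i < 2 * n \<Longrightarrow> pair_ev U V (A, B) $ i = 0"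
  shows False
proof -
  let ?c = "\<lambda>q. pcompose q [:x0, 1:]"
  have ev: "pev (?c q) U = pev q (U + fps_const x0)" for q U
    by (simp add: fps_ev.ev_pcompose add.commute)
  have c0: "?c q = 0 \<longleftrightarrow> q = 0" for q by (simp add: pcompose_eq_0_iff)
  show False
  proof (rule weierstrass_disc_at_origin[of "?c f" y0 n g "?c A" "?c B"])
    show "pint_poly (?c f)"
      using f by (intro pint_poly_pcompose) (auto simp: pint_poly_pCons pint_poly_0)
    have "coeff (?c f) 1 = poly (pderiv (?c f)) 0" by (simp add: poly_0_coeff_0 coeff_pderiv)
    also have "\<dots> = poly (pderiv f) x0" by (simp add: pderiv_pcompose poly_pcompose pderiv_pCons)
    finally show "punit (coeff (?c f) 1)" using f(4) by simp
    show "Riemann_Roch_space n g (?c A) (?c B)"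
      using AB(1) by (simp add: Riemann_Roch_space_iff c0 degree_pcompose)
    show "(?c A, ?c B) \<noteq> (0, 0)" using AB(2) by (simp add: c0)
    fix U V i assume p: "param (?c f) 0 y0 U V" and i: "i < 2 * n"
    have "param f x0 y0 (U + fps_const x0) V" using p by (simp add: param_def ev)
    from AB(3)[OF this i] show "pair_ev U V (?c A, ?c B) $ i = 0" by (simp add: pair_ev_def ev)
  qed (use assms in \<open>auto simp: poly_pcompose\<close>)
qed

lemma pint_poly_value: "pint_poly q \<Longrightarrow> pdvd 0 x \<Longrightarrow> pdvd 0 (poly q x)"
  by (induction q) (auto simp: pint_poly_pCons intro!: pdvd_add intro: pdvd_mult_left)

lemma poly_mod_constant_coeff:
  assumes "pint_poly q" "pdvd 1 v" shows "pdvd 1 (poly q v - coeff q 0)"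
proof -
  obtain a q' where q: "q = pCons a q'" by (cases q)
  then have "pdvd 0 (poly q' v)" using assms pint_poly_value pdvd_pint by (simp add: pint_poly_pCons)
  then have "pdvd 1 (v * poly q' v)" using assms(2) pdvd_mult_right by blast
  then show ?thesis by (simp add: q)
qed

lemma pdvd_power_diff:
  assumes "pdvd 1 (x - y)" "pdvd 0 x" "pdvd 0 y" shows "pdvd 1 (x ^ k - y ^ k)"
proof (induction k)
  case (Suc k)
  have "x ^ Suc k - y ^ Suc k = (x - y) * x ^ k + y * (x ^ k - y ^ k)" by (simp add: algebra_simps)
  then show ?case
    using Suc assms pint_power[OF assms(2), of k]
    by (metis pdvd_add pdvd_mult_left pdvd_mult_right)
qed simp

lemma residue_exists:
  assumes "pdvd 0 x" shows "\<exists>a::nat. pdvd 1 (x - of_nat a)"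
proof -
  obtain a b where ab: "\<not> int p dvd b" "x * of_int b = of_int a"
    using assms unfolding pdvd_def by auto
  have "coprime b (int p)" using prime_imp_coprime[OF prime_int ab(1)] by (simp add: coprime_commute)
  then obtain c where "[b * c = 1] (mod int p)" using cong_solve_coprime_int by blast
  then have "int p dvd b * c - 1" by (simp add: cong_iff_dvd_diff)
  then have "pdvd 1 (x * of_int (b * c - 1))"
    using assms pdvd_1_of_int_iff by (blast intro: pdvd_mult_left)
  moreover have "x * of_int (b * c - 1) = of_int (a * c) - x"
    using ab(2) by (simp add: algebra_simps flip: ab(2))
  ultimately have 1: "pdvd 1 (of_int (a * c) - x)" by simp
  define r where "r = (a * c) mod int p"
  have "int p dvd r - a * c" unfolding r_def by (metis dvd_minus_mod dvd_minus_iff minus_diff_eq)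
  then have "pdvd 1 (of_int (r - a * c))" using pdvd_1_of_int_iff by blast
  then have "pdvd 1 (of_int (r - a * c) + (of_int (a * c) - x))" using 1 pdvd_add by blast
  then have "pdvd 1 (- (x - of_int r))" by simp
  then have "pdvd 1 (x - of_int r)" using pdvd_minus_iff by blast
  moreover have "r \<ge> 0" using ge_3 by (simp add: r_def)
  then have "of_int r = (of_nat (nat r) :: rat)" by simp
  ultimately show ?thesis by metis
qed

lemma pdvd_square: assumes "pdvd 0 (y\<^sup>2)" shows "pdvd 0 y"
proof (rule ccontr)
  assume "\<not> pdvd 0 y"
  then have 1: "pdvd 1 (inverse y)" and "y \<noteq> 0" using pdvd_inverse_if_not_pint by auto
  have "pdvd 1 (inverse y * inverse y * y\<^sup>2)"
    using 1 assms pdvd_pint by (intro pdvd_mult_right) auto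
  moreover have "inverse y * inverse y * y\<^sup>2 = 1" using \<open>y \<noteq> 0\<close> by (simp add: power2_eq_square field_simps)
  ultimately show False using punit_1 by (simp add: punit_def)
qed

lemma pdvd_1_square: assumes "pdvd 1 (y\<^sup>2)" shows "pdvd 1 y"
  using assms pdvd_square[of y] pdvd_prime[of y y] pdvd_pint[OF assms] by (simp add: power2_eq_square)

lemma fermat_mod:
  assumes "punit x" shows "pdvd 1 (x ^ (p - 1) - 1)"
proof -
  have x: "pdvd 0 x" using assms by (simp add: punit_def)
  obtain a where a: "pdvd 1 (x - of_nat a)" using residue_exists[OF x] by blast
  have "\<not> p dvd a"
  proof
    assume "p dvd a"
    then have "pdvd 1 (of_nat a)" using pdvd_1_of_int_iff[of "int a"] by simp
    then have "pdvd 1 (x - of_nat a + of_nat a)" using a pdvd_add by blast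
    then show False using assms by (simp add: punit_def)
  qed
  then have "[a ^ (p - 1) = 1] (mod p)" using fermat_theorem prime by blast
  then have "[int (a ^ (p - 1)) = int 1] (mod int p)" using cong_int_iff by blast
  then have "int p dvd int (a ^ (p - 1)) - 1" by (simp add: cong_iff_dvd_diff)
  then have "pdvd 1 (of_int (int (a ^ (p - 1)) - 1))" using pdvd_1_of_int_iff by blast
  then have "pdvd 1 (of_nat a ^ (p - 1) - 1)" by simp
  then have "pdvd 1 ((x ^ (p - 1) - of_nat a ^ (p - 1)) + (of_nat a ^ (p - 1) - 1))"
    using pdvd_power_diff[OF a x pdvd_of_nat] pdvd_add by blast
  then show ?thesis by simp
qed

end

section \<open>Residue discs without rational points when the rank is 0\<close>

locale rank_zero_curve = odd_prime p + hyperelliptic_Q f0 for p and f0 +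
  assumes pint_f0: "pint_poly f0" and monic: "lead_coeff f0 = 1"
    and rank: "abelian_rank (jacobian_Q f0) = 0"
begin

lemma degree_f0: "degree f0 \<ge> 3"
  using degree_f by (simp add: to_ac.degree_map)

lemma genus_pos: "genus f0 \<ge> 1"
  using degree_f0 by (simp add: genus_def)

lemma pint_inf_poly: "pint_poly (inf_poly f0)"
proof -
  have "degree f0 \<le> 2 * genus f0 + 2" using inf_poly_exponent[of f0] degree_f0 by simp
  then show ?thesis
    unfolding inf_poly_rev_poly using pint_f0 by (auto simp: pint_poly_def coeff_rev_poly)
qed

lemma no_point_in_weierstrass_disc:
  assumes "y0\<^sup>2 = poly f0 x0" "y0 \<noteq> 0" "pdvd 0 x0" "pdvd 1 y0" "punit (poly (pderiv f0) x0)"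
  shows False
proof -
  obtain n A B where *: "n > 0" "(A, B) \<noteq> (0, 0)" "degree A \<le> n" "B = 0 \<or> degree B + genus f0 + 1 \<le> n"
    "\<And>U V i. param f0 x0 y0 U V \<Longrightarrow> i < 2 * n \<Longrightarrow> pair_ev U V (A, B) $ i = 0"
    using conjugate_pair_function[OF rank assms(1,2) zero_less_one] by blast
  have "Riemann_Roch_space n (genus f0) A B" using *(3,4) by (simp add: Riemann_Roch_space_iff)
  then show False
    using weierstrass_disc[OF pint_f0 assms(1,3,5,4,2) *(1) genus_pos _ *(2,5)] by blast
qed

lemma point_at_infinity_chart:
  assumes "y0\<^sup>2 = poly f0 x0" "\<not> pdvd 0 x0"
  shows "x0 \<noteq> 0" "pdvd 1 (inverse x0)" "(y0 / x0 ^ (genus f0 + 1))\<^sup>2 = poly (inf_poly f0) (inverse x0)"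
    "pdvd 0 (y0 / x0 ^ (genus f0 + 1))"
proof -
  show x0: "x0 \<noteq> 0" using assms(2) by auto
  show v: "pdvd 1 (inverse x0)" using pdvd_inverse_if_not_pint[OF assms(2)] .
  show e: "(y0 / x0 ^ (genus f0 + 1))\<^sup>2 = poly (inf_poly f0) (inverse x0)"
    using assms(1) x0 degree_f0 by (subst poly_inf_poly) (auto simp: power_divide)
  show "pdvd 0 (y0 / x0 ^ (genus f0 + 1))"
    by (rule pdvd_square, unfold e, rule pint_poly_value[OF pint_inf_poly pdvd_pint[OF v]])
qed

text \<open>A point with p in the denominator of x reduces to the single point at infinity (v, w) =
  (0, 0). This is a Weierstrass point of the second chart, where the derivative of
  \<open>inf_poly f0\<close> is 1 modulo p.\<close>

lemma integral_if_odd_degree: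
  assumes "y0\<^sup>2 = poly f0 x0" "odd (degree f0)"
  shows "pdvd 0 x0"
proof (rule ccontr)
  assume x0: "\<not> pdvd 0 x0"
  note c = point_at_infinity_chart[OF assms(1) x0]
  let ?v = "inverse x0" and ?w = "y0 / x0 ^ (genus f0 + 1)"
  have "2 * genus f0 + 2 - degree f0 = 1"
    using assms(2) degree_f0 unfolding genus_def by presburger
  then have inf: "inf_poly f0 = [:0, 1:] * reflect_poly f0"
    unfolding inf_poly_def by (simp add: monom_altdef)
  have r: "pint_poly (reflect_poly f0)"
    using pint_inf_poly unfolding inf by (simp add: pint_poly_pCons)
  have "pdvd 1 (poly (reflect_poly f0) ?v - coeff (reflect_poly f0) 0)"
    by (rule poly_mod_constant_coeff[OF r c(2)])
  then have u: "punit (poly (reflect_poly f0) ?v)"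
    using punit_add[OF punit_1] monic by fastforce
  have e: "poly (inf_poly f0) ?v = ?v * poly (reflect_poly f0) ?v" unfolding inf by simp
  have w1: "pdvd 1 ?w"
    by (rule pdvd_1_square, unfold c(3) e, rule pdvd_mult_right[OF c(2) punit_pint[OF u]])
  \<comment> \<open>The point differs from its conjugate: v is nonzero and the other factor of w^2
    is a unit.\<close>
  have w0: "?w \<noteq> 0"
    using c(1,3) punit_nonzero[OF u] unfolding e by auto
  then have y0: "y0 \<noteq> 0" by auto
  have "poly (pderiv (inf_poly f0)) ?v = poly (reflect_poly f0) ?v + ?v * poly (pderiv (reflect_poly f0)) ?v"
    unfolding inf by (simp add: pderiv_pCons)
  moreover have "pint_poly (pderiv (reflect_poly f0))"
    using r pdvd_of_nat by (auto simp: pint_poly_def coeff_pderiv simp del: of_nat_Suc intro: pdvd_mult_left)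
  ultimately have der: "punit (poly (pderiv (inf_poly f0)) ?v)"
    using punit_add[OF u] pdvd_mult_right[OF c(2)] pint_poly_value pdvd_pint[OF c(2)] by simp
  obtain n A B where *: "n > 0" "(A, B) \<noteq> (0, 0)" "degree A \<le> n" "B = 0 \<or> degree B + genus f0 + 1 \<le> n"
    "\<And>U V i. param f0 x0 y0 U V \<Longrightarrow> i < 2 * n \<Longrightarrow> pair_ev U V (A, B) $ i = 0"
    using conjugate_pair_function[OF rank assms(1) y0 zero_less_one] by blast
  let ?A = "rev_poly n A" and ?B = "rev_poly (n - (genus f0 + 1)) B"
  have "Riemann_Roch_space n (genus f0) ?A ?B"
    using *(3,4) by (intro Riemann_Roch_space_rev_poly) (simp add: Riemann_Roch_space_iff)
  moreover have "(?A, ?B) \<noteq> (0, 0)" using *(2) by simp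
  moreover have "pair_ev V W (?A, ?B) $ i = 0" if "param (inf_poly f0) ?v ?w V W" "i < 2 * n" for V W i
    using vanishing_at_infinity_chart[OF _ c(1) that(1) *(3,4,5) that(2)] degree_f0 by simp
  ultimately show False
    using weierstrass_disc[OF pint_inf_poly c(3) pdvd_pint[OF c(2)] der w1 w0 *(1) genus_pos] by blast
qed

text \<open>A point with p in the denominator of x reduces to w = 1 or w = -1 at infinity. Up to a
  change of sign of y it is w = 1, and the rational point there lies in the same disc.\<close>

lemma integral_if_even_degree:
  assumes "y0\<^sup>2 = poly f0 x0" "even (degree f0)"
  shows "pdvd 0 x0"
proof (rule ccontr)
  assume x0: "\<not> pdvd 0 x0"
  have one: "poly (inf_poly f0) 0 = 1"
  proof -
    have "2 * genus f0 + 2 - degree f0 = 0"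
      using assms(2) degree_f0 unfolding genus_def by presburger
    then show ?thesis using monic unfolding inf_poly_def by simp
  qed
  have main: False if y: "y\<^sup>2 = poly f0 x0" and w: "pdvd 1 (y / x0 ^ (genus f0 + 1) - 1)" for y
  proof -
    note c = point_at_infinity_chart[OF y x0]
    let ?v = "inverse x0" and ?w = "y / x0 ^ (genus f0 + 1)"
    have v0: "?v \<noteq> 0" using c(1) by simp
    have u: "punit ?w" using punit_add[OF punit_1 w] by simp
    have sq1: "1\<^sup>2 = poly (inf_poly f0) 0" using one by simp
    obtain n A B where *: "n > 0" "(A, B) \<noteq> (0, 0)" "degree A \<le> n" "B = 0 \<or> degree B + genus f0 + 1 \<le> n"
      "\<And>U V i. param f0 x0 y U V \<Longrightarrow> i < n \<Longrightarrow> pair_ev U V (A, B) $ i = 0"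
      "\<And>U V i. param (inf_poly f0) 0 (- 1) U V \<Longrightarrow> i < n \<Longrightarrow>
         pair_ev U V (rev_poly n A, rev_poly (n - (genus f0 + 1)) B) $ i = 0"
      using point_infinity_function[OF rank y sq1 one_neq_zero] by blast
    let ?A = "rev_poly n A" and ?B = "rev_poly (n - (genus f0 + 1)) B"
    have "Riemann_Roch_space n (genus f0) ?A ?B"
      using *(3,4) by (intro Riemann_Roch_space_rev_poly) (simp add: Riemann_Roch_space_iff)
    moreover have "(?A, ?B) \<noteq> (0, 0)" using *(2) by simp
    moreover have "pair_ev V W (?A, ?B) $ i = 0" if "param (inf_poly f0) ?v ?w V W" "i < n" for V W i
      using vanishing_at_infinity_chart[OF _ c(1) that(1) *(3,4,5) that(2)] degree_f0 by simp
    ultimately show False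
      using ordinary_disc_at_origin[OF pint_inf_poly sq1[symmetric] v0 c(2,3) u punit_1 w *(1) genus_pos] *(6) by blast
  qed
  note c = point_at_infinity_chart[OF assms(1) x0]
  let ?w = "y0 / x0 ^ (genus f0 + 1)"
  have "pdvd 1 (poly (inf_poly f0) (inverse x0) - 1)"
    using poly_mod_constant_coeff[OF pint_inf_poly c(2)] one by (simp add: poly_0_coeff_0)
  then have "pdvd 1 ((?w - 1) * (?w + 1))"
    unfolding c(3)[symmetric] by (simp add: power2_eq_square algebra_simps)
  then have "pdvd 1 (?w - 1) \<or> pdvd 1 (?w + 1)"
    using c(4) by (intro pdvd_prime) (auto intro: pdvd_add pdvd_diff)
  then show False
  proof
    assume "pdvd 1 (?w + 1)"
    then have "pdvd 1 (- (?w + 1))" by (rule pdvd_minus)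
    then show False using main[of "- y0"] assms(1) by simp
  qed (use main assms(1) in blast)
qed

end

section \<open>The three families\<close>

lemma hyperelliptic_QI:
  assumes "degree f \<ge> 3"
    "\<And>\<alpha>. to_ac.ev f \<alpha> = 0 \<Longrightarrow> to_ac.ev (pderiv f) \<alpha> \<noteq> 0"
  shows "hyperelliptic_Q f"
  using assms
  by unfold_locales (simp_all add: to_ac.degree_map to_ac.ev_def flip: to_ac.map_pderiv)

lemma Infty_on_odd_curve:
  fixes f :: "'a::field poly"
  assumes "odd (degree f)" shows "Infty w \<in> curve_points f \<longleftrightarrow> w = 0"
proof -
  have "2 * genus f + 2 - degree f = 1"
    using assms unfolding genus_def by presburger
  then show ?thesis by (simp add: curve_points_def inf_poly_def monom_altdef)
qed

section \<open>The curves y^2 = x^5 + d\<close>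

lemma C_poly_degree: "degree (C_poly d) = 5" "lead_coeff (C_poly d) = 1"
  by (simp_all add: C_poly_def degree_add_eq_left degree_monom_eq coeff_eq_0)

lemma C_poly_hyperelliptic:
  assumes "d \<noteq> 0" shows "hyperelliptic_Q (C_poly d)"
proof (rule hyperelliptic_QI)
  fix \<alpha> :: "rat alg_closure"
  assume a: "to_ac.ev (C_poly d) \<alpha> = 0"
  show "to_ac.ev (pderiv (C_poly d)) \<alpha> \<noteq> 0"
  proof
    assume "to_ac.ev (pderiv (C_poly d)) \<alpha> = 0"
    then have "\<alpha> = 0"
      by (simp add: C_poly_def pderiv_add pderiv_monom pderiv_pCons to_ac.ev_monom)
    then show False using a assms by (simp add: C_poly_def to_ac.ev_add to_ac.ev_monom)
  qed
qed (simp add: C_poly_degree)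

text \<open>As 5 = (11 - 1)/2, fifth powers are 0, 1 or -1 modulo 11, while squares are 0, 1, 3, 4,
  5 or 9; the rest is a comparison of residues.\<close>

lemma mod_11_residues:
  fixes a b d :: int
  assumes "11 dvd b ^ 2 - a ^ 5 - d"
  shows "[d = 7] (mod 11) \<Longrightarrow> False" "[d = 9] (mod 11) \<Longrightarrow> 11 dvd a" "[d = 1] (mod 11) \<Longrightarrow> 11 dvd a \<or> 11 dvd b"
proof -
  let ?A = "(a mod 11) ^ 5 mod 11" and ?B = "(b mod 11) ^ 2 mod 11"
  have "[b ^ 2 - a ^ 5 - d = ?B - ?A - d mod 11] (mod 11)"
    by (intro cong_diff) (simp_all add: cong_def power_mod)
  then have e: "(?B - ?A - d mod 11) mod 11 = 0"
    using assms unfolding cong_def dvd_eq_mod_eq_0 by (simp only:)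
  have "a mod 11 = 0 \<or> a mod 11 = 1 \<or> a mod 11 = 2 \<or> a mod 11 = 3 \<or> a mod 11 = 4 \<or> a mod 11 = 5 \<or> a mod 11 = 6 \<or> a mod 11 = 7 \<or> a mod 11 = 8 \<or> a mod 11 = 9 \<or> a mod 11 = 10" by presburger
  then have a: "?A = 0 \<and> 11 dvd a \<or> ?A = 1 \<or> ?A = 10"
    by (elim disjE) (simp_all add: dvd_eq_mod_eq_0)
  have "b mod 11 = 0 \<or> b mod 11 = 1 \<or> b mod 11 = 2 \<or> b mod 11 = 3 \<or> b mod 11 = 4 \<or> b mod 11 = 5 \<or> b mod 11 = 6 \<or> b mod 11 = 7 \<or> b mod 11 = 8 \<or> b mod 11 = 9 \<or> b mod 11 = 10" by presburger
  then have b: "?B = 0 \<and> 11 dvd b \<or> ?B = 1 \<or> ?B = 3 \<or> ?B = 4 \<or> ?B = 5 \<or> ?B = 9"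
    by (elim disjE) (simp_all add: dvd_eq_mod_eq_0)
  obtain A B \<delta> where AB: "A = ?A" "B = ?B" "\<delta> = d mod 11" by blast
  note e = e[folded AB] and a = a[folded AB] and b = b[folded AB]
  have "\<delta> = 7 \<Longrightarrow> False" "\<delta> = 9 \<Longrightarrow> 11 dvd a" "\<delta> = 1 \<Longrightarrow> 11 dvd a \<or> 11 dvd b"
    using e a b by (elim disjE conjE; simp)+
  then show "[d = 7] (mod 11) \<Longrightarrow> False" "[d = 9] (mod 11) \<Longrightarrow> 11 dvd a"
    "[d = 1] (mod 11) \<Longrightarrow> 11 dvd a \<or> 11 dvd b"
    by (simp_all add: AB cong_def)
qed

text \<open>By the congruences modulo 11, a point reduces to x = 0 or to y = 0. On the first disc it
  is compared with the zeros of y - y(P), on the second one with its conjugate.\<close>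

lemma C_poly_points:
  fixes x y :: rat
  assumes d: "d \<noteq> 0" "[d = 1] (mod 11) \<or> [d = 7] (mod 11) \<or> [d = 9] (mod 11)"
    and rank: "abelian_rank (jacobian_Q (C_poly d)) = 0" and xy: "y\<^sup>2 = poly (C_poly d) x"
  shows "\<not> [d = 7] (mod 11) \<and> (x = 0 \<or> [d = 1] (mod 11) \<and> y = 0)"
proof -
  interpret hyperelliptic_Q "C_poly d" by (rule C_poly_hyperelliptic[OF d(1)])
  interpret odd_prime 11 by unfold_locales simp_all
  have pint: "pint_poly (C_poly d)"
    unfolding C_poly_def by (intro pint_poly_add pint_poly_monom) (simp add: pint_poly_pCons pint_poly_0 pdvd_of_int)
  interpret rank_zero_curve 11 "C_poly d"
    by unfold_locales (rule pint C_poly_degree(2) rank)+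
  have e: "y\<^sup>2 = x ^ 5 + of_int d" using xy by (simp add: C_poly_def poly_monom)
  have x: "pdvd 0 x" using integral_if_odd_degree[OF xy] C_poly_degree by simp
  have y: "pdvd 0 y"
    by (rule pdvd_square, unfold e, rule pdvd_add[OF pint_power[OF x] pdvd_of_int])
  obtain a where a: "pdvd 1 (x - of_nat a)" using residue_exists[OF x] by blast
  obtain b where b: "pdvd 1 (y - of_nat b)" using residue_exists[OF y] by blast
  have "pdvd 1 ((y ^ 2 - of_nat b ^ 2) - (x ^ 5 - of_nat a ^ 5))"
    using pdvd_power_diff[OF a x pdvd_of_nat] pdvd_power_diff[OF b y pdvd_of_nat] by (rule pdvd_diff[rotated])
  then have "pdvd 1 (- of_int (int b ^ 2 - int a ^ 5 - d))" using e by (simp add: algebra_simps)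
  then have "pdvd 1 (of_int (int b ^ 2 - int a ^ 5 - d))" using pdvd_minus_iff by blast
  then have "int 11 dvd int b ^ 2 - int a ^ 5 - d" using pdvd_1_of_int_iff by blast
  then have m: "11 dvd int b ^ 2 - int a ^ 5 - d" by simp
  have ax: "pdvd 1 x" if "11 dvd int a"
  proof -
    have "int 11 dvd int a" using that by simp
    then have "pdvd 1 (of_int (int a))" using pdvd_1_of_int_iff by blast
    then have "pdvd 1 ((x - of_nat a) + of_nat a)" using a pdvd_add by fastforce
    then show ?thesis by simp
  qed
  have by': "pdvd 1 y" if "11 dvd int b"
  proof -
    have "int 11 dvd int b" using that by simp
    then have "pdvd 1 (of_int (int b))" using pdvd_1_of_int_iff by blast
    then have "pdvd 1 ((y - of_nat b) + of_nat b)" using b pdvd_add by fastforce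
    then show ?thesis by simp
  qed
  have dn: "\<not> int 11 dvd d" using d(2) by (auto simp: cong_def dvd_eq_mod_eq_0)
  then have du: "punit (of_int d)" using punit_of_int_iff by blast
  have small_x: "x = 0" if x1: "pdvd 1 x"
  proof (rule ccontr)
    assume x0: "x \<noteq> 0"
    have x5: "pdvd 1 (x ^ 5)"
      using pdvd_mult_right[OF x1 pint_power[OF x, of 4]] by (simp add: power_Suc[symmetric] del: power_Suc)
    have "punit (y * y)" using punit_add[OF du x5] e by (simp add: power2_eq_square add.commute)
    then have yu: "punit y" using y pdvd_mult_right[of 1 y y] by (auto simp: punit_def)
    have y0: "y \<noteq> 0" using punit_nonzero[OF yu] .
    have pos: "(5 :: nat) > 0" by simp
    \<comment> \<open>The multiplicity is taken divisible by 5 so that the pole at infinity can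
      match that of (y - y(P))^(2 m).\<close>
    obtain n A B where *: "n > 0" "5 dvd n" "(A, B) \<noteq> (0, 0)" "degree A \<le> n" "B = 0 \<or> degree B + genus (C_poly d) + 1 \<le> n"
      "\<And>U V i. param (C_poly d) x y U V \<Longrightarrow> i < 2 * n \<Longrightarrow> fps_nth (pair_ev U V (A, B)) i = 0"
      using conjugate_pair_function[OF rank xy y0 pos] by blast
    obtain m where m: "n = 5 * m" using *(2) by blast
    have "genus (C_poly d) = 2" by (simp add: genus_def C_poly_degree)
    then have "Riemann_Roch_space (5 * m) 2 A B" using *(4,5) m by (simp add: Riemann_Roch_space_iff)
    then show False
      using five_torsion_disc[OF C_poly_def pdvd_of_int xy x0 x1 yu, of m A B] * m by simp
  qed
  have small_y: "y = 0" if y1: "pdvd 1 y" and xn: "\<not> pdvd 1 x"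
  proof (rule ccontr)
    assume y0: "y \<noteq> 0"
    have "poly (pderiv (C_poly d)) x = 5 * x ^ 4"
      by (simp add: C_poly_def pderiv_add pderiv_monom pderiv_pCons poly_monom)
    moreover have "punit 5" using punit_of_int_iff[of 5] by simp
    moreover have "punit x" using x xn by (simp add: punit_def)
    ultimately have "punit (poly (pderiv (C_poly d)) x)" using punit_mult punit_power by simp
    then show False using no_point_in_weierstrass_disc[OF xy y0 x y1] by blast
  qed
  show ?thesis
    using d(2) mod_11_residues[OF m] ax by' small_x small_y by blast
qed

lemma rat_power_eq_int:
  fixes q :: rat
  assumes "q ^ n = of_int z" "n > 0"
  shows "\<exists>r::int. q = of_int r \<and> r ^ n = z"
proof -
  obtain a b where ab: "quotient_of q = (a, b)" by (cases "quotient_of q")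
  have q: "q = of_int a / of_int b" "b > 0" "coprime a b"
    using ab quotient_of_div quotient_of_denom_pos quotient_of_coprime by auto
  have "(of_int (a ^ n) :: rat) = of_int (z * b ^ n)"
    using assms(1) q(1,2) by (simp add: power_divide field_simps)
  then have e: "a ^ n = z * b ^ n" by (simp only: of_int_eq_iff)
  have "b dvd a ^ n" unfolding e using assms(2) by (simp add: dvd_power_le)
  moreover have "coprime (a ^ n) b" using q(3) by simp
  ultimately have "b dvd 1" using coprime_common_divisor by (metis dvd_refl)
  then have "b = 1" using q(2) by simp
  then show ?thesis using q(1) e by (intro exI[of _ a]) simp
qed

text \<open>One formula for the three residue classes, of which the listed cases are
  specialisations. Squares and fifth powers of integers appear because a rational root of an integer
  is an integer.\<close>

lemma C_poly_rational_points:
  assumes "d \<noteq> 0" "[d = 1] (mod 11) \<or> [d = 7] (mod 11) \<or> [d = 9] (mod 11)"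
    "abelian_rank (jacobian_Q (C_poly d)) = 0"
  defines "CQ \<equiv> map_hpoint real_of_rat ` curve_points (C_poly d)"
  shows "CQ = {Infty 0}
     \<union> (if is_nth_power 2 d \<and> \<not> [d = 7] (mod 11) then {Affine 0 (sqrt (of_int d)), Affine 0 (- sqrt (of_int d))} else {})
     \<union> (if is_nth_power 5 d \<and> [d = 1] (mod 11) then {Affine (- root 5 (of_int d)) 0} else {})"
    (is "_ = ?R")
proof (intro equalityI subsetI)
  fix P assume "P \<in> CQ"
  then obtain Q where Q: "Q \<in> curve_points (C_poly d)" "P = map_hpoint real_of_rat Q" unfolding CQ_def by blast
  show "P \<in> ?R"
  proof (cases Q)
    case (Infty w)
    then have "w = 0" using Q(1) Infty_on_odd_curve[of "C_poly d"] C_poly_degree by simp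
    then show ?thesis using Q Infty by simp
  next
    case (Affine x y)
    then have xy: "y\<^sup>2 = poly (C_poly d) x" using Q by (simp add: curve_points_def)
    then have e: "y\<^sup>2 = x ^ 5 + of_int d" by (simp add: C_poly_def poly_monom)
    note pts = C_poly_points[OF assms(1-3) xy]
    show ?thesis
    proof (cases "x = 0")
      case True
      then obtain r where r: "y = of_int r" "r\<^sup>2 = d" using rat_power_eq_int[of y 2 d] e by auto
      then have "is_nth_power 2 d" by (auto simp: is_nth_power_def)
      moreover have "real_of_int r = sqrt (of_int d) \<or> real_of_int r = - sqrt (of_int d)"
        using r(2) by (auto simp: real_sqrt_abs)
      ultimately show ?thesis using True r Q Affine pts by auto
    next
      case False
      then have y: "y = 0" and d1: "[d = 1] (mod 11)" using pts by auto
      then have "(- x) ^ 5 = of_int d" using e by (simp add: eq_neg_iff_add_eq_0 add.commute)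
      then obtain r where r: "- x = of_int r" "r ^ 5 = d" using rat_power_eq_int[of "- x" 5 d] by auto
      then have x: "x = - of_int r" by (metis minus_minus)
      have "root 5 (of_int d) = real_of_int r"
        using odd_real_root_power_cancel[of 5 "real_of_int r"] by (simp flip: r(2))
      moreover have "is_nth_power 5 d" using r by (auto simp: is_nth_power_def)
      ultimately show ?thesis using x y d1 Q Affine by (simp add: of_rat_minus)
    qed
  qed
next
  fix P assume P: "P \<in> ?R"
  consider "P = Infty 0" | "is_nth_power 2 d" "P = Affine 0 (sqrt (of_int d)) \<or> P = Affine 0 (- sqrt (of_int d))"
    | "is_nth_power 5 d" "P = Affine (- root 5 (of_int d)) 0"
    using P by (auto split: if_splits)
  then show "P \<in> CQ"
  proof cases
    case 1
    have "Infty 0 \<in> curve_points (C_poly d)" using Infty_on_odd_curve[of "C_poly d"] C_poly_degree by simp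
    then show ?thesis using 1 unfolding CQ_def by (intro image_eqI[of _ _ "Infty 0"]) simp_all
  next
    case 2
    then obtain r where r: "d = r\<^sup>2" by (auto simp: is_nth_power_def)
    have "sqrt (of_int d) = \<bar>real_of_int r\<bar>" by (simp add: r)
    then have "P = map_hpoint real_of_rat (Affine 0 (of_int r)) \<or> P = map_hpoint real_of_rat (Affine 0 (- of_int r))"
      using 2(2) by (cases "r \<ge> 0") (auto simp: of_rat_minus)
    moreover have "Affine 0 (of_int r) \<in> curve_points (C_poly d)" "Affine 0 (- of_int r) \<in> curve_points (C_poly d)"
      by (simp_all add: curve_points_def C_poly_def poly_monom r)
    ultimately show ?thesis unfolding CQ_def by blast
  next
    case 3
    then obtain r where r: "d = r ^ 5" by (auto simp: is_nth_power_def)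
    have "root 5 (of_int d) = real_of_int r"
      using odd_real_root_power_cancel[of 5 "real_of_int r"] r by simp
    then have "P = map_hpoint real_of_rat (Affine (- of_int r) 0)"
      using 3(2) by (simp add: of_rat_minus)
    moreover have "Affine (- of_int r) 0 \<in> curve_points (C_poly d)"
      by (simp add: curve_points_def C_poly_def poly_monom r)
    ultimately show ?thesis unfolding CQ_def by blast
  qed
qed

section \<open>The curves y^2 = x^(p-1) + d x^((p-1)/2) - 1\<close>

lemma D_poly_half:
  assumes "[p = 3] (mod 4)" "p \<ge> 7"
  obtains m where "p = 2 * m + 1" "odd m" "m \<ge> 3" "D_poly p d = monom 1 (2 * m) + monom (of_int d) m - 1"
    "degree (D_poly p d) = 2 * m" "lead_coeff (D_poly p d) = 1"
proof -
  define m where "m = (p - 1) div 2"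
  have "p mod 4 = 3" using assms(1) by (simp add: cong_def)
  \<comment> \<open>That m is odd is the condition p = 3 modulo 4, in the form in which it excludes
    y^2 = -1 modulo p.\<close>
  then have m: "p = 2 * m + 1" "odd m" "m \<ge> 3" using assms(2) unfolding m_def by presburger+
  then have D: "D_poly p d = monom 1 (2 * m) + monom (of_int d) m - 1" by (simp add: D_poly_def)
  have c: "coeff (D_poly p d) i
    = (if i = 2 * m then 1 else 0) + (if i = m then of_int d else 0) - (if i = 0 then 1 else 0)" for i
    unfolding D by (auto simp: coeff_1)
  have deg: "degree (D_poly p d) = 2 * m"
  proof (rule antisym)
    show "degree (D_poly p d) \<le> 2 * m" using m(3) by (intro degree_le) (simp add: c)
    show "2 * m \<le> degree (D_poly p d)" using m(3) by (intro le_degree) (simp add: c)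
  qed
  then have "lead_coeff (D_poly p d) = 1" using m(3) by (simp add: c)
  then show ?thesis using that m D deg by blast
qed

text \<open>Modulo p the equation is y^2 = x^(p-1) - 1. If x is not divisible by p, Fermat gives y =
  0 and the reduction is a Weierstrass point; if it is, then y^2 = -1, which is impossible.\<close>

lemma D_poly_points:
  fixes x y :: rat
  assumes p: "Factorial_Ring.prime p" "p \<ge> 7" "[p = 3] (mod 4)" "int p dvd d"
    and rank: "abelian_rank (jacobian_Q (D_poly p d)) = 0" and xy: "y\<^sup>2 = poly (D_poly p d) x"
  shows "y = 0"
proof (rule ccontr)
  assume y0: "y \<noteq> 0"
  obtain m where m: "p = 2 * m + 1" "odd m" "m \<ge> 3" and D: "D_poly p d = monom 1 (2 * m) + monom (of_int d) m - 1"
    and deg: "degree (D_poly p d) = 2 * m" and lead: "lead_coeff (D_poly p d) = 1"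
    using D_poly_half[OF p(3,2)] by metis
  let ?f = "D_poly p d"
  have dq: "pderiv ?f = monom (of_nat (2 * m)) (2 * m - 1) + monom (of_nat m * of_int d) (m - 1)"
    unfolding D by (simp add: pderiv_add pderiv_diff pderiv_monom)
  interpret hyperelliptic_Q ?f
  proof (rule hyperelliptic_QI)
    show "degree ?f \<ge> 3" using deg m by simp
    fix \<alpha> :: "rat alg_closure"
    assume a: "to_ac.ev ?f \<alpha> = 0"
    show "to_ac.ev (pderiv ?f) \<alpha> \<noteq> 0"
    proof
      assume b: "to_ac.ev (pderiv ?f) \<alpha> = 0"
      \<comment> \<open>In z the equation is z^2 + d z - 1 = 0, whose discriminant d^2 + 4 is
        positive.\<close>
      define z where "z = \<alpha> ^ m"
      have a': "z\<^sup>2 + of_int d * z = 1"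
        using a unfolding D by (simp add: to_ac.ev_add to_ac.ev_diff to_ac.ev_monom z_def power_mult mult.commute[of 2])
      have "\<alpha> * to_ac.ev (pderiv ?f) \<alpha> = of_nat m * (2 * z\<^sup>2 + of_int d * z)"
      proof -
        have "\<alpha> * \<alpha> ^ (2 * m - 1) = z\<^sup>2" "\<alpha> * \<alpha> ^ (m - 1) = z"
          using m(3) by (simp_all add: z_def power_mult mult.commute[of 2] flip: power_Suc)
        moreover have "\<alpha> * to_ac.ev (pderiv ?f) \<alpha>
            = of_nat (2 * m) * (\<alpha> * \<alpha> ^ (2 * m - 1)) + of_nat m * of_int d * (\<alpha> * \<alpha> ^ (m - 1))"
          unfolding dq by (simp add: to_ac.ev_add to_ac.ev_monom distrib_left mult.left_commute)
        ultimately show ?thesis by (simp add: algebra_simps)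
      qed
      then have "2 * z\<^sup>2 + of_int d * z = 0" using b m(3) by simp
      then have "z * (2 * z + of_int d) = 0" by (simp add: power2_eq_square algebra_simps)
      moreover have "z \<noteq> 0" using a' by auto
      ultimately have "2 * z = - of_int d" by (simp add: eq_neg_iff_add_eq_0)
      then have "(2 * z)\<^sup>2 + 2 * of_int d * (2 * z) = - (of_int d)\<^sup>2" by (simp add: power2_eq_square)
      moreover have "(2 * z)\<^sup>2 + 2 * of_int d * (2 * z) = 4 * (z\<^sup>2 + of_int d * z)" by (simp add: power2_eq_square algebra_simps)
      ultimately have "of_int (d\<^sup>2 + 4) = (0 :: rat alg_closure)" unfolding a' by (simp add: eq_neg_iff_add_eq_0 add.commute)
      then have "d\<^sup>2 + 4 = 0" by (simp only: of_int_eq_0_iff)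
      then show False using zero_le_power2[of d] by linarith
    qed
  qed
  interpret odd_prime p using p by unfold_locales simp_all
  have pint: "pint_poly ?f"
    unfolding pint_poly_def D by (auto simp: coeff_1 pdvd_minus_iff intro!: pdvd_add pdvd_diff pdvd_of_int)
  interpret rank_zero_curve p ?f
    by unfold_locales (simp_all only: pint lead rank)
  have x: "pdvd 0 x" using integral_if_even_degree[OF xy] deg by simp
  have dz: "pdvd 1 (of_int d)" using p(4) pdvd_1_of_int_iff by blast
  have e: "y\<^sup>2 = x ^ (2 * m) + of_int d * x ^ m - 1" using xy unfolding D by (simp add: poly_monom)
  have dx: "pdvd 1 (of_int d * x ^ m)" using dz pint_power[OF x] pdvd_mult_right by blast
  have y: "pdvd 0 y"
    by (rule pdvd_square, unfold e, rule pdvd_diff[OF pdvd_add[OF pint_power[OF x] pdvd_pint[OF dx]] pdvd_1])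
  show False
  proof (cases "pdvd 1 x")
    case True
    have "pdvd 1 (x ^ (2 * m))"
      using pdvd_mult_right[OF True pint_power[OF x, of "2 * m - 1"]] m(3) by (simp flip: power_Suc)
    then have "pdvd 1 (x ^ (2 * m) + of_int d * x ^ m)" using dx pdvd_add by blast
    then have y2: "pdvd 1 (y\<^sup>2 - (- 1))" unfolding e by simp
    have "punit (y * y)"
      using punit_add[of "- 1" "y\<^sup>2 - (- 1)"] y2 punit_1 punit_minus by (simp add: power2_eq_square)
    then have "punit y" using y pdvd_mult_right[of 1 y y] by (auto simp: punit_def)
    then have 1: "pdvd 1 (y ^ (2 * m) - 1)" using fermat_mod[of y] m(1) by simp
    \<comment> \<open>Raising y^2 = -1 to the odd power m gives y^(p-1) = -1, against
      Fermat.\<close>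
    have "pdvd 1 ((y\<^sup>2) ^ m - (- 1) ^ m)"
      using y2 pint_power[OF y, of 2] by (intro pdvd_power_diff) (auto simp: pdvd_minus_iff)
    then have "pdvd 1 (y ^ (2 * m) + 1)" using m(2) by (simp add: power_mult)
    then have "pdvd 1 ((y ^ (2 * m) + 1) - (y ^ (2 * m) - 1))" using 1 pdvd_diff by blast
    then show False using punit_2 by (simp add: punit_def)
  next
    case False
    then have xu: "punit x" using x by (simp add: punit_def)
    then have "pdvd 1 (x ^ (2 * m) - 1)" using fermat_mod[of x] m(1) by simp
    then have "pdvd 1 ((x ^ (2 * m) - 1) + of_int d * x ^ m)" using dx pdvd_add by blast
    moreover have "y\<^sup>2 = (x ^ (2 * m) - 1) + of_int d * x ^ m" unfolding e by simp
    ultimately have y1: "pdvd 1 y" using pdvd_1_square by metis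
    have "poly (pderiv ?f) x = of_int (int (2 * m)) * x ^ (2 * m - 1) + of_int d * (of_nat m * x ^ (m - 1))"
      unfolding dq by (simp add: poly_monom algebra_simps)
    moreover have "\<not> int p dvd int (2 * m)" using m(1,3) by (intro zdvd_not_zless) auto
    then have "punit (of_int (int (2 * m)) * x ^ (2 * m - 1))"
      using punit_of_int_iff punit_mult punit_power xu by blast
    moreover have "pdvd 1 (of_int d * (of_nat m * x ^ (m - 1)))"
      using dz pint_power[OF x] pdvd_of_nat by (intro pdvd_mult_right pdvd_mult_left[of "of_nat m" 0])
    ultimately have "punit (poly (pderiv ?f) x)" using punit_add by simp
    then show False using no_point_in_weierstrass_disc[OF xy y0 x y1] by blast
  qed
qed

lemma D_poly_inf:
  assumes "[p = 3] (mod 4)" "p \<ge> 7" shows "poly (inf_poly (D_poly p d)) 0 = 1"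
proof -
  obtain m where "m \<ge> 3" and deg: "degree (D_poly p d) = 2 * m" and lead: "lead_coeff (D_poly p d) = 1"
    using D_poly_half[OF assms] by metis
  then have "2 * genus (D_poly p d) + 2 - degree (D_poly p d) = 0"
    unfolding genus_def deg by presburger
  then show ?thesis using lead by (simp add: inf_poly_def)
qed

section \<open>The curves y^2 = x^p - x\<close>

lemma E_poly_coeff: "coeff (E_poly p) i = (if i = p then 1 else 0) - (if i = 1 then 1 else 0)"
  by (auto simp: E_poly_def)

lemma E_poly_degree:
  assumes "p \<ge> 5" shows "degree (E_poly p) = p" "lead_coeff (E_poly p) = 1"
proof -
  show "degree (E_poly p) = p"
  proof (rule antisym)
    show "degree (E_poly p) \<le> p" using assms by (intro degree_le) (simp add: E_poly_coeff)
    show "p \<le> degree (E_poly p)" using assms by (intro le_degree) (simp add: E_poly_coeff)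
  qed
  then show "lead_coeff (E_poly p) = 1" using assms by (simp add: E_poly_coeff)
qed

text \<open>By Fermat, x^p - x is divisible by p for every p-integral x, so all affine points reduce
  to Weierstrass points, where the derivative is -1 modulo p.\<close>

lemma E_poly_points:
  fixes x y :: rat
  assumes p: "Factorial_Ring.prime p" "p \<ge> 5"
    and rank: "abelian_rank (jacobian_Q (E_poly p)) = 0" and xy: "y\<^sup>2 = poly (E_poly p) x"
  shows "y = 0"
proof (rule ccontr)
  assume y0: "y \<noteq> 0"
  let ?f = "E_poly p"
  have deg: "degree ?f = p" "lead_coeff ?f = 1" using E_poly_degree[OF p(2)] by auto
  have dq: "pderiv ?f = monom (of_nat p) (p - 1) - 1"
    by (simp add: E_poly_def pderiv_diff pderiv_monom monom_0 one_pCons)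
  have odd: "odd p" using p prime_odd_nat by auto
  interpret hyperelliptic_Q ?f
  proof (rule hyperelliptic_QI)
    show "degree ?f \<ge> 3" using deg p by simp
    fix \<alpha> :: "rat alg_closure"
    assume a: "to_ac.ev ?f \<alpha> = 0"
    show "to_ac.ev (pderiv ?f) \<alpha> \<noteq> 0"
    proof
      assume "to_ac.ev (pderiv ?f) \<alpha> = 0"
      \<comment> \<open>A nonzero double root would satisfy both \<alpha>^(p-1) = 1 and p
        \<alpha>^(p-1) = 1.\<close>
      then have b: "of_nat p * \<alpha> ^ (p - 1) = 1" unfolding dq by (simp add: to_ac.ev_diff to_ac.ev_monom)
      have "\<alpha> * \<alpha> ^ (p - 1) = \<alpha>"
        using a p(2) by (simp add: E_poly_def to_ac.ev_diff to_ac.ev_monom flip: power_Suc)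
      moreover have "\<alpha> \<noteq> 0"
      proof
        assume "\<alpha> = 0"
        then have "\<alpha> ^ (p - 1) = 0" using p(2) by (simp add: zero_power)
        with b show False by (simp only: mult_zero_right zero_neq_one)
      qed
      ultimately have "\<alpha> ^ (p - 1) = 1" by simp
      then have "of_nat p = (of_nat 1 :: rat alg_closure)" using b by simp
      then show False using p(2) by (simp only: of_nat_eq_iff)
    qed
  qed
  interpret odd_prime p using p by unfold_locales simp_all
  have pint: "pint_poly ?f"
    unfolding pint_poly_def E_poly_coeff by (auto simp: pdvd_minus_iff intro!: pdvd_diff)
  interpret rank_zero_curve p ?f
    by unfold_locales (rule pint deg(2) rank)+
  have x: "pdvd 0 x" using integral_if_odd_degree[OF xy] deg odd by simp
  have e: "y\<^sup>2 = x * (x ^ (p - 1) - 1)"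
    using xy p(2) by (simp add: E_poly_def poly_monom algebra_simps flip: power_Suc)
  have x1: "pdvd 0 (x ^ (p - 1) - 1)" using pint_power[OF x] by (intro pdvd_diff) auto
  have "pdvd 1 (y\<^sup>2)"
  proof (cases "pdvd 1 x")
    case True
    then show ?thesis unfolding e using x1 by (rule pdvd_mult_right)
  next
    case False
    then show ?thesis unfolding e using x fermat_mod by (intro pdvd_mult_left) (auto simp: punit_def)
  qed
  then have y1: "pdvd 1 y" by (rule pdvd_1_square)
  have "poly (pderiv ?f) x = - 1 + of_int (int p) * x ^ (p - 1)" unfolding dq by (simp add: poly_monom)
  moreover have "pdvd 1 (of_int (int p) * x ^ (p - 1))"
    using pdvd_1_of_int_iff[of "int p"] pint_power[OF x] by (intro pdvd_mult_right) auto
  ultimately have "punit (poly (pderiv ?f) x)" using punit_add punit_1 punit_minus by metis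
  then show False using no_point_in_weierstrass_disc[OF xy y0 x y1] by blast
qed

lemma E_poly_rational_points:
  assumes "Factorial_Ring.prime p" "p \<ge> 5" "abelian_rank (jacobian_Q (E_poly p)) = 0"
  shows "curve_points (E_poly p) = {Affine 0 0, Affine 1 0, Affine (-1) 0, Infty 0}"
proof (intro equalityI subsetI)
  have odd: "odd p" using assms prime_odd_nat by auto
  have odd': "odd (degree (E_poly p))" using odd E_poly_degree[OF assms(2)] by simp
  have ev: "poly (E_poly p) x = x ^ p - x" for x by (simp add: E_poly_def poly_monom)
  {
    fix P assume P: "P \<in> curve_points (E_poly p)"
    show "P \<in> {Affine 0 0, Affine 1 0, Affine (-1) 0, Infty 0}"
    proof (cases P)
      case (Infty w)
      then show ?thesis using P Infty_on_odd_curve[OF odd'] by simp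
    next
      case (Affine x y)
      then have xy: "y\<^sup>2 = poly (E_poly p) x" using P by (simp add: curve_points_def)
      have y: "y = 0" by (rule E_poly_points[OF assms xy])
      have "x * x ^ (p - 1) = x" using xy y assms(2) by (simp add: ev flip: power_Suc)
      then have "x = 0 \<or> x ^ (p - 1) = 1" by auto
      moreover have "x = 1 \<or> x = - 1" if "x ^ (p - 1) = 1"
      proof -
        have "\<bar>x\<bar> ^ (p - 1) = 1 ^ (p - 1)" using that by (simp flip: power_abs)
        then have "\<bar>x\<bar> = 1" using assms(2) by (subst (asm) power_eq_iff_eq_base) auto
        then show ?thesis by linarith
      qed
      ultimately show ?thesis using Affine y by auto
    qed
  }
  fix P :: "rat hpoint" assume "P \<in> {Affine 0 0, Affine 1 0, Affine (-1) 0, Infty 0}"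
  then show "P \<in> curve_points (E_poly p)"
    using Infty_on_odd_curve[OF odd', of 0] odd assms(2) by (auto simp: curve_points_def ev)
qed

theorem corollary1p5:
  shows
    "(\<forall>d::int. d \<noteq> 0 \<longrightarrow> tenth_power_free d \<longrightarrow>
        [d = 1] (mod 11) \<or> [d = 7] (mod 11) \<or> [d = 9] (mod 11) \<longrightarrow>
        abelian_rank (jacobian_Q (C_poly d)) = 0 \<longrightarrow>
        (let CQ = map_hpoint real_of_rat ` curve_points (C_poly d);
             sq = is_nth_power 2 d;
             fifth = is_nth_power 5 d
         in
          ([d = 7] (mod 11) \<longrightarrow> CQ = {Infty 0}) \<and>
          ([d = 9] (mod 11) \<and> sq \<longrightarrow>
             CQ = {Affine 0 (sqrt (of_int d)), Affine 0 (- sqrt (of_int d)), Infty 0}) \<and>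
          ([d = 9] (mod 11) \<and> \<not> sq \<longrightarrow> CQ = {Infty 0}) \<and>
          ([d = 1] (mod 11) \<and> sq \<and> \<not> fifth \<longrightarrow>
             CQ = {Affine 0 (sqrt (of_int d)), Affine 0 (- sqrt (of_int d)), Infty 0}) \<and>
          ([d = 1] (mod 11) \<and> \<not> sq \<and> fifth \<longrightarrow>
             CQ = {Affine (- root 5 (of_int d)) 0, Infty 0}) \<and>
          ([d = 1] (mod 11) \<and> \<not> sq \<and> \<not> fifth \<longrightarrow> CQ = {Infty 0})))
     \<and>
     (\<forall>(p::nat) (d::int). Factorial_Ring.prime p \<longrightarrow> p \<ge> 7 \<longrightarrow> [p = 3] (mod 4) \<longrightarrow> int p dvd d \<longrightarrow>
        abelian_rank (jacobian_Q (D_poly p d)) = 0 \<longrightarrow>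
        map_hpoint to_ac ` curve_points (D_poly p d) \<subseteq>
          {Affine \<alpha> 0 | \<alpha> :: rat alg_closure. poly (map_poly to_ac (D_poly p d)) \<alpha> = 0}
          \<union> {Infty 1, Infty (-1)})
     \<and>
     (\<forall>p::nat. Factorial_Ring.prime p \<longrightarrow> p \<ge> 5 \<longrightarrow>
        abelian_rank (jacobian_Q (E_poly p)) = 0 \<longrightarrow>
        curve_points (E_poly p) = {Affine 0 0, Affine 1 0, Affine (-1) 0, Infty 0})"
proof (intro conjI allI impI, goal_cases)
  case (1 d)
  have "[d = 7] (mod 11) \<Longrightarrow> \<not> [d = 9] (mod 11)" "[d = 7] (mod 11) \<Longrightarrow> \<not> [d = 1] (mod 11)"
    "[d = 9] (mod 11) \<Longrightarrow> \<not> [d = 1] (mod 11)"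
    by (simp_all add: cong_def)
  then show ?case
    unfolding Let_def C_poly_rational_points[OF 1(1,3,4)] by auto
next
  case (2 p d)
  show ?case
  proof (rule image_subsetI)
    fix Q assume Q: "Q \<in> curve_points (D_poly p d)"
    show "map_hpoint to_ac Q
      \<in> {Affine \<alpha> 0 | \<alpha>. poly (map_poly to_ac (D_poly p d)) \<alpha> = 0} \<union> {Infty 1, Infty (-1)}"
    proof (cases Q)
      case (Infty w)
      then have "w\<^sup>2 = 1" using Q D_poly_inf[OF 2(3,2)] by (simp add: curve_points_def)
      then have "w = 1 \<or> w = - 1" by (simp add: power2_eq_1_iff)
      then show ?thesis using Infty by auto
    next
      case (Affine x y)
      then have xy: "y\<^sup>2 = poly (D_poly p d) x" using Q by (simp add: curve_points_def)
      have y: "y = 0" by (rule D_poly_points[OF 2 xy])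
      then show ?thesis using xy Affine to_ac.poly_map[of "D_poly p d" x] by simp
    qed
  qed
next
  case (3 p)
  then show ?case by (rule E_poly_rational_points)
qed

end
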